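(* There exist constants $C>0$, $\epsilon_0>0$, $\delta_0>0$ such that the following holds for all $\epsilon\in(0,\epsilon_0)$ and $\delta\in(0,\delta_0)$. Let $H$ be a harmonic function on $\mathbb{R}^2$ with $\nabla H(x,y)=\nabla H(x,y+2+\delta)$ for all $(x,y)\in\mathbb{R}^2$, and let $u$ be a solution for $H$ (in the sense of the context). Define $$N_v=\Big\{(x,y):\ |x|<1+\tfrac{\epsilon}{2}-\sqrt{1-y^2},\ |y|<\tfrac{\sqrt3}{2}\Big\},$$ $$N_h=\Big\{(x,y):\ \big|y-1-\tfrac{\delta}{2}\big|<1+\tfrac{\delta}{2}-\sqrt{1-(x-1-\tfrac{\epsilon}{2})^2},\ \big|x-1-\tfrac{\epsilon}{2}\big|<\tfrac{\sqrt3}{2}\Big\},$$ and $$S(x,y)=-2\sqrt{\delta}\,\frac{(x-1-\frac{\epsilon}{2})(y-1-\frac{\delta}{2})}{\big((x-1-\frac{\epsilon}{2})^2+\delta\big)^2}.$$ Then $\|S\|_{L^\infty(N_h)}\le 2$, $S(1+\frac{\epsilon}{2},1+\frac{\delta}{2})=0$, and there exist constants $\lambda,\mu$ and functions $R_1,R_2$ such that $$\nabla u(x,y)=\lambda\Big(\frac{1}{\delta+(x-1-\frac{\epsilon}{2})^2}(0,1)+\frac{1}{\sqrt\delta}S(x,y)(1,0)\Big)+R_1(x,y)\quad\text{for all }(x,y)\in N_h,$$ $$\nabla u(x,y)=\mu\,\frac{\sqrt\epsilon}{\epsilon+y^2}(1,0)+R_2(x,y)\quad\text{for all }(x,y)\in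 N_v,$$ where $\lambda=H(0,1)-H(0,-1)$, $|\mu|\le C\|H\|_{L^\infty(\Omega_4)}$, and $\|R_1\|_{L^\infty(N_h)}+\|R_2\|_{L^\infty(N_v)}\le C\|H\|_{L^\infty(\Omega_4)}$.
   Context: Let $\epsilon,\delta>0$. For each integer $n$, $D_{Rn}$ is the open unit disk centered at $(1+\frac{\epsilon}{2},\,n(2+\delta))$ and $D_{Ln}$ is the open unit disk centered at $(-1-\frac{\epsilon}{2},\,n(2+\delta))$; let $\mathcal D=\bigcup_{n\in\mathbb Z}(D_{Ln}\cup D_{Rn})$. Let $\Omega=\mathbb{R}\times(-1-\frac{\delta}{2},1+\frac{\delta}{2})$ and, for $m\ge 3$, $\Omega_m=\{(x,y)\in\Omega: |x|<m\}$. On disk boundaries, $\nu$ denotes the unit normal pointing into the disk. Given a harmonic $H$ on $\mathbb{R}^2$ with $(2+\delta)$-periodic gradient in $y$, a solution for $H$ is a function $u$ harmonic in $\mathbb{R}^2\setminus\overline{\mathcal D}$ such that: $u$ is constant on $\partial D_{L0}$ and constant on $\partial D_{R0}$; $\int_{\partial D_{L0}}\partial_\nu u\,ds=\int_{\partial D_{R0}}\partial_\nu u\,ds=0$; $\int_{\Omega\setminus\overline{D_{L0}\cup D_{R0}}}|\nabla(u-H)|^2\,dx\,dy<\infty$; and $\nabla u(x,y)=\nabla u(x,y+2+\delta)$ for all $(x,y)\in\mathbb{R}^2\setminus\overline{\mathcal D}$. *)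

theory Defs
  imports "HOL-Analysis.Analysis"
begin

type_synonym pt = "real \<times> real"

definition px :: "(pt \<Rightarrow> real) \<Rightarrow> pt \<Rightarrow> real" where
  "px f p = deriv (\<lambda>t. f (t, snd p)) (fst p)"

definition py :: "(pt \<Rightarrow> real) \<Rightarrow> pt \<Rightarrow> real" where
  "py f p = deriv (\<lambda>t. f (fst p, t)) (snd p)"

definition grad :: "(pt \<Rightarrow> real) \<Rightarrow> pt \<Rightarrow> pt" where
  "grad f p = (px f p, py f p)"

definition harmonic_on :: "pt set \<Rightarrow> (pt \<Rightarrow> real) \<Rightarrow> bool" where
  "harmonic_on S f \<longleftrightarrow> open S \<and> f differentiable_on S
     \<and> px f differentiable_on S \<and> py f differentiable_on S
     \<and> continuous_on S (px (px f)) \<and> continuous_on S (py (px f))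
     \<and> continuous_on S (px (py f)) \<and> continuous_on S (py (py f))
     \<and> (\<forall>p\<in>S. px (px f) p + py (py f) p = 0)"

definition DL :: "real \<Rightarrow> real \<Rightarrow> int \<Rightarrow> pt set" where
  "DL \<epsilon> \<delta> n = ball (-1 - \<epsilon>/2, real_of_int n * (2 + \<delta>)) 1"

definition DR :: "real \<Rightarrow> real \<Rightarrow> int \<Rightarrow> pt set" where
  "DR \<epsilon> \<delta> n = ball (1 + \<epsilon>/2, real_of_int n * (2 + \<delta>)) 1"

definition Dcal :: "real \<Rightarrow> real \<Rightarrow> pt set" where
  "Dcal \<epsilon> \<delta> = (\<Union>n. DL \<epsilon> \<delta> n \<union> DR \<epsilon> \<delta> n)"

definition Omega :: "real \<Rightarrow> pt set" where
  "Omega \<delta> = {p. \<bar>snd p\<bar> < 1 + \<delta>/2}"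

definition Omega_m :: "real \<Rightarrow> real \<Rightarrow> pt set" where
  "Omega_m \<delta> m = {p \<in> Omega \<delta>. \<bar>fst p\<bar> < m}"

text \<open>Zero flux through the unit circle centered at c: with p(theta) = c + (cos theta, sin theta)
  and nu = -(cos theta, sin theta) (pointing into the disk), the one-sided normal derivative
  (approached from outside the disk) exists and integrates (ds = dtheta) to 0.\<close>
definition zero_flux :: "(pt \<Rightarrow> real) \<Rightarrow> pt \<Rightarrow> bool" where
  "zero_flux u c \<longleftrightarrow> (\<exists>g. (\<forall>\<theta>. ((\<lambda>t. (u (c + (cos \<theta>, sin \<theta>))
          - u (c + (1 + t) *\<^sub>R (cos \<theta>, sin \<theta>))) / t) \<longlongrightarrow> g \<theta>) (at_right 0))
      \<and> (g has_integral 0) {0..2*pi})"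

definition const_on :: "(pt \<Rightarrow> real) \<Rightarrow> pt set \<Rightarrow> bool" where
  "const_on u A \<longleftrightarrow> (\<exists>k. \<forall>p\<in>A. u p = k)"

definition is_solution :: "real \<Rightarrow> real \<Rightarrow> (pt \<Rightarrow> real) \<Rightarrow> (pt \<Rightarrow> real) \<Rightarrow> bool" where
  "is_solution \<epsilon> \<delta> H u \<longleftrightarrow>
     harmonic_on (- closure (Dcal \<epsilon> \<delta>)) u
   \<and> continuous_on (- Dcal \<epsilon> \<delta>) u
   \<and> const_on u (frontier (DL \<epsilon> \<delta> 0)) \<and> const_on u (frontier (DR \<epsilon> \<delta> 0))
   \<and> zero_flux u (-1 - \<epsilon>/2, 0) \<and> zero_flux u (1 + \<epsilon>/2, 0)
   \<and> (\<lambda>p. (norm (grad (\<lambda>q. u q - H q) p))\<^sup>2) integrable_on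
        (Omega \<delta> - closure (DL \<epsilon> \<delta> 0 \<union> DR \<epsilon> \<delta> 0))
   \<and> (\<forall>p \<in> - closure (Dcal \<epsilon> \<delta>). grad u p = grad u (fst p, snd p + (2 + \<delta>)))"

definition Nv :: "real \<Rightarrow> pt set" where
  "Nv \<epsilon> = {(x, y). \<bar>x\<bar> < 1 + \<epsilon>/2 - sqrt (1 - y\<^sup>2) \<and> \<bar>y\<bar> < sqrt 3 / 2}"

definition Nh :: "real \<Rightarrow> real \<Rightarrow> pt set" where
  "Nh \<epsilon> \<delta> = {(x, y). \<bar>y - 1 - \<delta>/2\<bar> < 1 + \<delta>/2 - sqrt (1 - (x - 1 - \<epsilon>/2)\<^sup>2)
                 \<and> \<bar>x - 1 - \<epsilon>/2\<bar> < sqrt 3 / 2}"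

definition Sfun :: "real \<Rightarrow> real \<Rightarrow> pt \<Rightarrow> real" where
  "Sfun \<epsilon> \<delta> p = -2 * sqrt \<delta> * ((fst p - 1 - \<epsilon>/2) * (snd p - 1 - \<delta>/2))
                  / ((fst p - 1 - \<epsilon>/2)\<^sup>2 + \<delta>)\<^sup>2"

end

theory Submission
  imports Defs "HOL-Complex_Analysis.Complex_Analysis"
begin

text \<open>
  The vertical increments of \<open>u\<close> and \<open>H\<close> over one period agree, because \<open>u - H\<close> has finite energy on a
  half-infinite cylinder; hence \<open>u - H\<close> is periodic and bounded, and the maximum principle (with a
  logarithmic barrier at infinity) bounds it by its values on the circles. In each gap one subtracts from \<open>u\<close>
  the multiple of the bipolar coordinate of the two neighbouring disks that has the same boundary values.
  The difference vanishes on both arcs, so a logarithmic barrier centred inside a disk shows that it is at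
  most linear in the distance to the arcs, and the interior gradient estimate bounds its gradient uniformly
  in the width of the gap. The gradient of the bipolar coordinate is explicit. In the horizontal direction the
  jump of \<open>u\<close> across the gap is still unknown: adding to \<open>u\<close> its reflection in the axis makes it periodic
  without increment, and vanishing flux then forces the jump to be of order \<open>sqrt \<epsilon>\<close>, since the bipolar
  coordinate carries flux of order one per \<open>sqrt \<epsilon>\<close> of jump.
\<close>

subsection \<open>Harmonic functions of a complex variable\<close>

text \<open>All estimates must hold uniformly as the gaps close, while the constants
  \<open>KR\<close> and \<open>KL\<close> on the two columns are unknown. Every bound is therefore
  first proved in terms of \<open>M\<close> and \<open>K = KR - KL\<close>. The flux argument closes
  the loop: it bounds the coefficient \<kappa> = K / \<alpha> of the bipolar coordinate by a
  constant times M + |K|, whereas |K| is itself at most 2 sqrt \<epsilon> |\<kappa>|, so for small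
  \<epsilon> it is absorbed. Within a column nothing is unknown: consecutive disks differ by the
  increment \<open>P\<close> of H over a period. The theorem has H(0,1) - H(0,-1) in its place; the
  two differ by O(\<delta>), which the profile of size 1/\<delta> turns into a bounded error. The
  increment \<open>P\<close> makes the flux density of u large at the top and the bottom of a disk
  as \<delta> tends to 0. These contributions have opposite signs, and they cancel in the sum of u
  and its reflection. The barrier at a boundary point uses only the disk it is centred in; the other
  disks merely cut down the region. This is why the gap width does not enter.\<close>

text \<open>The function \<open>F\<close> is \<open>f\<^sub>x - i f\<^sub>y\<close>; its holomorphy encodes that \<open>f\<close> is harmonic.\<close>

definition has_cgrad :: "(complex \<Rightarrow> real) \<Rightarrow> (complex \<Rightarrow> complex) \<Rightarrow> complex set \<Rightarrow> bool" where
  "has_cgrad f F W \<longleftrightarrow> open W \<and> F holomorphic_on W \<and>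
     (\<forall>z\<in>W. (f has_derivative (\<lambda>h. Re (F z * h))) (at z))"

lemma has_cgrad_subset: "has_cgrad f F W \<Longrightarrow> open V \<Longrightarrow> V \<subseteq> W \<Longrightarrow> has_cgrad f F V"
  unfolding has_cgrad_def by (meson holomorphic_on_subset subsetD)

lemma has_cgrad_continuous_on: "has_cgrad f F W \<Longrightarrow> continuous_on W f"
  unfolding has_cgrad_def
  by (meson continuous_at_imp_continuous_on has_derivative_continuous)

lemma has_cgrad_add:
  "has_cgrad f F W \<Longrightarrow> has_cgrad g G W \<Longrightarrow> has_cgrad (\<lambda>z. f z + g z) (\<lambda>z. F z + G z) W"
  unfolding has_cgrad_def
  by (auto intro!: holomorphic_intros derivative_eq_intros simp: algebra_simps)

lemma has_cgrad_scale:
  "has_cgrad f F W \<Longrightarrow> has_cgrad (\<lambda>z. a * f z) (\<lambda>z. of_real a * F z) W"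
  unfolding has_cgrad_def
  by (auto intro!: holomorphic_intros derivative_eq_intros simp: algebra_simps)

lemma has_cgrad_diff:
  "has_cgrad f F W \<Longrightarrow> has_cgrad g G W \<Longrightarrow> has_cgrad (\<lambda>z. f z - g z) (\<lambda>z. F z - G z) W"
  unfolding has_cgrad_def
  by (auto intro!: holomorphic_intros derivative_eq_intros simp: algebra_simps)

lemma has_cgrad_minus_const:
  "has_cgrad f F W \<Longrightarrow> has_cgrad (\<lambda>z. f z - c) F W"
  unfolding has_cgrad_def
  by (auto intro!: derivative_eq_intros)

lemma has_cgrad_Re: "open W \<Longrightarrow> has_cgrad Re (\<lambda>_. 1) W"
  unfolding has_cgrad_def by (auto intro!: derivative_eq_intros)

lemma has_cgrad_affine:
  assumes "has_cgrad f F W" "open V" "\<And>z. z \<in> V \<Longrightarrow> c + w * z \<in> W"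
  shows "has_cgrad (\<lambda>z. f (c + w * z)) (\<lambda>z. w * F (c + w * z)) V"
  unfolding has_cgrad_def
proof (intro conjI ballI)
  have "(F \<circ> (\<lambda>z. c + w * z)) holomorphic_on V"
    using assms unfolding has_cgrad_def
    by (intro holomorphic_on_compose_gen[where t = W]) (auto intro!: holomorphic_intros)
  then show "(\<lambda>z. w * F (c + w * z)) holomorphic_on V"
    by (auto intro!: holomorphic_intros simp: o_def)
  fix z assume "z \<in> V"
  then have 1: "(f has_derivative (\<lambda>h. Re (F (c + w * z) * h))) (at (c + w * z))"
    using assms unfolding has_cgrad_def by auto
  have 2: "((\<lambda>z. c + w * z) has_derivative (\<lambda>h. w * h)) (at z)"
    by (auto intro!: derivative_eq_intros)
  from has_derivative_compose[OF 2 1]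
  show "((\<lambda>z. f (c + w * z)) has_derivative (\<lambda>h. Re (w * F (c + w * z) * h))) (at z)"
    by (simp add: algebra_simps)
qed (use assms in auto)

lemma has_cgrad_cnj:
  assumes "has_cgrad f F W" "cnj ` V \<subseteq> W" "open V"
  shows "has_cgrad (\<lambda>z. f (cnj z)) (\<lambda>z. cnj (F (cnj z))) V"
  unfolding has_cgrad_def
proof (intro conjI ballI)
  have "F holomorphic_on cnj ` V"
    using assms unfolding has_cgrad_def by (auto intro: holomorphic_on_subset)
  then have "(cnj \<circ> F \<circ> cnj) holomorphic_on V"
    using assms(3) by (intro holomorphic_on_compose_cnj_cnj)
  then show "(\<lambda>z. cnj (F (cnj z))) holomorphic_on V" by (simp add: o_def)
  fix z assume "z \<in> V"
  then have 1: "(f has_derivative (\<lambda>h. Re (F (cnj z) * h))) (at (cnj z))"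
    using assms unfolding has_cgrad_def by auto
  have 2: "(cnj has_derivative cnj) (at z)"
    by (rule bounded_linear_imp_has_derivative[OF bounded_linear_cnj])
  from has_derivative_compose[OF 2 1]
  show "((\<lambda>z. f (cnj z)) has_derivative (\<lambda>h. Re (cnj (F (cnj z)) * h))) (at z)"
    by simp
qed (use assms in auto)

lemma has_cgrad_ln_norm:
  assumes "open W" "c \<notin> W"
  shows "has_cgrad (\<lambda>z. ln (norm (z - c))) (\<lambda>z. 1 / (z - c)) W"
  unfolding has_cgrad_def
proof (intro conjI ballI)
  show "(\<lambda>z. 1 / (z - c)) holomorphic_on W"
    using assms by (auto intro!: holomorphic_intros)
  fix z assume "z \<in> W"
  then have z: "z - c \<noteq> 0" using assms by auto
  have n: "((\<lambda>z. norm (z - c)) has_derivative (\<lambda>h. inner (sgn (z - c)) h)) (at z)"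
    using has_derivative_compose[OF has_derivative_diff[OF has_derivative_ident has_derivative_const]
        has_derivative_norm[OF z], of UNIV] by (simp add: inner_commute)
  have "((\<lambda>z. ln (norm (z - c))) has_derivative (\<lambda>h. inner (sgn (z - c)) h * inverse (norm (z - c)))) (at z)"
    using z by (auto intro!: derivative_eq_intros n)
  moreover have "inner (sgn (z - c)) h * inverse (norm (z - c)) = Re (1 / (z - c) * h)" for h
  proof -
    have "Re (1 / (z - c) * h) = Re (cnj (z - c) * h) / (norm (z - c))\<^sup>2"
      using z by (simp add: complex_div_cnj [of 1] )
    also have "\<dots> = inner (z - c) h / (norm (z - c))\<^sup>2"
      by (simp add: inner_complex_def algebra_simps)
    also have "\<dots> = inner (sgn (z - c)) h * inverse (norm (z - c))"
      by (simp add: sgn_div_norm power2_eq_square divide_simps)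
    finally show ?thesis by simp
  qed
  ultimately show "((\<lambda>z. ln (norm (z - c))) has_derivative (\<lambda>h. Re (1 / (z - c) * h))) (at z)"
    by simp
qed (use assms in auto)

lemma has_cgrad_DERIV_Re:
  assumes "has_cgrad f F W" "z \<in> W"
  shows "((\<lambda>t. f (z + of_real t * w)) has_real_derivative Re (F z * w)) (at 0)"
proof -
  have 1: "(f has_derivative (\<lambda>h. Re (F z * h))) (at (z + of_real 0 * w))"
    using assms unfolding has_cgrad_def by simp
  have 2: "((\<lambda>t. z + of_real t * w) has_derivative (\<lambda>t. of_real t * w)) (at 0)"
    by (auto intro!: derivative_eq_intros)
  have 3: "(\<lambda>t. Re (F z * (of_real t * w))) = (*) (Re (F z * w))"
    by (auto simp: algebra_simps)
  from has_derivative_compose[OF 2 1] show ?thesis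
    unfolding has_field_derivative_def 3 .
qed

lemma has_cgrad_DERIV_line:
  assumes "has_cgrad f F W" "z + of_real t * w \<in> W"
  shows "((\<lambda>t. f (z + of_real t * w)) has_real_derivative Re (F (z + of_real t * w) * w)) (at t)"
proof -
  have "((\<lambda>s. f ((z + of_real t * w) + of_real s * w)) has_real_derivative Re (F (z + of_real t * w) * w)) (at 0)"
    using has_cgrad_DERIV_Re[OF assms] .
  then show ?thesis
    using DERIV_shift[of "\<lambda>t. f (z + of_real t * w)" "Re (F (z + of_real t * w) * w)" 0 t]
    by (simp add: algebra_simps)
qed

section \<open>Interior gradient estimate\<close>

lemma norm_cgrad_le:
  assumes "has_cgrad f F (ball p r)" "r > 0" and M: "\<And>z. z \<in> ball p r \<Longrightarrow> \<bar>f z\<bar> \<le> M"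
  shows "norm (F p) \<le> exp 2 * M / r"
proof -
  \<comment> \<open>Cauchy's estimate for \<open>exp (G / K)\<close> with \<open>G\<close> a primitive of \<open>F\<close>.\<close>
  have M0: "M \<ge> 0" using M[of p] assms(2) by force
  have est: "norm (F p) \<le> exp 2 * K / s" if K: "K > M" and s: "0 < s" "s < r" for K s
  proof -
    have hol: "F holomorphic_on ball p r" using assms(1) unfolding has_cgrad_def by auto
    obtain G0 where G0: "\<And>x. x \<in> ball p r \<Longrightarrow> (G0 has_field_derivative F x) (at x within ball p r)"
      using holomorphic_convex_primitive'[OF convex_ball open_ball hol] by blast
    \<comment> \<open>The additive constant makes \<open>Re G = f\<close> hold exactly, so the
      modulus of \<open>exp (G / K)\<close> is controlled by the bound on f.\<close>
    define G where "G = (\<lambda>z. G0 z - G0 p + of_real (f p))"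
    have G: "(G has_field_derivative F x) (at x)" if "x \<in> ball p r" for x
      using G0[OF that] at_within_open[OF that open_ball] unfolding G_def
      by (auto intro!: derivative_eq_intros)
    have "((\<lambda>z. Re (G z) - f z) has_derivative (\<lambda>h. 0)) (at x within ball p r)" if x: "x \<in> ball p r" for x
    proof -
      have "(G has_derivative (\<lambda>h. F x * h)) (at x)"
        using G[OF x] by (simp add: has_field_derivative_def)
      moreover have "(f has_derivative (\<lambda>h. Re (F x * h))) (at x)"
        using assms(1) x unfolding has_cgrad_def by auto
      ultimately have "((\<lambda>z. Re (G z) - f z) has_derivative (\<lambda>h. 0)) (at x)"
        by (auto intro!: derivative_eq_intros)
      then show ?thesis by (rule has_derivative_at_withinI)
    qed
    then obtain c where c: "\<And>x. x \<in> ball p r \<Longrightarrow> Re (G x) - f x = c"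
      using has_derivative_zero_constant[OF convex_ball, of p r "\<lambda>z. Re (G z) - f z"] by blast
    have "c = 0" using c[of p] assms(2) by (simp add: G_def)
    then have ReG: "Re (G x) = f x" if "x \<in> ball p r" for x using c[OF that] by simp
    have K0: "K > 0" using K M0 by simp
    define E where "E = (\<lambda>z. exp (G z / of_real K))"
    have nE: "norm (E x) = exp (f x / K)" if "x \<in> ball p r" for x
      using ReG[OF that] by (simp add: E_def)
    have dE: "(E has_field_derivative (F x / of_real K * E x)) (at x)" if "x \<in> ball p r" for x
      unfolding E_def using K0 by (auto intro!: derivative_eq_intros G that)
    have holE: "E holomorphic_on ball p r"
      using dE by (meson holomorphic_on_open open_ball)
    have sub: "cball p s \<subseteq> ball p r" using s by auto
    have "norm ((deriv ^^ 1) E p) \<le> fact 1 * exp 1 / s ^ 1"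
    proof (rule Cauchy_inequality)
      show "E holomorphic_on ball p s" using holE sub by (meson ball_subset_cball holomorphic_on_subset)
      show "continuous_on (cball p s) E"
        using holE sub by (meson continuous_on_subset holomorphic_on_imp_continuous_on)
      fix x assume "norm (p - x) = s"
      then have x: "x \<in> ball p r" using s by (auto simp: dist_norm)
      have "f x / K \<le> 1" using M[OF x] K K0 by (simp add: field_simps)
      then show "norm (E x) \<le> exp 1" using nE[OF x] by simp
    qed (use s in auto)
    moreover have p: "p \<in> ball p r" using assms by simp
    moreover have "deriv E p = F p / of_real K * E p" using dE[OF p] by (rule DERIV_imp_deriv)
    ultimately have le: "norm (F p) / K * exp (f p / K) \<le> exp 1 / s"
      using nE[OF p] K0 by (simp add: norm_mult norm_divide)
    \<comment> \<open>The modulus of \<open>E p\<close> is at least exp (-1); dividing the bound exp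
      1 / s of its derivative by it gives the factor \<open>exp 2\<close>.\<close>
    have "- 1 \<le> f p / K" using M[OF p] K K0 by (simp add: field_simps)
    then have "norm (F p) / K * exp (-1) \<le> norm (F p) / K * exp (f p / K)"
      using K0 by (intro mult_left_mono) auto
    also note le
    finally have "norm (F p) / K * exp (-1) * exp 1 \<le> exp 1 / s * exp 1" by (rule mult_right_mono) simp
    then have "norm (F p) / K \<le> exp 2 / s"
      by (simp add: mult.assoc flip: exp_add)
    then show ?thesis using K0 by (simp add: field_simps)
  qed
  \<comment> \<open>\<open>K\<close> must exceed \<open>M\<close>, which may be 0, and
    \<open>s\<close> must stay below \<open>r\<close>. Both limiting values are reached as t tends
    to 0.\<close>
  have "norm (F p) \<le> exp 2 * (M + t * M + t) / (r * (1 - t))" if "0 < t" "t < 1" for t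
    using est[of "M + t * M + t" "r * (1 - t)"] that M0 assms(2)
    by (simp add: add_nonneg_pos mult_less_cancel_left2)
  then have "eventually (\<lambda>t. norm (F p) \<le> exp 2 * (M + t * M + t) / (r * (1 - t))) (at_right 0)"
    unfolding eventually_at_right_field by (intro exI[of _ 1]) auto
  moreover have "((\<lambda>t. exp 2 * (M + t * M + t) / (r * (1 - t))) \<longlongrightarrow> exp 2 * (M + 0 * M + 0) / (r * (1 - 0))) (at_right 0)"
    using assms(2) by (intro tendsto_intros) auto
  ultimately show ?thesis
    using tendsto_lowerbound[of "\<lambda>t. exp 2 * (M + t * M + t) / (r * (1 - t))" _ "at_right 0" "norm (F p)"]
    by simp
qed

section \<open>Maximum principle on compact sets\<close>

lemma DERIV2_pos_not_local_max:
  fixes f :: "real \<Rightarrow> real"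
  assumes d1: "\<And>t. \<bar>t\<bar> < e \<Longrightarrow> (f has_real_derivative f' t) (at t)" and e: "e > 0"
    and d2: "(f' has_real_derivative l) (at 0)" and l: "l > 0"
    and max: "\<And>t. \<bar>t\<bar> < e \<Longrightarrow> f t \<le> f 0"
  shows False
proof -
  have "f' 0 = 0"
    by (rule DERIV_local_max[OF d1[of 0] e]) (use e max in auto)
  moreover obtain d where d: "d > 0" "\<And>h. h > 0 \<Longrightarrow> h < d \<Longrightarrow> f' 0 < f' (0 + h)"
    using DERIV_pos_inc_right[OF d2 l] by blast
  define h where "h = min d e / 2"
  have h: "0 < h" "h < d" "h < e" using d(1) e by (auto simp: h_def min_def)
  obtain z where z: "0 < z" "z < h" "f h - f 0 = (h - 0) * f' z"
    using MVT2[of 0 h f f'] h d1 by force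
  then have "f' z > 0" using d(2)[of z] h \<open>f' 0 = 0\<close> by simp
  then have "f h > f 0" using z h by (metis diff_gt_0_iff_gt diff_zero mult_pos_pos)
  then show False using max[of h] h by simp
qed

text \<open>The second derivatives of f at p along 1 and \<i> are Re F' and - Re F', with F' the
  derivative of F at p. If Re F' >= 0, the added square makes the second derivative along the real
  direction positive; otherwise the one along the imaginary direction is positive, and there the
  added square is constant.\<close>

lemma cgrad_perturbed_no_local_max:
  assumes f: "has_cgrad f F W" and p: "p \<in> W" and \<eta>: "\<eta> > 0" and r: "r > 0"
    and max: "\<And>q. q \<in> ball p r \<Longrightarrow> f q + \<eta> * (Re q)\<^sup>2 \<le> f p + \<eta> * (Re p)\<^sup>2"
  shows False
proof -
  have W: "open W" and hol: "F holomorphic_on W" using f unfolding has_cgrad_def by auto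
  obtain e0 where e0: "e0 > 0" "ball p e0 \<subseteq> W" using W p by (meson openE)
  define e where "e = min e0 r"
  have e: "e > 0" "ball p e \<subseteq> W" "e \<le> r" using e0 r by (auto simp: e_def)
  obtain F' where F': "(F has_field_derivative F') (at p)"
    using hol W p by (metis holomorphic_on_open)
  have inW: "p + of_real t * w \<in> W" "p + of_real t * w \<in> ball p r" if "\<bar>t\<bar> < e" "norm w = 1" for t w
    using e that by (auto simp: dist_norm norm_mult subset_iff)
  have dF: "((\<lambda>t. Re (F (p + of_real t * w) * w)) has_real_derivative Re (F' * w * w)) (at 0)" for w
  proof -
    have 1: "(F has_derivative (\<lambda>h. F' * h)) (at (p + of_real 0 * w))"
      using F' by (simp add: has_field_derivative_def)
    have 2: "((\<lambda>t. p + of_real t * w) has_derivative (\<lambda>t. of_real t * w)) (at 0)"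
      by (auto intro!: derivative_eq_intros)
    have "((\<lambda>t. Re (F (p + of_real t * w) * w)) has_derivative (\<lambda>t. Re (F' * (of_real t * w) * w))) (at 0)"
      by (intro has_derivative_Re has_derivative_mult_left has_derivative_compose[OF 2 1])
    moreover have "(\<lambda>t. Re (F' * (of_real t * w) * w)) = (*) (Re (F' * w * w))"
      by (auto simp: algebra_simps)
    ultimately show ?thesis unfolding has_field_derivative_def by simp
  qed
  show False
  proof (cases "Re F' \<ge> 0")
    case True
    show False
    proof (rule DERIV2_pos_not_local_max[of e
          "\<lambda>t. f (p + of_real t * 1) + \<eta> * (Re p + t)\<^sup>2"
          "\<lambda>t. Re (F (p + of_real t * 1) * 1) + \<eta> * (2 * (Re p + t))" "Re (F' * 1 * 1) + \<eta> * 2"])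
      fix t :: real assume t: "\<bar>t\<bar> < e"
      show "((\<lambda>t. f (p + of_real t * 1) + \<eta> * (Re p + t)\<^sup>2) has_real_derivative
           Re (F (p + of_real t * 1) * 1) + \<eta> * (2 * (Re p + t))) (at t)"
        using has_cgrad_DERIV_line[OF f inW(1)[OF t, of 1]]
        by (auto intro!: derivative_eq_intros)
      show "f (p + of_real t * 1) + \<eta> * (Re p + t)\<^sup>2 \<le> f (p + of_real 0 * 1) + \<eta> * (Re p + 0)\<^sup>2"
        using max[OF inW(2)[OF t, of 1]] by simp
    next
      show "((\<lambda>t. Re (F (p + of_real t * 1) * 1) + \<eta> * (2 * (Re p + t))) has_real_derivative Re (F' * 1 * 1) + \<eta> * 2) (at 0)"
        by (rule DERIV_add[OF dF]) (auto intro!: derivative_eq_intros)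
    qed (use e \<eta> True in auto)
  next
    case False
    show False
    proof (rule DERIV2_pos_not_local_max[of e
          "\<lambda>t. f (p + of_real t * \<i>)"
          "\<lambda>t. Re (F (p + of_real t * \<i>) * \<i>)" "Re (F' * \<i> * \<i>)"])
      fix t :: real assume t: "\<bar>t\<bar> < e"
      show "((\<lambda>t. f (p + of_real t * \<i>)) has_real_derivative Re (F (p + of_real t * \<i>) * \<i>)) (at t)"
        using has_cgrad_DERIV_line[OF f inW(1)[OF t, of \<i>]] by simp
      show "f (p + of_real t * \<i>) \<le> f (p + of_real 0 * \<i>)"
        using max[OF inW(2)[OF t, of \<i>]] by simp
    next
      show "((\<lambda>t. Re (F (p + of_real t * \<i>) * \<i>)) has_real_derivative Re (F' * \<i> * \<i>)) (at 0)"
        by (rule dF)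
    qed (use e \<eta> False in \<open>auto simp: mult.assoc\<close>)
  qed
qed

lemma cgrad_maximum_principle:
  assumes K: "compact K" and f: "has_cgrad f F W" and WK: "W \<subseteq> K"
    and cont: "continuous_on K f" and bd: "\<And>z. z \<in> K - W \<Longrightarrow> f z \<le> m" and z: "z \<in> K"
  shows "f z \<le> m"
proof (rule ccontr)
  assume less: "\<not> f z \<le> m"
  obtain B where B: "B > 0" "\<And>q. q \<in> K \<Longrightarrow> norm q \<le> B"
    using compact_imp_bounded[OF K] bounded_pos by metis
  \<comment> \<open>With this \<eta> the perturbation is at most half of the excess
    \<open>f z - m\<close> on \<open>K\<close>, so a maximum outside \<open>W\<close> still
    contradicts \<open>bd\<close>.\<close>
  define \<eta> where "\<eta> = (f z - m) / (2 * B\<^sup>2)"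
  have \<eta>: "\<eta> > 0" using less B by (simp add: \<eta>_def)
  have "continuous_on K (\<lambda>q. f q + \<eta> * (Re q)\<^sup>2)"
    by (intro continuous_intros cont)
  then obtain p where p: "p \<in> K" "\<And>q. q \<in> K \<Longrightarrow> f q + \<eta> * (Re q)\<^sup>2 \<le> f p + \<eta> * (Re p)\<^sup>2"
    using continuous_attains_sup[OF K] z by blast
  show False
  proof (cases "p \<in> W")
    case True
    then obtain e where e: "e > 0" "ball p e \<subseteq> W" using f unfolding has_cgrad_def by (meson openE)
    show False
      by (rule cgrad_perturbed_no_local_max[OF f True \<eta> e(1)]) (use p e WK in blast)
  next
    case False
    then have "f p \<le> m" using bd p by blast
    moreover have "(Re p)\<^sup>2 \<le> B\<^sup>2"
      using B(2)[OF p(1)] abs_Re_le_cmod[of p] by (intro abs_le_square_iff[THEN iffD1]) (use B in linarith)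
    then have "\<eta> * (Re p)\<^sup>2 \<le> \<eta> * B\<^sup>2" using \<eta> by simp
    moreover have "\<eta> * B\<^sup>2 = (f z - m) / 2" using B by (simp add: \<eta>_def)
    moreover have "f z + \<eta> * (Re z)\<^sup>2 \<ge> f z" using \<eta> by simp
    ultimately have "f z \<le> m + (f z - m) / 2" using p(2)[OF z] by linarith
    then show False using less by argo
  qed
qed

subsection \<open>Complex gradients of harmonic functions of two real variables\<close>

lemma differentiable_imp_DERIV_px:
  assumes "f differentiable (at (x, y))"
  shows "((\<lambda>t. f (t, y)) has_real_derivative px f (x, y)) (at x)"
proof -
  obtain D where D: "(f has_derivative D) (at (x, y))" using assms by (auto simp: differentiable_def)
  have "((\<lambda>t. (t, y)) has_derivative (\<lambda>t. (t, 0))) (at x)"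
    by (auto intro!: derivative_eq_intros)
  from has_derivative_compose[OF this D] have "(\<lambda>t. f (t, y)) differentiable (at x)"
    by (rule differentiableI)
  then show ?thesis
    unfolding px_def by (auto simp: DERIV_deriv_iff_real_differentiable)
qed

lemma differentiable_imp_DERIV_py:
  assumes "f differentiable (at (x, y))"
  shows "((\<lambda>t. f (x, t)) has_real_derivative py f (x, y)) (at y)"
proof -
  obtain D where D: "(f has_derivative D) (at (x, y))" using assms by (auto simp: differentiable_def)
  have "((\<lambda>t. (x, t)) has_derivative (\<lambda>t. (0, t))) (at y)"
    by (auto intro!: derivative_eq_intros)
  from has_derivative_compose[OF this D] have "(\<lambda>t. f (x, t)) differentiable (at y)"
    by (rule differentiableI)
  then show ?thesis
    unfolding py_def by (auto simp: DERIV_deriv_iff_real_differentiable)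
qed

lemma differentiable_has_derivative_partials:
  assumes "f differentiable (at p)"
  shows "(f has_derivative (\<lambda>h. fst h * px f p + snd h * py f p)) (at p)"
proof -
  obtain x y where p: "p = (x, y)" by (cases p)
  obtain D where D: "(f has_derivative D) (at (x, y))" using assms p by (auto simp: differentiable_def)
  then interpret D: bounded_linear D by (rule has_derivative_bounded_linear)
  have 2: "((\<lambda>t. (t, y)) has_derivative (\<lambda>t. (t, 0))) (at x)"
    by (auto intro!: derivative_eq_intros)
  have "((\<lambda>t. f (t, y)) has_derivative (\<lambda>t. D (t, 0))) (at x)"
    using has_derivative_compose[OF 2 D] .
  moreover have "((\<lambda>t. f (t, y)) has_derivative (*) (px f (x, y))) (at x)"
    using differentiable_imp_DERIV_px[of f x y] assms p by (simp add: has_field_derivative_def)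
  ultimately have 1: "(\<lambda>t. D (t, 0)) = (*) (px f (x, y))" by (rule has_derivative_unique)
  have 3: "((\<lambda>t. (x, t)) has_derivative (\<lambda>t. (0, t))) (at y)"
    by (auto intro!: derivative_eq_intros)
  have "((\<lambda>t. f (x, t)) has_derivative (\<lambda>t. D (0, t))) (at y)"
    using has_derivative_compose[OF 3 D] .
  moreover have "((\<lambda>t. f (x, t)) has_derivative (*) (py f (x, y))) (at y)"
    using differentiable_imp_DERIV_py[of f x y] assms p by (simp add: has_field_derivative_def)
  ultimately have 4: "(\<lambda>t. D (0, t)) = (*) (py f (x, y))" by (rule has_derivative_unique)
  have "D h = fst h * px f p + snd h * py f p" for h
  proof -
    have "D h = D (fst h, 0) + D (0, snd h)" by (simp add: D.add[symmetric])
    then show ?thesis using fun_cong[OF 1] fun_cong[OF 4] p by (simp add: mult.commute)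
  qed
  then have "D = (\<lambda>h. fst h * px f p + snd h * py f p)" by (rule ext)
  then show ?thesis using D p by simp
qed

lemma mixed_difference_MVT:
  fixes u a b :: "real \<Rightarrow> real \<Rightarrow> real"
  assumes h: "h > 0"
    and du: "\<And>s t. x \<le> s \<Longrightarrow> s \<le> x + h \<Longrightarrow> y \<le> t \<Longrightarrow> t \<le> y + h \<Longrightarrow>
      ((\<lambda>s. u s t) has_real_derivative a s t) (at s)"
    and da: "\<And>s t. x \<le> s \<Longrightarrow> s \<le> x + h \<Longrightarrow> y \<le> t \<Longrightarrow> t \<le> y + h \<Longrightarrow>
      (a s has_real_derivative b s t) (at t)"
  obtains s t where "x \<le> s" "s \<le> x + h" "y \<le> t" "t \<le> y + h"
    "u (x + h) (y + h) - u (x + h) y - u x (y + h) + u x y = h * h * b s t"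
proof -
  obtain s where s: "x < s" "s < x + h"
    "(u (x + h) (y + h) - u (x + h) y) - (u x (y + h) - u x y) = (x + h - x) * (a s (y + h) - a s y)"
    using MVT2[of x "x + h" "\<lambda>s. u s (y + h) - u s y" "\<lambda>s. a s (y + h) - a s y"] h
    by (force intro!: DERIV_diff du)
  moreover obtain t where t: "y < t" "t < y + h" "a s (y + h) - a s y = (y + h - y) * b s t"
    using MVT2[of y "y + h" "a s" "b s"] h s by (force intro!: da)
  ultimately show thesis by (intro that[of s t]) auto
qed

text \<open>\<open>harmonic_on\<close> asks for continuous mixed partials, not for their equality.
  The second difference over a small square is h^2 times a value of either mixed partial somewhere
  in the square, and by continuity both values are close to those at \<open>p\<close>.\<close>

lemma harmonic_on_mixed_partials:
  assumes u: "harmonic_on S u" and p: "p \<in> S"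
  shows "py (px u) p = px (py u) p"
proof (rule ccontr)
  assume neq: "py (px u) p \<noteq> px (py u) p"
  define e where "e = \<bar>py (px u) p - px (py u) p\<bar> / 2"
  have e: "e > 0" using neq by (simp add: e_def)
  obtain x y where xy: "p = (x, y)" by (cases p)
  have S: "open S" and c: "continuous_on S (py (px u))" "continuous_on S (px (py u))"
    and df: "\<And>q. q \<in> S \<Longrightarrow> u differentiable (at q)" "\<And>q. q \<in> S \<Longrightarrow> px u differentiable (at q)"
     "\<And>q. q \<in> S \<Longrightarrow> py u differentiable (at q)"
    using u unfolding harmonic_on_def by (auto simp: differentiable_on_eq_differentiable_at)
  obtain d where d: "d > 0" "\<And>q. dist q p < d \<Longrightarrow> q \<in> S \<and> dist (py (px u) q) (py (px u) p) < e
      \<and> dist (px (py u) q) (px (py u) p) < e"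
  proof -
    have "eventually (\<lambda>q. q \<in> S \<and> dist (py (px u) q) (py (px u) p) < e
      \<and> dist (px (py u) q) (px (py u) p) < e) (nhds p)"
    proof (intro eventually_conj)
      show "eventually (\<lambda>q. q \<in> S) (nhds p)" using S p by (simp add: eventually_nhds_in_open)
      show "eventually (\<lambda>q. dist (py (px u) q) (py (px u) p) < e) (nhds p)"
        "eventually (\<lambda>q. dist (px (py u) q) (px (py u) p) < e) (nhds p)"
        using c S p e by (auto simp: continuous_on_eq_continuous_at isCont_def tendsto_at_iff_tendsto_nhds
            intro!: tendstoD)
    qed
    then show thesis using that unfolding eventually_nhds_metric by blast
  qed
  define h where "h = d / 4"
  have h: "h > 0" using d by (simp add: h_def)
  have in_d: "dist (s, t) p < d" if "x \<le> s" "s \<le> x + h" "y \<le> t" "t \<le> y + h" for s t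
  proof -
    have "dist (s, t) p \<le> dist s x + dist t y"
      unfolding xy dist_Pair_Pair by (rule sqrt_sum_squares_le_sum) auto
    then show ?thesis using that d(1) by (simp add: dist_real_def h_def)
  qed
  then have inS: "(s, t) \<in> S" if "x \<le> s" "s \<le> x + h" "y \<le> t" "t \<le> y + h" for s t
    using d(2) that by blast
  obtain s t where st: "x \<le> s" "s \<le> x + h" "y \<le> t" "t \<le> y + h"
    "u (x + h, y + h) - u (x + h, y) - u (x, y + h) + u (x, y) = h * h * py (px u) (s, t)"
    by (rule mixed_difference_MVT[OF h, of x y "\<lambda>s t. u (s, t)" "\<lambda>s t. px u (s, t)" "\<lambda>s t. py (px u) (s, t)"])
      (use inS in \<open>blast intro: differentiable_imp_DERIV_px[OF df(1)] differentiable_imp_DERIV_py[OF df(2)]\<close>)+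
  obtain t' s' where st': "x \<le> s'" "s' \<le> x + h" "y \<le> t'" "t' \<le> y + h"
    "u (x + h, y + h) - u (x, y + h) - u (x + h, y) + u (x, y) = h * h * px (py u) (s', t')"
    by (rule mixed_difference_MVT[OF h, of y x "\<lambda>t s. u (s, t)" "\<lambda>t s. py u (s, t)" "\<lambda>t s. px (py u) (s, t)"])
      (use inS in \<open>blast intro: differentiable_imp_DERIV_py[OF df(1)] differentiable_imp_DERIV_px[OF df(3)]\<close>)+
  have "h * h * py (px u) (s, t) = h * h * px (py u) (s', t')" using st(5) st'(5) by linarith
  then have "py (px u) (s, t) = px (py u) (s', t')" using h by simp
  moreover have "dist (py (px u) (s, t)) (py (px u) p) < e" using d(2) in_d st by blast
  moreover have "dist (px (py u) (s', t')) (px (py u) p) < e" using d(2) in_d st' by blast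
  ultimately have "\<bar>py (px u) p - px (py u) p\<bar> < 2 * e" by (simp add: dist_real_def)
  then show False by (simp add: e_def)
qed

definition cgradient :: "(pt \<Rightarrow> real) \<Rightarrow> complex \<Rightarrow> complex" where
  "cgradient u z = Complex (px u (Re z, Im z)) (- py u (Re z, Im z))"

text \<open>The Cauchy-Riemann equations for u_x - i u_y are the Laplace equation and the symmetry
  of the mixed partials.\<close>

lemma harmonic_on_has_cgrad:
  assumes u: "harmonic_on S u"
  shows "has_cgrad (\<lambda>z. u (Re z, Im z)) (cgradient u) {z. (Re z, Im z) \<in> S}"
  unfolding has_cgrad_def
proof (intro conjI ballI)
  have S: "open S" and df: "\<And>q. q \<in> S \<Longrightarrow> u differentiable (at q)" "\<And>q. q \<in> S \<Longrightarrow> px u differentiable (at q)"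
     "\<And>q. q \<in> S \<Longrightarrow> py u differentiable (at q)" and lap: "\<And>q. q \<in> S \<Longrightarrow> px (px u) q + py (py u) q = 0"
    using u unfolding harmonic_on_def by (auto simp: differentiable_on_eq_differentiable_at)
  have vim: "{z. (Re z, Im z) \<in> S} = (\<lambda>z. (Re z, Im z)) -` S" by auto
  show op: "open {z. (Re z, Im z) \<in> S}"
    unfolding vim using S by (intro open_vimage continuous_intros)
  have D: "((\<lambda>z. (Re z, Im z)) has_derivative (\<lambda>z. (Re z, Im z))) (at z)" for z
    by (auto intro!: derivative_eq_intros)
  have comp: "((\<lambda>z. f (Re z, Im z)) has_derivative
      (\<lambda>h. Re h * px f (Re z, Im z) + Im h * py f (Re z, Im z))) (at z)"
    if "f differentiable (at (Re z, Im z))" for f z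
    using has_derivative_compose[OF D differentiable_has_derivative_partials[OF that]] by simp
  { fix z assume "z \<in> {z. (Re z, Im z) \<in> S}"
    then show "((\<lambda>z. u (Re z, Im z)) has_derivative (\<lambda>h. Re (cgradient u z * h))) (at z)"
      using comp[OF df(1), of z] by (simp add: cgradient_def mult.commute) }
  show "cgradient u holomorphic_on {z. (Re z, Im z) \<in> S}"
    unfolding holomorphic_on_open[OF op]
  proof (intro ballI exI)
    fix z assume "z \<in> {z. (Re z, Im z) \<in> S}"
    then have z: "(Re z, Im z) \<in> S" by simp
    let ?F' = "Complex (px (px u) (Re z, Im z)) (- px (py u) (Re z, Im z))"
    have "cgradient u = (\<lambda>z. of_real (px u (Re z, Im z)) - \<i> * of_real (py u (Re z, Im z)))"
      by (auto simp: cgradient_def complex_eq_iff)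
    moreover have "((\<lambda>z. of_real (px u (Re z, Im z)) - \<i> * of_real (py u (Re z, Im z))) has_derivative (\<lambda>h. ?F' * h)) (at z)"
    proof -
      have yy: "py (py u) (Re z, Im z) = - px (px u) (Re z, Im z)" using lap[OF z] by linarith
      have "((\<lambda>z. of_real (px u (Re z, Im z)) - \<i> * of_real (py u (Re z, Im z))) has_derivative
        (\<lambda>h. of_real (Re h * px (px u) (Re z, Im z) + Im h * py (px u) (Re z, Im z))
           - \<i> * of_real (Re h * px (py u) (Re z, Im z) + Im h * py (py u) (Re z, Im z)))) (at z)"
        by (intro has_derivative_diff has_derivative_mult_right has_derivative_of_real
            comp df z)
      moreover have "(\<lambda>h. of_real (Re h * px (px u) (Re z, Im z) + Im h * py (px u) (Re z, Im z))
           - \<i> * of_real (Re h * px (py u) (Re z, Im z) + Im h * py (py u) (Re z, Im z))) = (\<lambda>h. ?F' * h)"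
        unfolding yy harmonic_on_mixed_partials[OF u z]
        by (intro ext complex_eqI) (simp_all add: mult.commute)
      ultimately show ?thesis by simp
    qed
    ultimately show "(cgradient u has_field_derivative ?F') (at z)"
      by (simp add: has_field_derivative_def)
  qed
qed

subsection \<open>Boundary estimates outside unit disks\<close>

definition cl_ext :: "complex set \<Rightarrow> complex set" where
  "cl_ext Z = {z. \<forall>c\<in>Z. 1 \<le> dist z c}"

text \<open>For infinite \<open>Z\<close> this set need not be open: general lemmas take openness
  from \<open>has_cgrad\<close>, and the array supplies it by local finiteness. Describing the
  domain by centres lets a rotated array be treated in the same way.\<close>

definition op_ext :: "complex set \<Rightarrow> complex set" where
  "op_ext Z = {z. \<forall>c\<in>Z. 1 < dist z c}"

lemma op_ext_subset_cl_ext: "op_ext Z \<subseteq> cl_ext Z"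
  unfolding op_ext_def cl_ext_def by force

lemma closed_cl_ext: "closed (cl_ext Z)"
proof -
  have "cl_ext Z = (\<Inter>c\<in>Z. - ball c 1)" by (auto simp: cl_ext_def dist_commute not_less)
  then show ?thesis by (metis closed_Compl closed_INT open_ball)
qed

lemma upper_linear_bound_near_circle:
  assumes f: "has_cgrad f F (op_ext Z)" and cont: "continuous_on (cl_ext Z) f"
    and c: "c \<in> Z" and q: "dist q c = 1" and s: "s > 0"
    and zero: "\<And>z. z \<in> cl_ext Z - op_ext Z \<Longrightarrow> dist z q \<le> s \<Longrightarrow> f z = 0"
    and bd: "\<And>z. z \<in> cl_ext Z \<Longrightarrow> dist z q \<le> s \<Longrightarrow> f z \<le> M" and M: "M \<ge> 0"
    and z: "z \<in> cl_ext Z" "dist z q \<le> s"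
  shows "f z \<le> 4 / ln (1 + 2 * s\<^sup>2) * M * dist z q"
proof -
  \<comment> \<open>The barrier vanishes at \<open>q\<close>: it is centred in a disk of radius 1/2 touching the circle from inside.\<close>
  define c' where "c' = (c + q) / 2"
  define h where "h = (\<lambda>z. ln (norm (z - c')) + ln 2)"
  \<comment> \<open>At distance \<open>s\<close> from \<open>q\<close> the barrier is at least ln (1
    + 2 s^2) / 2, and \<open>A\<close> times this value is \<open>M\<close>.\<close>
  define A where "A = 2 * M / ln (1 + 2 * s\<^sup>2)"
  have lns: "ln (1 + 2 * s\<^sup>2) > 0" using s by (intro ln_gt_zero) simp
  have A: "A \<ge> 0" using M lns by (simp add: A_def)
  \<comment> \<open>Median formula for the midpoint \<open>c'\<close> of the unit segment from
    \<open>c\<close> to \<open>q\<close>. Outside the disk about \<open>c\<close> it keeps the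
    distance to \<open>c'\<close> at least 1/2, with a gain in its square that is quadratic in the
    distance to \<open>q\<close>.\<close>
  have id: "(norm (z - c'))\<^sup>2 = (norm (z - c))\<^sup>2 / 2 + (norm (z - q))\<^sup>2 / 2 - 1 / 4" for z
  proof -
    have "(norm (q - c))\<^sup>2 = 1" using q by (simp add: dist_norm)
    then have 1: "(Re q - Re c)\<^sup>2 + (Im q - Im c)\<^sup>2 = 1" by (simp add: cmod_power2)
    have 2: "(x - (a + b) / 2)\<^sup>2 = (x - a)\<^sup>2 / 2 + (x - b)\<^sup>2 / 2 - (b - a)\<^sup>2 / 4" for x a b :: real
      by (simp add: power2_eq_square field_simps)
    have 3: "X = a / 2 + b / 2 - e / 4 \<Longrightarrow> Y = c / 2 + d / 2 - g / 4 \<Longrightarrow> e + g = 1 \<Longrightarrow>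
        X + Y = (a + c) / 2 + (b + d) / 2 - 1 / 4" for X Y a b c d e g :: real
      by (simp add: field_simps)
    have eqs: "Re (z - c') = Re z - (Re c + Re q) / 2" "Im (z - c') = Im z - (Im c + Im q) / 2"
      by (simp_all add: c'_def)
    show ?thesis unfolding cmod_power2 eqs unfolding minus_complex.simps
      using 3[OF 2[of "Re z" "Re c" "Re q"] 2[of "Im z" "Im c" "Im q"] 1] .
  qed
  have far: "(norm (z - c'))\<^sup>2 \<ge> 1 / 4 + (norm (z - q))\<^sup>2 / 2" if "z \<in> cl_ext Z" for z
  proof -
    have "1 \<le> norm (z - c)" using that c by (auto simp: cl_ext_def dist_norm)
    then have "1 \<le> (norm (z - c))\<^sup>2" by simp
    then show ?thesis using id[of z] by simp
  qed
  have hlb: "2 * h z \<ge> ln (1 + 2 * (norm (z - q))\<^sup>2)" if "z \<in> cl_ext Z" for z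
  proof -
    have "(norm (z - c'))\<^sup>2 > 0" using far[OF that] zero_le_power2[of "norm (z - q)"] by linarith
    then have "norm (z - c') > 0" by simp
    then have "2 * h z = ln ((2 * norm (z - c'))\<^sup>2)"
      by (subst ln_realpow) (auto simp: h_def ln_mult)
    moreover have "1 + 2 * (norm (z - q))\<^sup>2 \<le> (2 * norm (z - c'))\<^sup>2"
      using far[OF that] by (simp add: power_mult_distrib)
    ultimately show ?thesis
      by (metis add_pos_nonneg ln_mono mult_nonneg_nonneg zero_le_numeral zero_le_power2 zero_less_one)
  qed
  have h0: "h z \<ge> 0" if "z \<in> cl_ext Z" for z
    using order_trans[OF ln_ge_zero[of "1 + 2 * (norm (z - q))\<^sup>2"] hlb[OF that]] by simp
  have c'n: "c' \<notin> cl_ext Z"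
    using far[of c'] zero_le_power2[of "norm (c' - q)"] by auto
  have "f z - A * h z \<le> 0"
  proof (rule cgrad_maximum_principle[where K = "cl_ext Z \<inter> cball q s" and W = "op_ext Z \<inter> ball q s"])
    show "compact (cl_ext Z \<inter> cball q s)" by (simp add: closed_Int_compact closed_cl_ext)
    have op: "open (op_ext Z)" using f by (simp add: has_cgrad_def)
    then have opW: "open (op_ext Z \<inter> ball q s)" by blast
    have "has_cgrad (\<lambda>z. ln (norm (z - c')) - (- ln 2)) (\<lambda>z. 1 / (z - c')) (op_ext Z \<inter> ball q s)"
      using c'n op_ext_subset_cl_ext opW
      by (intro has_cgrad_minus_const has_cgrad_ln_norm) auto
    then have "has_cgrad h (\<lambda>z. 1 / (z - c')) (op_ext Z \<inter> ball q s)" by (simp add: h_def)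
    then show "has_cgrad (\<lambda>z. f z - A * h z) (\<lambda>z. F z - of_real A * (1 / (z - c'))) (op_ext Z \<inter> ball q s)"
      using has_cgrad_subset[OF f opW] by (intro has_cgrad_diff has_cgrad_scale) auto
    show "op_ext Z \<inter> ball q s \<subseteq> cl_ext Z \<inter> cball q s" using op_ext_subset_cl_ext by auto
    show "continuous_on (cl_ext Z \<inter> cball q s) (\<lambda>z. f z - A * h z)"
      unfolding h_def using c'n
      by (intro continuous_intros continuous_on_subset[OF cont]) auto
    show "z \<in> cl_ext Z \<inter> cball q s" using z by (simp add: dist_commute)
    fix w assume w: "w \<in> cl_ext Z \<inter> cball q s - op_ext Z \<inter> ball q s"
    then have w1: "w \<in> cl_ext Z" "dist w q \<le> s" by (auto simp: dist_commute)
    show "f w - A * h w \<le> 0"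
    proof (cases "w \<in> op_ext Z")
      case False
      then show ?thesis using zero w1 A h0[OF w1(1)] by simp
    next
      case True
      then have "dist w q = s" using w by (auto simp: dist_commute)
      then have "2 * h w \<ge> ln (1 + 2 * s\<^sup>2)" using hlb[OF w1(1)] by (simp add: dist_norm)
      then have "A * (2 * h w) \<ge> A * ln (1 + 2 * s\<^sup>2)" using A by (intro mult_left_mono) auto
      moreover have "A * ln (1 + 2 * s\<^sup>2) = 2 * M" using lns by (simp add: A_def)
      ultimately show ?thesis using bd[OF w1] by simp
    qed
  qed
  moreover have "h z \<le> 2 * dist z q"
  proof -
    have "norm (z - c') \<le> norm (z - q) + norm (q - c')" using norm_triangle_ineq[of "z - q" "q - c'"] by simp
    moreover have "norm (q - c') = 1 / 2"
    proof -
      have "q - c' = (q - c) / 2" by (simp add: c'_def field_simps)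
      then have "norm (q - c') = norm (q - c) / 2" by (simp only: norm_divide norm_numeral)
      then show ?thesis using q by (simp add: dist_norm)
    qed
    ultimately have le: "2 * norm (z - c') \<le> 1 + 2 * dist z q" by (simp add: dist_norm)
    have pos: "norm (z - c') > 0" using c'n z by auto
    then have "h z = ln (2 * norm (z - c'))" by (simp add: h_def ln_mult)
    also have "\<dots> \<le> ln (1 + 2 * dist z q)" using le pos by (intro ln_mono) auto
    also have "\<dots> \<le> 2 * dist z q" using ln_add_one_self_le_self by simp
    finally show ?thesis .
  qed
  then have "A * h z \<le> A * (2 * dist z q)" using A by (intro mult_left_mono)
  moreover have "A * (2 * dist z q) = 4 / ln (1 + 2 * s\<^sup>2) * M * dist z q" by (simp add: A_def)
  ultimately show ?thesis by linarith
qed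

lemma linear_bound_near_circle:
  assumes f: "has_cgrad f F (op_ext Z)" and cont: "continuous_on (cl_ext Z) f"
    and c: "c \<in> Z" and q: "dist q c = 1" and s: "s > 0"
    and zero: "\<And>z. z \<in> cl_ext Z - op_ext Z \<Longrightarrow> dist z q \<le> s \<Longrightarrow> f z = 0"
    and bd: "\<And>z. z \<in> cl_ext Z \<Longrightarrow> dist z q \<le> s \<Longrightarrow> \<bar>f z\<bar> \<le> M"
    and z: "z \<in> cl_ext Z" "dist z q \<le> s"
  shows "\<bar>f z\<bar> \<le> 4 / ln (1 + 2 * s\<^sup>2) * M * dist z q"
proof -
  have M: "M \<ge> 0" using bd[OF z] by linarith
  have "f z \<le> 4 / ln (1 + 2 * s\<^sup>2) * M * dist z q"
    by (rule upper_linear_bound_near_circle[OF f cont c q s zero _ M z]) (use bd in force)+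
  moreover have "-1 * f z \<le> 4 / ln (1 + 2 * s\<^sup>2) * M * dist z q"
    by (rule upper_linear_bound_near_circle[OF has_cgrad_scale[OF f, of "-1"] _ c q s _ _ M z])
      (use bd zero in \<open>force intro!: continuous_intros cont\<close>)+
  ultimately show ?thesis by linarith
qed

text \<open>\<open>exp 2\<close> comes from the gradient estimate. The first summand is twice the
  barrier slope at radius 1/10, because points of a ball touching the boundary at \<open>q\<close>
  are within two radii of \<open>q\<close>; 20 is the inverse of the radius 1/20 of an interior
  ball.\<close>

definition gapC :: real where
  "gapC = exp 2 * (8 / ln (1 + 2 * (1 / 10)\<^sup>2) + 20)"

lemma gapC_pos: "gapC > 0"
  unfolding gapC_def by (intro mult_pos_pos add_nonneg_pos divide_nonneg_pos ln_gt_zero) auto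

text \<open>The distance r from \<open>p\<close> to the boundary cancels: on \<open>ball p r\<close>
  the function is of size \<open>M * r\<close>, and the gradient estimate divides by r. If
  \<open>p\<close> has room 1/20, the plain bound \<open>M\<close> is enough. The width of a gap
  does not matter, since \<open>zero\<close> covers all circles near \<open>p\<close>.\<close>

lemma norm_cgrad_le_near_circles:
  assumes f: "has_cgrad f F (op_ext Z)" and cont: "continuous_on (cl_ext Z) f"
    and p: "p \<in> op_ext Z"
    and zero: "\<And>z. z \<in> cl_ext Z - op_ext Z \<Longrightarrow> dist z p \<le> 1 / 5 \<Longrightarrow> f z = 0"
    and bd: "\<And>z. z \<in> cl_ext Z \<Longrightarrow> dist z p \<le> 1 / 5 \<Longrightarrow> \<bar>f z\<bar> \<le> M"
  shows "norm (F p) \<le> gapC * M"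
proof -
  define l where "l = 8 / ln (1 + 2 * (1 / 10 :: real)\<^sup>2)"
  have l: "l > 0" unfolding l_def by (intro divide_pos_pos ln_gt_zero) auto
  have M: "M \<ge> 0" using bd[of p] p op_ext_subset_cl_ext by fastforce
  have op: "open (op_ext Z)" using f by (simp add: has_cgrad_def)
  show ?thesis
  proof (cases "ball p (1 / 20) \<subseteq> op_ext Z")
    case True
    have "norm (F p) \<le> exp 2 * M / (1 / 20)"
      using subsetD[OF subset_trans[OF True op_ext_subset_cl_ext]]
      by (intro norm_cgrad_le[OF has_cgrad_subset[OF f _ True]] bd) (auto simp: dist_commute)
    also have "\<dots> \<le> gapC * M"
      using M l by (simp add: gapC_def l_def[symmetric] algebra_simps)
    finally show ?thesis .
  next
    case False
    then obtain w where w: "w \<in> - op_ext Z" "dist p w < 1 / 20" by (meson ComplI mem_ball subsetI)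
    obtain v where v: "v \<in> - op_ext Z" "\<And>y. y \<in> - op_ext Z \<Longrightarrow> dist p v \<le> dist p y"
      using distance_attains_inf[of "- op_ext Z" p] op w(1) by (metis closed_Compl empty_iff)
    obtain c where c: "c \<in> Z" "dist v c \<le> 1" using v(1) by (auto simp: op_ext_def)
    have pc: "dist p c > 1" using p c by (auto simp: op_ext_def)
    \<comment> \<open>Radial projection of \<open>p\<close> to the circle about \<open>c\<close>. As
      \<open>v\<close> is a nearest point of the complement and lies in the closed disk about
      \<open>c\<close>, \<open>q\<close> is a nearest point too.\<close>
    define q where "q = c + (p - c) / of_real (norm (p - c))"
    define r where "r = dist p q"
    have n0: "norm (p - c) > 1" using pc by (simp add: dist_norm)
    then have "p \<noteq> c" by auto
    have qc: "dist q c = 1" using n0 \<open>p \<noteq> c\<close> by (simp add: q_def dist_norm norm_divide)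
    have "p - q = (p - c) * of_real (1 - 1 / norm (p - c))"
      using n0 \<open>p \<noteq> c\<close> by (simp add: q_def field_simps)
    then have "norm (p - q) = norm (p - c) * \<bar>1 - 1 / norm (p - c)\<bar>"
      by (metis norm_mult norm_of_real)
    also have "\<dots> = norm (p - c) * (1 - 1 / norm (p - c))" using n0 by (simp add: divide_le_eq)
    also have "\<dots> = norm (p - c) - 1" using n0 \<open>p \<noteq> c\<close> by (simp add: right_diff_distrib)
    finally have r: "r = dist p c - 1" by (simp add: r_def dist_norm)
    then have "r \<le> dist p v" using c(2) dist_triangle[of p c v] by simp
    then have rmin: "\<And>y. y \<in> - op_ext Z \<Longrightarrow> r \<le> dist p y" using v(2) by force
    have r20: "r < 1 / 20" using rmin[OF w(1)] w(2) by simp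
    have r0: "r > 0" using r pc by simp
    have sub: "ball p r \<subseteq> op_ext Z" using rmin by force
    have "norm (F p) \<le> exp 2 * (l * M * r) / r"
    proof (rule norm_cgrad_le[OF has_cgrad_subset[OF f _ sub] r0])
      fix z assume z: "z \<in> ball p r"
      \<comment> \<open>The barrier neighbourhood of radius 1/10 about \<open>q\<close>, together
        with r < 1/20, stays within the radius 1/5 about \<open>p\<close> that the hypotheses
        cover.\<close>
      have tri: "dist y p \<le> 1 / 5" if "dist y q \<le> 1 / 10" for y
        using dist_triangle[of y p q] that r20 by (simp add: r_def dist_commute)
      have zq: "dist z q \<le> 2 * r" using dist_triangle[of z q p] z by (simp add: r_def dist_commute)
      have "\<bar>f z\<bar> \<le> 4 / ln (1 + 2 * (1 / 10)\<^sup>2) * M * dist z q"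
      proof (rule linear_bound_near_circle[OF f cont c(1) qc])
        show "z \<in> cl_ext Z" using z sub op_ext_subset_cl_ext by blast
      qed (use tri zero bd zq r20 in auto)
      also have "\<dots> \<le> 4 / ln (1 + 2 * (1 / 10)\<^sup>2) * M * (2 * r)"
        using zq M l by (intro mult_left_mono) (auto simp: l_def zero_le_divide_iff)
      also have "\<dots> = l * M * r" by (simp add: l_def)
      finally show "\<bar>f z\<bar> \<le> l * M * r" .
    qed simp
    also have "\<dots> \<le> gapC * M"
      using M r0 l by (simp add: gapC_def l_def[symmetric] algebra_simps)
    finally show ?thesis .
  qed
qed

subsection \<open>Bipolar coordinates\<close>

definition bip_a :: "real \<Rightarrow> real" where "bip_a \<gamma> = sqrt (\<gamma> + \<gamma>\<^sup>2 / 4)"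

text \<open>This is arcosh (1 + \<gamma> / 2), the value of the bipolar coordinate on the right-hand
  circle.\<close>

definition bip_alpha :: "real \<Rightarrow> real" where "bip_alpha \<gamma> = ln (1 + \<gamma> / 2 + bip_a \<gamma>)"

text \<open>Bipolar coordinate of the unit disks centred at \<open>\<plusminus>(1 + \<gamma>/2)\<close>, whose common
  inverse points are \<open>\<plusminus>bip_a \<gamma>\<close>.\<close>

definition bip :: "real \<Rightarrow> complex \<Rightarrow> real" where
  "bip \<gamma> z = ln (norm (z - (- of_real (bip_a \<gamma>)))) - ln (norm (z - of_real (bip_a \<gamma>)))"

definition bip' :: "real \<Rightarrow> complex \<Rightarrow> complex" where
  "bip' \<gamma> z = 1 / (z - (- of_real (bip_a \<gamma>))) - 1 / (z - of_real (bip_a \<gamma>))"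

lemma bip_a_sq: "\<gamma> > 0 \<Longrightarrow> (bip_a \<gamma>)\<^sup>2 = \<gamma> + \<gamma>\<^sup>2 / 4"
  by (simp add: bip_a_def)

lemma bip_a_pos: "\<gamma> > 0 \<Longrightarrow> bip_a \<gamma> > 0"
  by (simp add: bip_a_def add_pos_nonneg)

lemma bip_a_bounds:
  assumes "\<gamma> > 0"
  shows "\<gamma> / 2 < bip_a \<gamma>" "bip_a \<gamma> < 1 + \<gamma> / 2"
proof -
  have "(\<gamma> / 2)\<^sup>2 = \<gamma>\<^sup>2 / 4" "(1 + \<gamma> / 2)\<^sup>2 = 1 + \<gamma> + \<gamma>\<^sup>2 / 4"
    by (simp_all add: power2_eq_square field_simps)
  then have "(\<gamma> / 2)\<^sup>2 < (bip_a \<gamma>)\<^sup>2" "(bip_a \<gamma>)\<^sup>2 < (1 + \<gamma> / 2)\<^sup>2"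
    using bip_a_sq[OF assms] assms by simp_all
  then show "\<gamma> / 2 < bip_a \<gamma>" "bip_a \<gamma> < 1 + \<gamma> / 2"
    using power_less_imp_less_base[of _ 2] bip_a_pos[OF assms] assms by fastforce+
qed

lemma bip_a_eq:
  assumes "\<gamma> > 0" shows "(1 + \<gamma> / 2 - bip_a \<gamma>) * (1 + \<gamma> / 2 + bip_a \<gamma>) = 1"
  using bip_a_sq[OF assms] by (simp add: power2_eq_square algebra_simps)

lemma bip_minus: "bip \<gamma> (- z) = - bip \<gamma> z"
proof -
  have "norm (- z + of_real (bip_a \<gamma>)) = norm (z - of_real (bip_a \<gamma>))"
    by (metis add.commute minus_diff_eq norm_minus_cancel uminus_add_conv_diff)
  moreover have "norm (- z - of_real (bip_a \<gamma>)) = norm (z + of_real (bip_a \<gamma>))"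
    by (metis minus_add_distrib norm_minus_cancel uminus_add_conv_diff add.commute diff_conv_add_uminus)
  ultimately show ?thesis by (simp add: bip_def)
qed

text \<open>Circles of Apollonius: the level sets of the quotient of the distances to the two poles
  are circles. The pole a satisfies a^2 = C^2 - 1 with C = 1 + \<gamma> / 2, which makes one of them
  the unit circle about C.\<close>

lemma norm_bip_a_identity:
  fixes z :: complex
  assumes \<gamma>: "\<gamma> > 0"
  shows "(norm (z - of_real (bip_a \<gamma>)))\<^sup>2 * (1 + \<gamma> / 2 + bip_a \<gamma>) - (norm (z + of_real (bip_a \<gamma>)))\<^sup>2 * (1 + \<gamma> / 2 - bip_a \<gamma>)
    = 2 * bip_a \<gamma> * ((dist z (of_real (1 + \<gamma> / 2)))\<^sup>2 - 1)"
proof -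
  have 1: "(bip_a \<gamma>)\<^sup>2 = (1 + \<gamma> / 2)\<^sup>2 - 1"
    unfolding bip_a_sq[OF \<gamma>] by (simp add: power2_eq_square field_simps)
  have 2: "((x - a)\<^sup>2 + y\<^sup>2) * (C + a) - ((x + a)\<^sup>2 + y\<^sup>2) * (C - a) = 2 * a * ((x - C)\<^sup>2 + y\<^sup>2 - 1)"
    if "a\<^sup>2 = C\<^sup>2 - 1" for x y a C :: real
    using that by algebra
  show ?thesis
    using 2[OF 1, of "Re z" "Im z"] by (simp add: dist_norm cmod_power2)
qed

text \<open>Multiplying \<open>norm_bip_a_identity\<close> by C + a and using (C - a)(C + a) = 1
  compares the quotient of the squared distances with (C + a)^2. At the pole -a the convention
  \<open>ln 0 = 0\<close> would give a meaningless value; the other pole lies in the disk.\<close>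

lemma bip_le:
  assumes \<gamma>: "\<gamma> > 0" and z: "1 \<le> dist z (of_real (1 + \<gamma> / 2))" "z \<noteq> - of_real (bip_a \<gamma>)"
  shows "bip \<gamma> z \<le> bip_alpha \<gamma>" and "dist z (of_real (1 + \<gamma> / 2)) = 1 \<Longrightarrow> bip \<gamma> z = bip_alpha \<gamma>"
proof -
  let ?a = "bip_a \<gamma>" and ?C = "1 + \<gamma> / 2"
  note b = bip_a_bounds[OF \<gamma>] bip_a_pos[OF \<gamma>]
  have "z \<noteq> of_real ?a"
  proof
    assume "z = of_real ?a"
    then have "dist z (of_real ?C) = \<bar>?a - ?C\<bar>" by (metis dist_of_real dist_real_def)
    then show False using z b by simp
  qed
  then have B: "norm (z - of_real ?a) > 0" and A: "norm (z + of_real ?a) > 0" 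
    using z(2) by (auto simp: eq_neg_iff_add_eq_0)
  have q: "(norm (z - of_real ?a))\<^sup>2 * (?C + ?a)\<^sup>2 - (norm (z + of_real ?a))\<^sup>2
      = (?C + ?a) * (2 * ?a * ((dist z (of_real ?C))\<^sup>2 - 1))"
  proof -
    have "B * C\<^sup>2 - A = C * E" if "B * C - A * D = E" "D * C = 1" for A B C D E :: real
    proof -
      have "C * E = B * C\<^sup>2 - A * (D * C)"
        unfolding that(1)[symmetric] by (simp add: algebra_simps power2_eq_square)
      then show ?thesis using that(2) by simp
    qed
    from this[OF norm_bip_a_identity[OF \<gamma>, of z] bip_a_eq[OF \<gamma>]] show ?thesis .
  qed
  have e: "bip \<gamma> z = ln (norm (z + of_real ?a)) - ln (norm (z - of_real ?a))"
    by (simp add: bip_def)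
  have e2: "ln (norm (z - of_real ?a) * (?C + ?a)) = ln (norm (z - of_real ?a)) + bip_alpha \<gamma>"
    using B b \<gamma> unfolding bip_alpha_def by (subst ln_mult) auto
  have "1 \<le> (dist z (of_real ?C))\<^sup>2" using z(1) by (rule one_le_power)
  have "(norm (z + of_real ?a))\<^sup>2 \<le> (norm (z - of_real ?a) * (?C + ?a))\<^sup>2"
  proof -
    have "0 \<le> (?C + ?a) * (2 * ?a * ((dist z (of_real ?C))\<^sup>2 - 1))"
      using \<open>1 \<le> (dist z (of_real ?C))\<^sup>2\<close> b(3) \<gamma> by (intro mult_nonneg_nonneg) auto
    then show ?thesis unfolding power_mult_distrib using q by linarith
  qed
  then have "norm (z + of_real ?a) \<le> norm (z - of_real ?a) * (?C + ?a)"
    by (rule power2_le_imp_le) (use B b \<gamma> in auto)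
  then have "ln (norm (z + of_real ?a)) \<le> ln (norm (z - of_real ?a) * (?C + ?a))" using A by (intro ln_mono) auto
  then show "bip \<gamma> z \<le> bip_alpha \<gamma>" using e e2 by simp
  assume "dist z (of_real ?C) = 1"
  then have "(norm (z + of_real ?a))\<^sup>2 = (norm (z - of_real ?a) * (?C + ?a))\<^sup>2"
    using q by (simp add: power_mult_distrib)
  then have "norm (z + of_real ?a) = norm (z - of_real ?a) * (?C + ?a)"
    using B b \<gamma> by (subst (asm) power2_eq_iff_nonneg) auto
  then show "bip \<gamma> z = bip_alpha \<gamma>" using e e2 by simp
qed

lemma bip_a_in_disk:
  assumes \<gamma>: "\<gamma> > 0"
  shows "dist (of_real (bip_a \<gamma>)) (of_real (1 + \<gamma> / 2) :: complex) < 1"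
    "dist (- of_real (bip_a \<gamma>)) (- of_real (1 + \<gamma> / 2) :: complex) < 1"
proof -
  show 1: "dist (of_real (bip_a \<gamma>)) (of_real (1 + \<gamma> / 2) :: complex) < 1"
    unfolding dist_of_real dist_real_def using bip_a_bounds[OF \<gamma>] by simp
  then show "dist (- of_real (bip_a \<gamma>)) (- of_real (1 + \<gamma> / 2) :: complex) < 1"
    by (metis dist_minus)
qed

text \<open>\<open>bip\<close> is odd, so \<open>bip_le\<close> for z and for -z gives both
  halves.\<close>

lemma bip_outside:
  assumes \<gamma>: "\<gamma> > 0" and z: "1 \<le> dist z (of_real (1 + \<gamma> / 2))" "1 \<le> dist z (- of_real (1 + \<gamma> / 2))"
  shows "\<bar>bip \<gamma> z\<bar> \<le> bip_alpha \<gamma>"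
    and "dist z (of_real (1 + \<gamma> / 2)) = 1 \<Longrightarrow> bip \<gamma> z = bip_alpha \<gamma>"
    and "dist z (- of_real (1 + \<gamma> / 2)) = 1 \<Longrightarrow> bip \<gamma> z = - bip_alpha \<gamma>"
proof -
  note d = bip_a_in_disk[OF \<gamma>]
  have n1: "z \<noteq> - of_real (bip_a \<gamma>)" using z(2) d(2) by (auto simp: not_less[symmetric])
  have n2: "- z \<noteq> - of_real (bip_a \<gamma>)" using z(1) d(1) by (auto simp: not_less[symmetric])
  have m: "dist (- z) (of_real (1 + \<gamma> / 2)) = dist z (- of_real (1 + \<gamma> / 2))"
    by (metis dist_minus minus_minus)
  note r = bip_le[OF \<gamma> z(1) n1] bip_le[OF \<gamma> _ n2, unfolded m, OF z(2)]
  show "\<bar>bip \<gamma> z\<bar> \<le> bip_alpha \<gamma>" using r(1,3) by (simp add: bip_minus abs_le_iff)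
  show "dist z (of_real (1 + \<gamma> / 2)) = 1 \<Longrightarrow> bip \<gamma> z = bip_alpha \<gamma>" by (rule r(2))
  show "dist z (- of_real (1 + \<gamma> / 2)) = 1 \<Longrightarrow> bip \<gamma> z = - bip_alpha \<gamma>"
    using r(4) by (simp add: bip_minus)
qed

lemma has_cgrad_bip:
  assumes \<gamma>: "\<gamma> > 0" and W: "open W"
    and out: "\<And>z. z \<in> W \<Longrightarrow> 1 \<le> dist z (of_real (1 + \<gamma> / 2))" "\<And>z. z \<in> W \<Longrightarrow> 1 \<le> dist z (- of_real (1 + \<gamma> / 2))"
  shows "has_cgrad (bip \<gamma>) (bip' \<gamma>) W"
  unfolding bip_def[abs_def] bip'_def[abs_def]
  using out bip_a_in_disk[OF \<gamma>] W by (intro has_cgrad_diff has_cgrad_ln_norm) (auto simp: not_less[symmetric])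

lemma continuous_on_bip:
  assumes \<gamma>: "\<gamma> > 0"
    and out: "\<And>z. z \<in> W \<Longrightarrow> 1 \<le> dist z (of_real (1 + \<gamma> / 2))" "\<And>z. z \<in> W \<Longrightarrow> 1 \<le> dist z (- of_real (1 + \<gamma> / 2))"
  shows "continuous_on W (bip \<gamma>)"
  unfolding bip_def[abs_def]
  using out bip_a_in_disk[OF \<gamma>] by (intro continuous_intros) (auto simp: not_less[symmetric] eq_neg_iff_add_eq_0[symmetric])

section \<open>Size of the bipolar constants for narrow gaps\<close>

lemma bip_alpha_arsinh: "\<gamma> > 0 \<Longrightarrow> bip_alpha \<gamma> = arsinh (bip_a \<gamma>)"
proof -
  assume \<gamma>: "\<gamma> > 0"
  have "(bip_a \<gamma>)\<^sup>2 + 1 = (1 + \<gamma> / 2)\<^sup>2" unfolding bip_a_sq[OF \<gamma>] by (simp add: power2_eq_square field_simps)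
  then have "sqrt ((bip_a \<gamma>)\<^sup>2 + 1) = 1 + \<gamma> / 2" using \<gamma> by simp
  then show ?thesis by (simp add: bip_alpha_def arsinh_real_def add.commute)
qed

lemma arsinh_bounds:
  fixes t :: real assumes t: "0 \<le> t"
  shows "arsinh t \<le> t" "t - t ^ 3 / 2 \<le> arsinh t"
proof -
  have s: "1 \<le> sqrt (x\<^sup>2 + 1)" for x :: real by simp
  show "arsinh t \<le> t"
  proof -
    have "arsinh 0 - 0 \<ge> arsinh t - t"
      using t
    proof (rule DERIV_nonpos_imp_nonincreasing)
      fix x :: real
      have "((\<lambda>t. arsinh t - t) has_real_derivative (1 / sqrt (x\<^sup>2 + 1) - 1)) (at x)"
        by (intro DERIV_diff arsinh_real_has_field_derivative DERIV_ident)
      moreover have "1 / sqrt (x\<^sup>2 + 1) \<le> 1 / 1"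
        by (intro divide_left_mono s) (auto simp: add_nonneg_pos)
      then have "1 / sqrt (x\<^sup>2 + 1) - 1 \<le> 0" by simp
      ultimately show "\<exists>y. ((\<lambda>t. arsinh t - t) has_real_derivative y) (at x) \<and> y \<le> 0" by blast
    qed
    then show ?thesis by simp
  qed
  show "t - t ^ 3 / 2 \<le> arsinh t"
  proof -
    have "arsinh 0 - (0 - 0 ^ 3 / 2) \<le> arsinh t - (t - t ^ 3 / 2)"
      using t
    proof (rule DERIV_nonneg_imp_nondecreasing)
      fix x :: real
      have "((\<lambda>t. arsinh t - (t - t ^ 3 / 2)) has_real_derivative (1 / sqrt (x\<^sup>2 + 1) - (1 - 3 * x\<^sup>2 / 2))) (at x)"
        by (rule DERIV_diff[OF arsinh_real_has_field_derivative]) (auto intro!: derivative_eq_intros)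
      moreover have "1 / sqrt (x\<^sup>2 + 1) - (1 - 3 * x\<^sup>2 / 2) \<ge> 0"
      proof -
        have "sqrt (x\<^sup>2 + 1) \<le> 1 + x\<^sup>2"
          by (rule real_le_lsqrt) (auto simp: power2_eq_square distrib_left distrib_right)
        then have "1 / (1 + x\<^sup>2) \<le> 1 / sqrt (x\<^sup>2 + 1)" by (intro divide_left_mono mult_pos_pos) (auto simp: add_pos_nonneg add_nonneg_pos)
        moreover have "1 - x\<^sup>2 \<le> 1 / (1 + x\<^sup>2)"
          by (simp add: le_divide_eq add_pos_nonneg algebra_simps)
        ultimately show ?thesis using zero_le_power2[of x] by linarith
      qed
      ultimately show "\<exists>y. ((\<lambda>t. arsinh t - (t - t ^ 3 / 2)) has_real_derivative y) (at x) \<and> 0 \<le> y" by blast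
    qed
    then show ?thesis by simp
  qed
qed

text \<open>The quotient a / \<alpha> will multiply a function as large as 1/\<gamma>, so its
  distance from 1 has to be of order \<gamma>. This is what the cubic term in the lower bound of
  \<open>arsinh\<close> is for.\<close>

lemma bip_alpha_bounds:
  assumes \<gamma>: "0 < \<gamma>" "\<gamma> \<le> 1 / 10"
  shows "0 < bip_alpha \<gamma>" "bip_alpha \<gamma> \<le> bip_a \<gamma>" "bip_a \<gamma> / bip_alpha \<gamma> - 1 \<le> 2 * \<gamma>" "bip_a \<gamma> \<le> 2 * sqrt \<gamma>"
proof -
  let ?a = "bip_a \<gamma>" and ?\<alpha> = "bip_alpha \<gamma>"
  have a: "?a > 0" using bip_a_pos \<gamma> by blast
  have a2: "?a\<^sup>2 = \<gamma> + \<gamma>\<^sup>2 / 4" using \<gamma> by (simp add: bip_a_sq)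
  have "\<gamma>\<^sup>2 \<le> \<gamma> * (1 / 10)" unfolding power2_eq_square using \<gamma> by (intro mult_left_mono) auto
  then have a2': "?a\<^sup>2 \<le> 2 * \<gamma>" "?a\<^sup>2 \<le> 1 / 2" using a2 \<gamma> by simp_all
  show pos: "0 < ?\<alpha>" and le: "?\<alpha> \<le> ?a" using arsinh_bounds[of ?a] a \<gamma> by (simp_all add: bip_alpha_arsinh)
  have "?a * (1 - ?a\<^sup>2 / 2) \<le> ?\<alpha>" using arsinh_bounds(2)[of ?a] a \<gamma> 
    by (simp add: bip_alpha_arsinh power2_eq_square power3_eq_cube algebra_simps)
  then have "?a * (1 - ?a\<^sup>2 / 2) * (1 + ?a\<^sup>2) \<le> ?\<alpha> * (1 + ?a\<^sup>2)" by (intro mult_right_mono) auto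
  moreover have "(1 - ?a\<^sup>2 / 2) * (1 + ?a\<^sup>2) \<ge> 1"
  proof -
    have "(1 - ?a\<^sup>2 / 2) * (1 + ?a\<^sup>2) = 1 + ?a\<^sup>2 * (1 - ?a\<^sup>2) / 2" by (simp add: field_simps)
    moreover have "?a\<^sup>2 * (1 - ?a\<^sup>2) \<ge> 0" using a2' by (intro mult_nonneg_nonneg) auto
    ultimately show ?thesis by linarith
  qed
  then have "?a * ((1 - ?a\<^sup>2 / 2) * (1 + ?a\<^sup>2)) \<ge> ?a * 1" using a by (intro mult_left_mono) auto
  ultimately have "?a \<le> ?\<alpha> * (1 + ?a\<^sup>2)" by (simp add: mult.assoc)
  then have "?a / ?\<alpha> \<le> 1 + ?a\<^sup>2" using pos by (simp add: divide_le_eq mult.commute)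
  then show "?a / ?\<alpha> - 1 \<le> 2 * \<gamma>" using a2' by linarith
  have "?a\<^sup>2 \<le> (2 * sqrt \<gamma>)\<^sup>2" using a2' \<gamma> by (simp add: power_mult_distrib)
  then show "?a \<le> 2 * sqrt \<gamma>" by (rule power2_le_imp_le) (use \<gamma> in auto)
qed

section \<open>Gradient in a gap between two disks\<close>

lemma gap_gradient:
  assumes \<gamma>: "0 < \<gamma>" "\<gamma> \<le> 1 / 10" and U: "has_cgrad U G (op_ext Z)" and cont: "continuous_on (cl_ext Z) U"
    and Z: "of_real (1 + \<gamma> / 2) \<in> Z" "- of_real (1 + \<gamma> / 2) \<in> Z"
    and k1: "\<And>z. z \<in> cl_ext Z \<Longrightarrow> dist z (of_real (1 + \<gamma> / 2)) = 1 \<Longrightarrow> U z = k1"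
    and k2: "\<And>z. z \<in> cl_ext Z \<Longrightarrow> dist z (- of_real (1 + \<gamma> / 2)) = 1 \<Longrightarrow> U z = k2"
    and p: "p \<in> op_ext Z"
    and far: "\<And>c. c \<in> Z \<Longrightarrow> c \<noteq> of_real (1 + \<gamma> / 2) \<Longrightarrow> c \<noteq> - of_real (1 + \<gamma> / 2) \<Longrightarrow> 6 / 5 < dist p c"
    and bd: "\<And>z. z \<in> cl_ext Z \<Longrightarrow> dist z p \<le> 1 / 5 \<Longrightarrow> \<bar>U z - (k1 + k2) / 2\<bar> \<le> M0"
  shows "norm (G p - of_real ((k1 - k2) / (2 * bip_alpha \<gamma>)) * bip' \<gamma> p) \<le> gapC * (M0 + \<bar>k1 - k2\<bar> / 2)"
proof -
  define \<kappa> where "\<kappa> = (k1 - k2) / (2 * bip_alpha \<gamma>)"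
  have al: "bip_alpha \<gamma> > 0" using bip_alpha_bounds[OF \<gamma>] by simp
  then have \<kappa>: "\<kappa> * bip_alpha \<gamma> = (k1 - k2) / 2" by (simp add: \<kappa>_def)
  have op: "open (op_ext Z)" using U by (simp add: has_cgrad_def)
  have out: "1 \<le> dist z (of_real (1 + \<gamma> / 2))" "1 \<le> dist z (- of_real (1 + \<gamma> / 2))" if "z \<in> cl_ext Z" for z
    using that Z by (auto simp: cl_ext_def)
  note out' = out[OF subsetD[OF op_ext_subset_cl_ext]]
  let ?f = "\<lambda>z. (U z - (k1 + k2) / 2) - \<kappa> * bip \<gamma> z"
  have "norm (G p - of_real \<kappa> * bip' \<gamma> p) \<le> gapC * (M0 + \<bar>k1 - k2\<bar> / 2)"
  proof (rule norm_cgrad_le_near_circles[where f = ?f, OF _ _ p])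
    show "has_cgrad ?f (\<lambda>z. G z - of_real \<kappa> * bip' \<gamma> z) (op_ext Z)"
      by (intro has_cgrad_diff has_cgrad_minus_const U has_cgrad_scale has_cgrad_bip \<gamma> op out')
    show "continuous_on (cl_ext Z) ?f"
      by (intro continuous_intros cont continuous_on_bip \<gamma> out)
    fix z assume z: "z \<in> cl_ext Z - op_ext Z" "dist z p \<le> 1 / 5"
    then obtain c where c: "c \<in> Z" "dist z c = 1" unfolding cl_ext_def op_ext_def by force
    \<comment> \<open>The 6/5 in \<open>far\<close> is the unit radius plus the radius 1/5 of the
      neighbourhood of \<open>p\<close>, so boundary points in the latter lie on the two circles of
      the gap.\<close>
    have "dist p c \<le> 6 / 5" using dist_triangle[of p c z] c z by (simp add: dist_commute)
    then consider "c = of_real (1 + \<gamma> / 2)" | "c = - of_real (1 + \<gamma> / 2)" using far[OF c(1)] by force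
    then show "?f z = 0"
    proof cases
      case 1
      then have "U z = k1" "bip \<gamma> z = bip_alpha \<gamma>" using k1 bip_outside(2)[OF \<gamma>(1) out] c z by auto
      then show ?thesis using \<kappa> by (simp add: field_simps)
    next
      case 2
      then have "U z = k2" "bip \<gamma> z = - bip_alpha \<gamma>" using k2 bip_outside(3)[OF \<gamma>(1) out] c z by auto
      then show ?thesis using \<kappa> by (simp add: field_simps)
    qed
  next
    fix z assume z: "z \<in> cl_ext Z" "dist z p \<le> 1 / 5"
    have "\<bar>\<kappa> * bip \<gamma> z\<bar> \<le> \<bar>\<kappa>\<bar> * bip_alpha \<gamma>"
      unfolding abs_mult using bip_outside(1)[OF \<gamma>(1) out[OF z(1)]] by (intro mult_left_mono) auto
    also have "\<dots> = \<bar>\<kappa> * bip_alpha \<gamma>\<bar>" using al by (simp add: abs_mult)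
    also have "\<dots> = \<bar>k1 - k2\<bar> / 2" by (simp add: \<kappa>)
    finally show "\<bar>?f z\<bar> \<le> M0 + \<bar>k1 - k2\<bar> / 2" using bd[OF z] by linarith
  qed
  then show ?thesis by (simp add: \<kappa>_def)
qed

lemma sqrt_one_minus_square_ge:
  fixes y :: real
  assumes "\<bar>y\<bar> < sqrt 3 / 2"
  shows "y\<^sup>2 < 3 / 4" "1 / 2 < sqrt (1 - y\<^sup>2)" "1 - y\<^sup>2 \<le> sqrt (1 - y\<^sup>2)"
proof -
  have "\<bar>y\<bar>\<^sup>2 < (sqrt 3 / 2)\<^sup>2" using assms by (intro power_strict_mono) auto
  then show 1: "y\<^sup>2 < 3 / 4" by (simp add: power_divide)
  show "1 / 2 < sqrt (1 - y\<^sup>2)" by (rule real_less_rsqrt) (use 1 in \<open>simp add: power_divide\<close>)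
  have "(1 - y\<^sup>2)\<^sup>2 \<le> 1 - y\<^sup>2" unfolding power2_eq_square[of "1 - y\<^sup>2"]
    using 1 by (intro mult_left_le) auto
  then show "1 - y\<^sup>2 \<le> sqrt (1 - y\<^sup>2)" by (rule real_le_rsqrt)
qed

lemma bip'_expansion:
  assumes \<gamma>: "0 < \<gamma>" "\<gamma> \<le> 1 / 10" and x: "\<bar>x\<bar> < 1 + \<gamma> / 2 - sqrt (1 - y\<^sup>2)" and y: "\<bar>y\<bar> < sqrt 3 / 2"
  shows "norm (bip' \<gamma> (Complex x y) / of_real (2 * bip_alpha \<gamma>)
     - Complex (1 / (\<gamma> + y\<^sup>2)) (2 * (x * y) / (\<gamma> + y\<^sup>2)\<^sup>2)) \<le> 20"
proof -
  define X where "X = \<gamma> + y\<^sup>2"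
  let ?a = "bip_a \<gamma>"
  note s = sqrt_one_minus_square_ge[OF y]
  have X: "X > 0" "\<gamma> \<le> X" "y\<^sup>2 \<le> X" "X \<le> 1" using \<gamma> s by (auto simp: X_def add_pos_nonneg)
  have xX: "\<bar>x\<bar> \<le> X" using x s(3) \<gamma> by (simp add: X_def)
  \<comment> \<open>The cut-off sqrt 3 / 2 enters here: it gives sqrt (1 - y^2) > 1/2, hence this
    bound, which keeps \<open>D\<close> comparable to \<open>X\<close>.\<close>
  have x2: "\<bar>x\<bar> \<le> 11 / 20" using x s(2) \<gamma> by simp
  define ef where "ef = x\<^sup>2 - \<gamma>\<^sup>2 / 4"
  define e where "e = Complex ef (2 * (x * y))"
  define D where "D = of_real X - e"
  have "x\<^sup>2 \<le> X\<^sup>2" using power_mono[OF xX, of 2] by simp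
  moreover have g2: "\<gamma>\<^sup>2 \<le> X\<^sup>2" using power_mono[OF X(2), of 2] \<gamma> by simp
  ultimately have ef: "\<bar>ef\<bar> \<le> X\<^sup>2" using zero_le_power2[of x] zero_le_power2[of \<gamma>]
    unfolding ef_def by (simp only: abs_le_iff) linarith
  have xs: "x\<^sup>2 \<le> 11 / 20 * X"
  proof -
    have "x\<^sup>2 = \<bar>x\<bar> * \<bar>x\<bar>" by (simp add: power2_eq_square)
    also have "\<dots> \<le> 11 / 20 * X" using xX x2 by (intro mult_mono) auto
    finally show ?thesis .
  qed
  have "Re D = X - x\<^sup>2 + \<gamma>\<^sup>2 / 4" by (simp add: D_def e_def ef_def)
  then have "Re D \<ge> 9 / 20 * X" using xs zero_le_power2[of \<gamma>] by linarith
  then have nD: "norm D \<ge> 9 / 20 * X" using complex_Re_le_cmod[of D] by linarith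
  then have D0: "D \<noteq> 0" using X by auto
  have nee: "(norm e)\<^sup>2 \<le> 5 * X ^ 3"
  proof -
    have "(norm e)\<^sup>2 = ef\<^sup>2 + 4 * (x\<^sup>2 * y\<^sup>2)" by (simp add: e_def cmod_power2 power_mult_distrib)
    also have "ef\<^sup>2 \<le> (X\<^sup>2)\<^sup>2" using power_mono[OF ef, of 2] by simp
    also have "(X\<^sup>2)\<^sup>2 \<le> X ^ 3"
    proof -
      have "(X\<^sup>2)\<^sup>2 = X ^ 3 * X" by (simp add: power2_eq_square power3_eq_cube)
      also have "\<dots> \<le> X ^ 3 * 1" using X by (intro mult_left_mono) auto
      finally show ?thesis by simp
    qed
    also have "x\<^sup>2 * y\<^sup>2 \<le> X\<^sup>2 * X" using \<open>x\<^sup>2 \<le> X\<^sup>2\<close> X by (intro mult_mono) auto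
    also have "X\<^sup>2 * X = X ^ 3" by (simp add: power2_eq_square power3_eq_cube)
    finally show ?thesis by simp
  qed
  have id: "1 / D - 1 / of_real X - (e - of_real ef) / (of_real X)\<^sup>2
      = of_real ef / (of_real X)\<^sup>2 + e\<^sup>2 / ((of_real X)\<^sup>2 * D)"
  proof -
    have "1 / D = 1 / of_real X + e / (of_real X)\<^sup>2 + e\<^sup>2 / ((of_real X)\<^sup>2 * D)"
      using D0 X unfolding D_def by (simp add: divide_simps power2_eq_square) (simp add: algebra_simps)
    then show ?thesis by (simp add: diff_divide_distrib)
  qed
  have "norm (of_real ef / (of_real X)\<^sup>2 :: complex) \<le> 1"
    using ef X by (simp add: norm_divide norm_power)
  moreover have "norm (e\<^sup>2 / ((of_real X)\<^sup>2 * D)) \<le> 12"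
  proof -
    have "norm (e\<^sup>2 / ((of_real X)\<^sup>2 * D)) = (norm e)\<^sup>2 / (X\<^sup>2 * norm D)"
      by (simp add: norm_divide norm_mult norm_power)
    also have "\<dots> \<le> (5 * X ^ 3) / (X\<^sup>2 * (9 / 20 * X))"
      using nee nD X by (intro frac_le mult_left_mono) auto
    also have "\<dots> \<le> 12" using X by (simp add: power2_eq_square power3_eq_cube)
    finally show ?thesis .
  qed
  ultimately have n1: "norm (1 / D - 1 / of_real X - (e - of_real ef) / (of_real X)\<^sup>2) \<le> 13"
    unfolding id using norm_triangle_ineq[of "of_real ef / (of_real X)\<^sup>2" "e\<^sup>2 / ((of_real X)\<^sup>2 * D)"] by linarith
  have tgt: "1 / of_real X + (e - of_real ef) / (of_real X)\<^sup>2 = Complex (1 / X) (2 * (x * y) / X\<^sup>2)"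
    by (simp add: complex_eq_iff e_def power2_eq_square[of "complex_of_real X"] flip: of_real_mult)
      (simp add: power2_eq_square)
  have DD: "(of_real ?a)\<^sup>2 - (Complex x y)\<^sup>2 = D"
  proof -
    have "complex_of_real ?a ^ 2 = of_real (\<gamma> + \<gamma>\<^sup>2 / 4)" using bip_a_sq[OF \<gamma>(1)] by (metis of_real_power)
    then show ?thesis
      by (simp add: complex_eq_iff D_def e_def ef_def X_def power2_eq_square)
  qed
  have nz: "Complex x y + of_real ?a \<noteq> 0" "Complex x y - of_real ?a \<noteq> 0"
  proof -
    have "(of_real ?a - Complex x y) * (of_real ?a + Complex x y) = D"
      unfolding DD[symmetric] by (simp add: power2_eq_square algebra_simps)
    then show "Complex x y + of_real ?a \<noteq> 0" "Complex x y - of_real ?a \<noteq> 0" using D0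
      by (auto simp: add.commute)
  qed
  have bD: "bip' \<gamma> (Complex x y) = of_real (2 * ?a) / D"
  proof -
    have "1 / (p + A) - 1 / (p - A) = 2 * A / (A\<^sup>2 - p\<^sup>2)" if "p + A \<noteq> 0" "p - A \<noteq> 0" for p A :: complex
    proof -
      have "A\<^sup>2 - p\<^sup>2 = - ((p + A) * (p - A))" by (simp add: power2_eq_square algebra_simps)
      moreover have "1 / (p + A) - 1 / (p - A) = (- (2 * A)) / ((p + A) * (p - A))"
        using that by (simp add: diff_frac_eq)
      ultimately show ?thesis by simp
    qed
    from this[OF nz] show ?thesis unfolding DD by (simp add: bip'_def)
  qed
  define q where "q = ?a / bip_alpha \<gamma>"
  note al = bip_alpha_bounds[OF \<gamma>]
  have q: "0 \<le> q - 1" "q - 1 \<le> 2 * \<gamma>" using al by (simp_all add: q_def)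
  have main: "bip' \<gamma> (Complex x y) / of_real (2 * bip_alpha \<gamma>) = 1 / D + of_real (q - 1) / D"
  proof -
    have "bip' \<gamma> (Complex x y) / of_real (2 * bip_alpha \<gamma>) = of_real q / D"
      unfolding bD by (simp add: q_def mult.commute)
    then show ?thesis by (simp add: diff_divide_distrib)
  qed
  \<comment> \<open>\<open>q - 1\<close> is O(\<gamma>), hence O(X), which cancels the size 1 / X of
    1 / D.\<close>
  have n2: "norm (of_real (q - 1) / D) \<le> 5"
  proof -
    have "norm (of_real (q - 1) / D) = (q - 1) / norm D" using q(1) by (simp only: norm_divide norm_of_real abs_of_nonneg)
    also have "\<dots> \<le> (2 * X) / (9 / 20 * X)" using q nD X by (intro frac_le) auto
    also have "\<dots> \<le> 5" using X by simp
    finally show ?thesis .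
  qed
  have "bip' \<gamma> (Complex x y) / of_real (2 * bip_alpha \<gamma>) - Complex (1 / X) (2 * (x * y) / X\<^sup>2)
    = (1 / D - 1 / of_real X - (e - of_real ef) / (of_real X)\<^sup>2) + of_real (q - 1) / D"
    unfolding main tgt[symmetric] by simp
  then have "norm (bip' \<gamma> (Complex x y) / of_real (2 * bip_alpha \<gamma>) - Complex (1 / X) (2 * (x * y) / X\<^sup>2)) \<le> 13 + 5"
    using norm_triangle_le[OF add_mono[OF n1 n2]] by simp
  then show ?thesis by (simp add: X_def)
qed

text \<open>Needed to place (t, s) outside both disks of the gap (second bound) and to compare |t|
  with the denominator of the profile (third bound).\<close>

lemma gap_sqrt_bounds:
  assumes "\<bar>t\<bar> < 1 + \<gamma> / 2 - sqrt (1 - s\<^sup>2)" "\<bar>s\<bar> < sqrt 3 / 2" "0 < \<gamma>"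
  shows "1 / 2 < 1 + \<gamma> / 2 - \<bar>t\<bar>" "1 < (1 + \<gamma> / 2 - \<bar>t\<bar>)\<^sup>2 + s\<^sup>2" "\<bar>t\<bar> \<le> \<gamma> + s\<^sup>2" "s\<^sup>2 \<le> 3 / 4"
    "\<bar>t\<bar> < 1 / 2 + \<gamma> / 2"
proof -
  note q = sqrt_one_minus_square_ge[OF assms(2)]
  have h: "sqrt (1 - s\<^sup>2) < 1 + \<gamma> / 2 - \<bar>t\<bar>" using assms(1) by linarith
  show "1 / 2 < 1 + \<gamma> / 2 - \<bar>t\<bar>" "\<bar>t\<bar> \<le> \<gamma> + s\<^sup>2" "s\<^sup>2 \<le> 3 / 4" "\<bar>t\<bar> < 1 / 2 + \<gamma> / 2" using h q assms(3) by linarith+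
  have "0 \<le> 1 - s\<^sup>2" using q(1) by linarith
  then have "(sqrt (1 - s\<^sup>2))\<^sup>2 = 1 - s\<^sup>2" by simp
  moreover have "(sqrt (1 - s\<^sup>2))\<^sup>2 < (1 + \<gamma> / 2 - \<bar>t\<bar>)\<^sup>2" using h q(2) by (intro power_strict_mono) linarith+
  ultimately show "1 < (1 + \<gamma> / 2 - \<bar>t\<bar>)\<^sup>2 + s\<^sup>2" by linarith
qed

lemma scaled_expansion:
  assumes \<gamma>: "0 < \<gamma>" "\<gamma> \<le> 1 / 10" and t: "\<bar>t\<bar> < 1 + \<gamma> / 2 - sqrt (1 - s\<^sup>2)" "\<bar>s\<bar> < sqrt 3 / 2"
    and W: "norm (w - of_real (k / (2 * bip_alpha \<gamma>)) * bip' \<gamma> (Complex t s)) \<le> B"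
  shows "norm (w - of_real k * Complex (1 / (\<gamma> + s\<^sup>2)) (2 * (t * s) / (\<gamma> + s\<^sup>2)\<^sup>2)) \<le> B + 20 * \<bar>k\<bar>"
proof -
  let ?E = "Complex (1 / (\<gamma> + s\<^sup>2)) (2 * (t * s) / (\<gamma> + s\<^sup>2)\<^sup>2)"
  let ?b = "bip' \<gamma> (Complex t s) / of_real (2 * bip_alpha \<gamma>)"
  have eq: "w - of_real k * ?E = (w - of_real (k / (2 * bip_alpha \<gamma>)) * bip' \<gamma> (Complex t s)) + of_real k * (?b - ?E)"
    by (simp add: right_diff_distrib)
  have "norm (of_real k * (?b - ?E)) \<le> \<bar>k\<bar> * 20"
    unfolding norm_mult norm_of_real using bip'_expansion[OF \<gamma> t] by (intro mult_left_mono) auto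
  then have "norm (of_real k * (?b - ?E)) \<le> 20 * \<bar>k\<bar>" by simp
  then show ?thesis unfolding eq by (intro norm_triangle_le add_mono W)
qed

subsection \<open>Harmonic functions of finite energy on a half-cylinder\<close>

lemma vertical_period_int:
  fixes f :: "complex \<Rightarrow> real"
  assumes S: "\<And>z. z + \<i> * of_real L \<in> S \<longleftrightarrow> z \<in> S"
    and per: "\<And>z. z \<in> S \<Longrightarrow> f (z + \<i> * of_real L) = f z + \<tau>" and z: "z \<in> S"
  shows "z + of_int k * (\<i> * of_real L) \<in> S \<and> f (z + of_int k * (\<i> * of_real L)) = f z + of_int k * \<tau>"
proof (induction k rule: int_induct[where k = 0])
  case base
  then show ?case using z by simp
next
  case (step1 i)
  have e: "z + of_int (i + 1) * (\<i> * of_real L) = (z + of_int i * (\<i> * of_real L)) + \<i> * of_real L"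
    by (simp add: algebra_simps)
  show ?case unfolding e S using step1(2) per[of "z + of_int i * (\<i> * of_real L)"]
    by (simp add: distrib_right)
next
  case (step2 i)
  have e: "z + of_int i * (\<i> * of_real L) = (z + of_int (i - 1) * (\<i> * of_real L)) + \<i> * of_real L"
    by (simp add: algebra_simps)
  have "z + of_int (i - 1) * (\<i> * of_real L) \<in> S" using step2(2) S[of "z + of_int (i - 1) * (\<i> * of_real L)"] e by simp
  moreover from per[OF this] have "f (z + of_int (i - 1) * (\<i> * of_real L)) = f z + of_int (i - 1) * \<tau>"
    using step2(2) e by (simp add: algebra_simps)
  ultimately show ?case by blast
qed

lemma vertical_reduce:
  fixes L :: real assumes "L > 0"
  shows "\<exists>k :: int. \<bar>Im (z + of_int k * (\<i> * of_real L))\<bar> \<le> L / 2"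
proof -
  have "\<bar>Im z / L - of_int (round (Im z / L))\<bar> \<le> 1 / 2"
    using of_int_round_abs_le[of "Im z / L"] by (simp add: abs_minus_commute)
  then have "\<bar>Im z / L - of_int (round (Im z / L))\<bar> * L \<le> 1 / 2 * L" using assms by (intro mult_right_mono) auto
  moreover have "\<bar>Im z / L - of_int (round (Im z / L))\<bar> * L = \<bar>(Im z / L - of_int (round (Im z / L))) * L\<bar>"
    using assms by (simp add: abs_mult)
  moreover have "(Im z / L - of_int (round (Im z / L))) * L = Im (z + of_int (- round (Im z / L)) * (\<i> * of_real L))"
    using assms by (simp add: algebra_simps)
  ultimately show ?thesis by (metis mult.commute times_divide_eq_right mult_1 divide_inverse_commute inverse_eq_divide)
qed

text \<open>Periodicity replaces compactness: the perturbed function is periodic too, since (Re q)^2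
  ignores vertical shifts. Its maximum over a closed period cell is a maximum over the whole strip,
  so a maximum on a horizontal side of the cell, away from the vertical edges, still counts as
  interior.\<close>

lemma strip_maximum_principle:
  assumes f: "has_cgrad f F {z. a < Re z \<and> Re z < b}"
    and cont: "continuous_on {z. a \<le> Re z \<and> Re z \<le> b} f" and L: "L > 0"
    and per: "\<And>z. a \<le> Re z \<Longrightarrow> Re z \<le> b \<Longrightarrow> f (z + \<i> * of_real L) = f z"
    and bd: "\<And>z. Re z = a \<Longrightarrow> f z \<le> m" "\<And>z. Re z = b \<Longrightarrow> f z \<le> m"
    and z: "a \<le> Re z" "Re z \<le> b"
  shows "f z \<le> m"
proof (rule ccontr)
  assume less: "\<not> f z \<le> m"
  define B where "B = 1 + max \<bar>a\<bar> \<bar>b\<bar>"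
  have B: "B > 0" "\<And>q. a \<le> Re q \<Longrightarrow> Re q \<le> b \<Longrightarrow> \<bar>Re q\<bar> \<le> B" by (auto simp: B_def)
  define \<eta> where "\<eta> = (f z - m) / (2 * B\<^sup>2)"
  have \<eta>: "\<eta> > 0" using less B by (simp add: \<eta>_def)
  let ?S = "{z. a \<le> Re z \<and> Re z \<le> b}"
  let ?h = "\<lambda>q. f q + \<eta> * (Re q)\<^sup>2"
  let ?K = "cbox (Complex a (- L / 2)) (Complex b (L / 2))"
  have hk: "\<exists>q'\<in>?K. ?h q' = ?h q" if "q \<in> ?S" for q
  proof -
    obtain k :: int where k: "\<bar>Im (q + of_int k * (\<i> * of_real L))\<bar> \<le> L / 2" using vertical_reduce[OF L] by blast
    have "f (q + of_int k * (\<i> * of_real L)) = f q"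
      using vertical_period_int[of L ?S f 0 q k] that per by simp
    moreover have "Re (q + of_int k * (\<i> * of_real L)) = Re q" by simp
    moreover have "- L / 2 \<le> Im (q + of_int k * (\<i> * of_real L))" "Im (q + of_int k * (\<i> * of_real L)) \<le> L / 2"
      using k by linarith+
    ultimately show ?thesis using that
      by (intro bexI[of _ "q + of_int k * (\<i> * of_real L)"]) (simp_all add: in_cbox_complex_iff)
  qed
  have KS: "?K \<subseteq> ?S" by (auto simp: in_cbox_complex_iff)
  have ne: "?K \<noteq> {}" using hk z by blast
  have cK: "continuous_on ?K ?h"
    by (intro continuous_intros continuous_on_subset[OF cont KS])
  obtain p where p: "p \<in> ?K" "\<And>q. q \<in> ?K \<Longrightarrow> ?h q \<le> ?h p"
    using continuous_attains_sup[OF compact_cbox ne cK] by metis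
  then have pmax: "?h q \<le> ?h p" if "q \<in> ?S" for q using hk[OF that] by metis
  have pS: "a \<le> Re p" "Re p \<le> b" using p KS by auto
  show False
  proof (cases "a < Re p \<and> Re p < b")
    case True
    then have pW: "p \<in> {z. a < Re z \<and> Re z < b}" by simp
    moreover have "open {z. a < Re z \<and> Re z < b}" using f by (simp add: has_cgrad_def)
    ultimately obtain e where e: "e > 0" "ball p e \<subseteq> {z. a < Re z \<and> Re z < b}" by (meson openE)
    show False
      by (rule cgrad_perturbed_no_local_max[OF f pW \<eta> e(1)]) (rule pmax, use e in force)
  next
    case False
    then have "Re p = a \<or> Re p = b" using pS by linarith
    then have "f p \<le> m" using bd by blast
    moreover have "(Re p)\<^sup>2 \<le> B\<^sup>2" using B(2)[OF pS] B(1) by (simp add: abs_le_square_iff[symmetric])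
    then have "\<eta> * (Re p)\<^sup>2 \<le> \<eta> * B\<^sup>2" using \<eta> by simp
    moreover have "\<eta> * B\<^sup>2 = (f z - m) / 2" using B by (simp add: \<eta>_def)
    moreover have "f z + \<eta> * (Re z)\<^sup>2 \<ge> f z" using \<eta> by simp
    moreover have "?h z \<le> ?h p" by (rule pmax) (use z in simp)
    ultimately have "f z \<le> m + (f z - m) / 2" by linarith
    then show False using less by argo
  qed
qed

text \<open>The 1 added to \<open>E\<close> makes the contradiction strict.\<close>

lemma exists_le_average:
  fixes V :: "real \<Rightarrow> real"
  assumes "continuous_on {a..b} V" "a < b" "integral {a..b} V \<le> E"
  shows "\<exists>x\<in>{a..b}. V x \<le> (E + 1) / (b - a)"
proof (rule ccontr)
  assume "\<not> ?thesis"
  then have "\<And>x. x \<in> {a..b} \<Longrightarrow> (E + 1) / (b - a) \<le> V x" by force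
  then have "integral {a..b} (\<lambda>x. (E + 1) / (b - a)) \<le> integral {a..b} V"
    using assms by (intro integral_le integrable_continuous_interval) auto
  then show False using assms by simp
qed

text \<open>The fundamental theorem of calculus along the segment, with 2 n <= \<eta> + n^2 / \<eta>
  in place of the Cauchy-Schwarz inequality. The free \<eta> makes the term that grows with the
  length as small as desired.\<close>

lemma cgrad_segment_bound:
  assumes g: "has_cgrad g \<Gamma> W" and seg: "\<And>t. a \<le> t \<Longrightarrow> t \<le> b \<Longrightarrow> z + of_real t * w \<in> W"
    and w: "norm w = 1" and ab: "a \<le> b" and \<eta>: "\<eta> > 0"
  shows "\<bar>g (z + of_real b * w) - g (z + of_real a * w)\<bar>
    \<le> (\<eta> * (b - a) + integral {a..b} (\<lambda>t. (norm (\<Gamma> (z + of_real t * w)))\<^sup>2) / \<eta>) / 2"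
proof -
  let ?h = "\<lambda>t. Re (\<Gamma> (z + of_real t * w) * w)"
  let ?k = "\<lambda>t. (norm (\<Gamma> (z + of_real t * w)))\<^sup>2"
  have h: "(?h has_integral (g (z + of_real b * w) - g (z + of_real a * w))) {a..b}"
  proof (rule fundamental_theorem_of_calculus[OF ab])
    fix t assume "t \<in> {a..b}"
    then have "((\<lambda>t. g (z + of_real t * w)) has_real_derivative ?h t) (at t)"
      by (intro has_cgrad_DERIV_line[OF g] seg) auto
    then show "((\<lambda>t. g (z + of_real t * w)) has_vector_derivative ?h t) (at t within {a..b})"
      by (simp add: has_real_derivative_iff_has_vector_derivative has_vector_derivative_at_within)
  qed
  have "\<Gamma> holomorphic_on W" using g by (simp add: has_cgrad_def)
  then have "continuous_on W \<Gamma>" by (rule holomorphic_on_imp_continuous_on)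
  then have "continuous_on {a..b} (\<lambda>t. \<Gamma> (z + of_real t * w))"
    by (rule continuous_on_compose2) (use seg in \<open>auto intro!: continuous_intros\<close>)
  then have "continuous_on {a..b} ?k" by (intro continuous_intros)
  then have "(?k has_integral integral {a..b} ?k) {a..b}"
    by (intro integrable_integral integrable_continuous_interval)
  then have k: "((\<lambda>t. (\<eta> + ?k t / \<eta>) / 2) has_integral ((\<eta> * (b - a) + integral {a..b} ?k / \<eta>) / 2)) {a..b}"
    using has_integral_const_real[of \<eta> a b] ab
    by (intro has_integral_divide has_integral_add) (auto simp: mult.commute)
  have le: "\<bar>?h t\<bar> \<le> (\<eta> + ?k t / \<eta>) / 2" for t
  proof -
    define n where "n = norm (\<Gamma> (z + of_real t * w))"
    have "\<bar>?h t\<bar> \<le> n" using abs_Re_le_cmod[of "\<Gamma> (z + of_real t * w) * w"] w by (simp add: norm_mult n_def)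
    moreover have "2 * n \<le> \<eta> + n\<^sup>2 / \<eta>"
    proof -
      have "0 \<le> (\<eta> - n)\<^sup>2" by simp
      then have "2 * n * \<eta> \<le> \<eta>\<^sup>2 + n\<^sup>2" by (simp add: power2_diff algebra_simps)
      then show ?thesis using \<eta> by (simp add: field_simps power2_eq_square)
    qed
    ultimately show ?thesis by (simp add: n_def)
  qed
  have "g (z + of_real b * w) - g (z + of_real a * w) \<le> (\<eta> * (b - a) + integral {a..b} ?k / \<eta>) / 2"
    by (rule has_integral_le[OF h k]) (use le abs_le_D1 in blast)
  moreover have "- (g (z + of_real b * w) - g (z + of_real a * w)) \<le> (\<eta> * (b - a) + integral {a..b} ?k / \<eta>) / 2"
    by (rule has_integral_le[OF has_integral_neg[OF h] k]) (use le abs_le_D2 in blast)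
  ultimately show ?thesis by linarith
qed

text \<open>By averaging, a long cylinder contains a vertical slice of arbitrarily small energy,
  along which the increment \<tau> is small. Likewise, for every \<eta>, |g| is at most c + \<eta> N
  / 2 on some slice near N, with c depending on \<eta> only: the growth is sublinear. Comparison
  with small multiples of Re z - 3 then bounds g by its values on Re z = 3.\<close>

lemma half_cylinder_finite_energy:
  assumes g: "has_cgrad g \<Gamma> {z. Re z > 5 / 2}" and L: "L > 0"
    and per: "\<And>z. Re z > 5 / 2 \<Longrightarrow> g (z + \<i> * of_real L) = g z + \<tau>"
    and E: "\<And>N. N \<ge> 3 \<Longrightarrow> integral (cbox (3, - L / 2) (N, L / 2)) (\<lambda>(x, y). (norm (\<Gamma> (Complex x y)))\<^sup>2) \<le> E"
  shows "\<tau> = 0" "\<exists>B. \<forall>z. Re z \<ge> 3 \<longrightarrow> \<bar>g z\<bar> \<le> B"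
proof -
  let ?W = "{z. Re z > 5 / 2}"
  define e where "e = (\<lambda>x y. (norm (\<Gamma> (Complex x y)))\<^sup>2)"
  have E: "integral (cbox (3, - L / 2) (N, L / 2)) (\<lambda>(x, y). e x y) \<le> E" if "N \<ge> 3" for N
    using E[OF that] by (simp add: e_def)
  have contG: "continuous_on ?W \<Gamma>" using g by (auto simp: has_cgrad_def intro: holomorphic_on_imp_continuous_on)
  have ce: "continuous_on (cbox (a, c) (b, d)) (\<lambda>(x, y). e x y)" if "a \<ge> 3" for a b c d
  proof -
    have "continuous_on (cbox (a, c) (b, d)) (\<lambda>p. \<Gamma> (Complex (fst p) (snd p)))"
      by (rule continuous_on_compose2[OF contG])
        (use that in \<open>auto intro!: continuous_intros simp: cbox_Pair_eq\<close>)
    then show ?thesis unfolding e_def case_prod_unfold by (intro continuous_intros)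
  qed
  have e0: "e x y \<ge> 0" for x y by (simp add: e_def)
  have E0: "E \<ge> 0" using order_trans[OF integral_nonneg E[of 3]] e0 integrable_continuous[OF ce]
    by (auto simp: case_prod_unfold)
  have sub: "integral (cbox (a, - L / 2) (N, L / 2)) (\<lambda>(x, y). e x y) \<le> E" if "3 \<le> a" "3 \<le> N" for a N
  proof -
    have "integral (cbox (a, - L / 2) (N, L / 2)) (\<lambda>(x, y). e x y)
        \<le> integral (cbox (3, - L / 2) (N, L / 2)) (\<lambda>(x, y). e x y)"
      using that by (intro integral_subset_le integrable_continuous ce) (auto simp: e0 cbox_Pair_eq)
    then show ?thesis using E[OF that(2)] by simp
  qed
  define V where "V = (\<lambda>x. integral {- L / 2..L / 2} (e x))"
  have cex: "continuous_on {c..d} (e x)" if "x \<ge> 3" for x c d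
  proof -
    have "continuous_on {c..d} (\<lambda>y. (\<lambda>(x, y). e x y) (x, y))"
      by (rule continuous_on_compose2[OF ce[of x c x d]])
        (use that in \<open>auto intro!: continuous_on_Pair continuous_on_const continuous_on_id simp: cbox_Pair_eq\<close>)
    then show ?thesis by simp
  qed
  have cey: "continuous_on {a..b} (\<lambda>x. e x y)" if "a \<ge> 3" for y a b
  proof -
    have "continuous_on {a..b} (\<lambda>x. (\<lambda>(x, y). e x y) (x, y))"
      by (rule continuous_on_compose2[OF ce[of a y b y]])
        (use that in \<open>auto intro!: continuous_on_Pair continuous_on_const continuous_on_id simp: cbox_Pair_eq\<close>)
    then show ?thesis by simp
  qed
  have slice_x: "\<exists>x\<in>{a..b}. V x \<le> (E + 1) / (b - a)" if "3 \<le> a" "a < b" for a b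
  proof (rule exists_le_average)
    show "continuous_on {a..b} V"
      unfolding V_def using integral_continuous_on_param[of "{a..b}" "- L / 2" "L / 2" e]
        ce[OF that(1), of "- L / 2" b "L / 2"]
      by (simp add: cbox_Pair_eq)
    have "integral {a..b} V = integral (cbox (a, - L / 2) (b, L / 2)) (\<lambda>(x, y). e x y)"
      using integral_prod_continuous[OF ce[OF that(1)], of "- L / 2" b "L / 2"] by (simp add: V_def)
    then show "integral {a..b} V \<le> E" using sub[of a b] that by simp
  qed (use that in auto)
  have slice_y: "\<exists>y\<in>{- L / 2..L / 2}. integral {3..N} (\<lambda>x. e x y) \<le> (E + 1) / L" if "3 < N" for N
  proof -
    have "\<exists>y\<in>{- L / 2..L / 2}. integral {3..N} (\<lambda>x. e x y) \<le> (E + 1) / (L / 2 - (- L / 2))"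
    proof (rule exists_le_average)
      have ce': "continuous_on (cbox (- L / 2, 3) (L / 2, N)) (\<lambda>(y, x). e x y)"
      proof -
        have "continuous_on (cbox (- L / 2, 3) (L / 2, N)) (\<lambda>p. (\<lambda>(x, y). e x y) (snd p, fst p))"
          by (rule continuous_on_compose2[OF ce[of 3 "- L / 2" N "L / 2"]])
            (auto intro!: continuous_intros simp: cbox_Pair_eq)
        then show ?thesis by (simp add: case_prod_unfold)
      qed
      show "continuous_on {- L / 2..L / 2} (\<lambda>y. integral {3..N} (\<lambda>x. e x y))"
        using integral_continuous_on_param[of "{- L / 2..L / 2}" 3 N "\<lambda>y x. e x y"] ce' by (simp add: cbox_Pair_eq)
      have "integral {- L / 2..L / 2} (\<lambda>y. integral {3..N} (\<lambda>x. e x y)) = integral {3..N} V"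
        using integral_swap_continuous[OF ce[of 3 "- L / 2" N "L / 2"]] by (simp add: V_def)
      also have "\<dots> = integral (cbox (3, - L / 2) (N, L / 2)) (\<lambda>(x, y). e x y)"
        using integral_prod_continuous[OF ce, of 3 "- L / 2" N "L / 2"] by (simp add: V_def)
      finally show "integral {- L / 2..L / 2} (\<lambda>y. integral {3..N} (\<lambda>x. e x y)) \<le> E" using E[of N] that by simp
    qed (use L in auto)
    then show ?thesis by simp
  qed
  have cx: "Complex x 0 + of_real t * \<i> = Complex x t" "Complex 0 y + of_real t * 1 = Complex t y" for x y t
    by (simp_all add: complex_eq_iff)
  have vert: "\<bar>g (Complex x d) - g (Complex x c)\<bar> \<le> (\<eta> * L + V x / \<eta>) / 2"
    if "3 \<le> x" "- L / 2 \<le> c" "c \<le> d" "d \<le> L / 2" "\<eta> > 0" for x c d \<eta>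
  proof -
    have "\<bar>g (Complex x d) - g (Complex x c)\<bar> \<le> (\<eta> * (d - c) + integral {c..d} (e x) / \<eta>) / 2"
      using cgrad_segment_bound[OF g, of c d "Complex x 0" \<i> \<eta>] that unfolding cx e_def by simp
    also have "\<dots> \<le> (\<eta> * L + V x / \<eta>) / 2"
      unfolding V_def using that e0
      by (intro divide_right_mono add_mono mult_left_mono integral_subset_le integrable_continuous_interval cex) auto
    finally show ?thesis .
  qed
  have hor: "\<bar>g (Complex b y) - g (Complex 3 y)\<bar> \<le> (\<eta> * (N - 3) + integral {3..N} (\<lambda>x. e x y) / \<eta>) / 2"
    if "3 \<le> b" "b \<le> N" "\<eta> > 0" for y b N \<eta>
  proof -
    have "\<bar>g (Complex b y) - g (Complex 3 y)\<bar> \<le> (\<eta> * (b - 3) + integral {3..b} (\<lambda>x. e x y) / \<eta>) / 2"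
      using cgrad_segment_bound[OF g, of 3 b "Complex 0 y" 1 \<eta>] that unfolding cx e_def by simp
    also have "\<dots> \<le> (\<eta> * (N - 3) + integral {3..N} (\<lambda>x. e x y) / \<eta>) / 2"
      using that e0
      by (intro divide_right_mono add_mono mult_left_mono integral_subset_le integrable_continuous_interval cey) auto
    finally show ?thesis .
  qed
  show \<tau>: "\<tau> = 0"
  proof (rule ccontr)
    assume "\<tau> \<noteq> 0"
    \<comment> \<open>On a slice with V x <= \<eta>^2 the increment is at most \<eta> (L + 1) / 2,
      half of |\<tau>|. The length of the interval up to \<open>N\<close> is chosen to guarantee
      such a slice.\<close>
    define \<eta> where "\<eta> = \<bar>\<tau>\<bar> / (L + 1)"
    have \<eta>: "\<eta> > 0" using \<open>\<tau> \<noteq> 0\<close> L by (simp add: \<eta>_def)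
    define N where "N = 3 + (E + 1) / \<eta>\<^sup>2"
    have N: "N > 3" using \<eta> E0 by (simp add: N_def)
    obtain x where x: "x \<in> {3..N}" "V x \<le> (E + 1) / (N - 3)" using slice_x[of 3 N] N by auto
    have "(E + 1) / (N - 3) = \<eta>\<^sup>2" using \<eta> E0 by (simp add: N_def)
    then have "V x / \<eta> \<le> \<eta>" using x(2) \<eta> by (simp add: divide_le_eq power2_eq_square)
    moreover have "\<bar>g (Complex x (L / 2)) - g (Complex x (- L / 2))\<bar> \<le> (\<eta> * L + V x / \<eta>) / 2"
      using vert[of x "- L / 2" "L / 2" \<eta>] x \<eta> L by auto
    moreover have "g (Complex x (L / 2)) = g (Complex x (- L / 2)) + \<tau>"
    proof -
      have "Complex x (- L / 2) + \<i> * of_real L = Complex x (L / 2)" by (simp add: complex_eq_iff)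
      then show ?thesis using per[of "Complex x (- L / 2)"] x by simp
    qed
    ultimately have "\<bar>\<tau>\<bar> \<le> (\<eta> * L + \<eta>) / 2" by simp
    also have "\<eta> * L + \<eta> = \<eta> * (L + 1)" by (simp add: algebra_simps)
    also have "\<dots> = \<bar>\<tau>\<bar>" using L by (simp add: \<eta>_def)
    finally show False using \<open>\<tau> \<noteq> 0\<close> by simp
  qed
  have per: "g (z + \<i> * of_real L) = g z" if "Re z > 5 / 2" for z using per[OF that] \<tau> by simp
  have gcont: "continuous_on ?W g" by (rule has_cgrad_continuous_on[OF g])
  have "continuous_on {- L / 2..L / 2} (\<lambda>y. g (Complex 3 y))"
    by (rule continuous_on_compose2[OF gcont]) (auto intro!: continuous_intros)
  then have "bounded ((\<lambda>y. g (Complex 3 y)) ` {- L / 2..L / 2})"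
    by (intro compact_imp_bounded compact_continuous_image) auto
  then obtain B3 where B3: "\<And>y. y \<in> {- L / 2..L / 2} \<Longrightarrow> \<bar>g (Complex 3 y)\<bar> \<le> B3"
    unfolding bounded_iff by (metis image_eqI real_norm_def)
  have B30: "B3 \<ge> 0" using B3[of 0] L by force
  have redu: "\<exists>y\<in>{- L / 2..L / 2}. g z = g (Complex (Re z) y)" if "Re z > 5 / 2" for z
  proof -
    obtain k :: int where k: "\<bar>Im (z + of_int k * (\<i> * of_real L))\<bar> \<le> L / 2" using vertical_reduce[OF L] by blast
    have "g (z + of_int k * (\<i> * of_real L)) = g z"
      using vertical_period_int[of L ?W g 0 z k] that per by simp
    moreover have "z + of_int k * (\<i> * of_real L) = Complex (Re z) (Im (z + of_int k * (\<i> * of_real L)))"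
      by (simp add: complex_eq_iff)
    moreover have "Im (z + of_int k * (\<i> * of_real L)) \<in> {- L / 2..L / 2}"
      using k unfolding abs_le_iff by auto
    ultimately show ?thesis by metis
  qed
  have "\<bar>g z\<bar> \<le> B3" if z: "Re z \<ge> 3" for z
  proof -
    have main: "\<sigma> * g z \<le> B3 + \<eta> * (Re z - 3)" if \<eta>: "\<eta> > 0" and \<sigma>: "\<bar>\<sigma>\<bar> = 1" for \<eta> \<sigma>
    proof -
      define c where "c = B3 + ((E + 1) / L / \<eta>) / 2 + (L + (E + 1)) / 2"
      \<comment> \<open>Large enough that the bound \<open>Q\<close> on the slice \<open>xN\<close>
        near \<open>N\<close> is at most \<eta> (N - 4), hence at most \<eta> (xN - 3), so that the
        comparison slope \<open>s\<close> does not exceed \<eta>.\<close>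
      define N where "N = max (Re z + 5) (2 * (c + 4 * \<eta>) / \<eta>)"
      have N: "N \<ge> Re z + 5" "N \<ge> 2 * (c + 4 * \<eta>) / \<eta>" by (auto simp: N_def)
      have N2: "\<eta> * N \<ge> 2 * (c + 4 * \<eta>)" using N(2) \<eta> by (simp add: divide_le_eq mult.commute)
      have "3 \<le> N - 1" "N - 1 < N" "3 < N" using N z by auto
      then obtain xN where xN: "N - 1 \<le> xN" "xN \<le> N" "V xN \<le> E + 1" using slice_x[of "N - 1" N] by auto
      obtain yN where yN: "- L / 2 \<le> yN" "yN \<le> L / 2" "integral {3..N} (\<lambda>x. e x yN) \<le> (E + 1) / L"
        using slice_y[OF \<open>3 < N\<close>] by auto
      define Q where "Q = c + \<eta> * (N - 3) / 2"
      have x3: "xN > 3" "xN \<ge> 3" "Re z \<le> xN" using xN N z by auto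
      have Qb: "\<bar>g w\<bar> \<le> Q" if w: "Re w = xN" for w
      proof -
        obtain y where y: "- L / 2 \<le> y" "y \<le> L / 2" "g w = g (Complex xN y)" using redu[of w] w x3 by auto
        have f1: "\<bar>g (Complex xN y) - g (Complex xN yN)\<bar> \<le> (1 * L + V xN / 1) / 2"
        proof (cases "y \<le> yN")
          case True
          show ?thesis using vert[of xN y yN 1] True y yN x3 by (simp add: abs_minus_commute)
        next
          case False
          then show ?thesis using vert[of xN yN y 1] y yN x3 by simp
        qed
        have f2: "\<bar>g (Complex xN yN) - g (Complex 3 yN)\<bar> \<le> (\<eta> * (N - 3) + integral {3..N} (\<lambda>x. e x yN) / \<eta>) / 2"
          using hor[of xN N \<eta> yN] x3 xN \<eta> by simp
        have f3: "integral {3..N} (\<lambda>x. e x yN) / \<eta> \<le> (E + 1) / L / \<eta>"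
          using yN(3) \<eta> by (intro divide_right_mono) auto
        have f4: "\<bar>g (Complex 3 yN)\<bar> \<le> B3" using B3 yN by simp
        have f5: "\<bar>a\<bar> \<le> b3 + (i / 2) + (l + e) / 2 + j / 2"
          if "\<bar>a - b\<bar> \<le> (1 * l + v / 1) / 2" "\<bar>b - c\<bar> \<le> (j + i') / 2" "i' \<le> i" "\<bar>c\<bar> \<le> b3" "v \<le> e"
          for a b c l v j i i' b3 e :: real
          using that unfolding add_divide_distrib by simp
        show ?thesis unfolding y(3) Q_def c_def by (rule f5[OF f1 f2 f3 f4 xN(3)])
      qed
      have Q0: "Q \<ge> 0" using Qb[of "of_real xN"] by force
      define s where "s = Q / (xN - 3)"
      have "\<sigma> * g z - s * (Re z - 3) \<le> B3"
      proof (rule strip_maximum_principle[of "\<lambda>z. \<sigma> * g z - s * (Re z - 3)" _ 3 xN L])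
        have op: "open {z. 3 < Re z \<and> Re z < xN}"
          by (simp add: open_Collect_conj open_halfspace_Re_gt open_halfspace_Re_lt)
        show "has_cgrad (\<lambda>z. \<sigma> * g z - s * (Re z - 3)) (\<lambda>z. of_real \<sigma> * \<Gamma> z - of_real s * 1) {z. 3 < Re z \<and> Re z < xN}"
          by (intro has_cgrad_diff has_cgrad_scale has_cgrad_minus_const has_cgrad_Re op has_cgrad_subset[OF g op]) auto
        show "continuous_on {z. 3 \<le> Re z \<and> Re z \<le> xN} (\<lambda>z. \<sigma> * g z - s * (Re z - 3))"
          by (intro continuous_intros continuous_on_subset[OF gcont]) auto
        show "\<sigma> * g w - s * (Re w - 3) \<le> B3" if w: "Re w = 3" for w
        proof -
          have "\<bar>g w\<bar> \<le> B3" using redu[of w] w B3 by fastforce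
          then have "\<bar>\<sigma> * g w\<bar> \<le> B3" using \<sigma> by (simp add: abs_mult)
          then show ?thesis using w by simp
        qed
        show "\<sigma> * g w - s * (Re w - 3) \<le> B3" if w: "Re w = xN" for w
        proof -
          have "\<bar>\<sigma> * g w\<bar> \<le> Q" using Qb[OF w] \<sigma> by (simp add: abs_mult)
          moreover have "s * (Re w - 3) = Q" using w x3 by (simp add: s_def)
          ultimately show ?thesis using B30 by linarith
        qed
      qed (use L z x3 per in auto)
      moreover have "s \<le> \<eta>"
      proof -
        have "Q \<le> \<eta> * (N - 4)" using N2 \<eta> unfolding Q_def by (simp add: algebra_simps diff_divide_distrib)
        also have "\<dots> \<le> \<eta> * (xN - 3)" using xN \<eta> by (intro mult_left_mono) auto
        finally show ?thesis using x3 by (simp add: s_def divide_le_eq)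
      qed
      then have "s * (Re z - 3) \<le> \<eta> * (Re z - 3)" using z by (intro mult_right_mono) auto
      ultimately show ?thesis by linarith
    qed
    have lim: "\<sigma> * g z \<le> B3" if "\<bar>\<sigma>\<bar> = 1" for \<sigma>
    proof (rule field_le_epsilon)
      fix r :: real assume r: "r > 0"
      \<comment> \<open>Dividing by Re z - 2 instead of Re z - 3 keeps \<eta> positive when Re z =
        3.\<close>
      have "\<sigma> * g z \<le> B3 + r / (Re z - 2) * (Re z - 3)" using main[of "r / (Re z - 2)" \<sigma>] r z that by simp
      also have "r / (Re z - 2) * (Re z - 3) \<le> r" using r z by (simp add: divide_le_eq)
      finally show "\<sigma> * g z \<le> B3 + r" by simp
    qed
    show ?thesis using lim[of 1] lim[of "-1"] by simp
  qed
  then show "\<exists>B. \<forall>z. Re z \<ge> 3 \<longrightarrow> \<bar>g z\<bar> \<le> B" by blast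
qed

subsection \<open>The array of disks\<close>

lemma dist_pt_complex: "dist (Re z, Im z) (a, b) = dist z (Complex a b)"
  by (simp add: dist_Pair_Pair dist_norm[of z] cmod_def dist_real_def)

locale disk_array =
  fixes \<epsilon> \<delta> :: real
  assumes eps: "0 < \<epsilon>" "\<epsilon> \<le> 1 / 10" and del: "0 < \<delta>" "\<delta> \<le> 1 / 10"
begin

definition L :: real where "L = 2 + \<delta>"
definition cR :: "int \<Rightarrow> complex" where "cR n = Complex (1 + \<epsilon> / 2) (of_int n * L)"
definition cL :: "int \<Rightarrow> complex" where "cL n = Complex (- 1 - \<epsilon> / 2) (of_int n * L)"
definition Z :: "complex set" where "Z = range cR \<union> range cL"

lemma L_bounds: "2 < L" "L \<le> 21 / 10" "0 < L" using del by (auto simp: L_def)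

lemma Z_cases:
  assumes "c \<in> Z"
  obtains n where "c = cR n" | n where "c = cL n"
  using assms by (auto simp: Z_def)

lemma cR_in_Z [simp]: "cR n \<in> Z" and cL_in_Z [simp]: "cL n \<in> Z" by (auto simp: Z_def)

lemma Z_Re_Im: "c \<in> Z \<Longrightarrow> \<bar>Re c\<bar> = 1 + \<epsilon> / 2 \<and> (\<exists>n. Im c = of_int n * L)"
  using eps by (auto simp: Z_def cR_def cL_def)

lemma Z_shift: "c + of_int k * (\<i> * of_real L) \<in> Z \<longleftrightarrow> c \<in> Z"
proof -
  have 1: "cR n + of_int k * (\<i> * of_real L) = cR (n + k)" "cL n + of_int k * (\<i> * of_real L) = cL (n + k)" for n k
    by (simp_all add: cR_def cL_def complex_eq_iff algebra_simps)
  have 2: "c + of_int k * (\<i> * of_real L) \<in> Z" if "c \<in> Z" for c k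
    using that by (elim Z_cases) (simp_all only: 1 cR_in_Z cL_in_Z)
  have "c + of_int k * (\<i> * of_real L) + of_int (- k) * (\<i> * of_real L) = c" by simp
  then show ?thesis using 2 by metis
qed

lemma Z_cnj: "cnj c \<in> Z \<longleftrightarrow> c \<in> Z"
proof -
  have 1: "cnj (cR n) = cR (- n)" "cnj (cL n) = cL (- n)" for n
    by (simp_all add: cR_def cL_def complex_eq_iff)
  have "cnj c \<in> Z" if "c \<in> Z" for c
    using that by (elim Z_cases) (simp_all only: 1 cR_in_Z cL_in_Z)
  from this this[of "cnj c"] show ?thesis by auto
qed

lemma ext_shift:
  "z + of_int k * (\<i> * of_real L) \<in> cl_ext Z \<longleftrightarrow> z \<in> cl_ext Z"
  "z + of_int k * (\<i> * of_real L) \<in> op_ext Z \<longleftrightarrow> z \<in> op_ext Z"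
proof -
  have d: "dist (z + v) c = dist z (c - v)" for v c :: complex by (simp add: dist_norm algebra_simps)
  have b: "(\<forall>c\<in>Z. P (c - of_int k * (\<i> * of_real L))) \<longleftrightarrow> (\<forall>c\<in>Z. P c)" for P
  proof -
    have "c - of_int k * (\<i> * of_real L) \<in> Z" if "c \<in> Z" for c
      using Z_shift[of c "- k"] that by simp
    moreover have "c + of_int k * (\<i> * of_real L) \<in> Z" if "c \<in> Z" for c
      using Z_shift[of c k] that by simp
    ultimately show ?thesis by (metis add_diff_cancel)
  qed
  show "z + of_int k * (\<i> * of_real L) \<in> cl_ext Z \<longleftrightarrow> z \<in> cl_ext Z"
    unfolding cl_ext_def mem_Collect_eq d by (rule b)
  show "z + of_int k * (\<i> * of_real L) \<in> op_ext Z \<longleftrightarrow> z \<in> op_ext Z"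
    unfolding op_ext_def mem_Collect_eq d by (rule b)
qed

lemma ext_shift1:
  "z + \<i> * of_real L \<in> cl_ext Z \<longleftrightarrow> z \<in> cl_ext Z"
  "z + \<i> * of_real L \<in> op_ext Z \<longleftrightarrow> z \<in> op_ext Z"
  using ext_shift[of z 1] by simp_all

lemma ext_cnj: "cnj z \<in> cl_ext Z \<longleftrightarrow> z \<in> cl_ext Z" "cnj z \<in> op_ext Z \<longleftrightarrow> z \<in> op_ext Z"
proof -
  have d: "dist (cnj z) c = dist z (cnj c)" for c
    by (metis complex_cnj_cnj complex_cnj_diff complex_mod_cnj dist_norm)
  have b: "(\<forall>c\<in>Z. P (cnj c)) \<longleftrightarrow> (\<forall>c\<in>Z. P c)" for P
    using Z_cnj by (metis complex_cnj_cnj)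
  show "cnj z \<in> cl_ext Z \<longleftrightarrow> z \<in> cl_ext Z"
    unfolding cl_ext_def mem_Collect_eq d by (rule b)
  show "cnj z \<in> op_ext Z \<longleftrightarrow> z \<in> op_ext Z"
    unfolding op_ext_def mem_Collect_eq d by (rule b)
qed

text \<open>The condition is locally finite: only finitely many centres lie within distance 2 of z,
  and all others leave room 1.\<close>

lemma open_op_ext: "open (op_ext Z)"
proof (rule openI)
  fix z assume z: "z \<in> op_ext Z"
  define F where "F = {c\<in>Z. dist z c < 2}"
  let ?I = "{\<lfloor>(Im z - 2) / L\<rfloor>..\<lceil>(Im z + 2) / L\<rceil>}"
  have "F \<subseteq> cR ` ?I \<union> cL ` ?I"
  proof
    fix c assume c: "c \<in> F"
    have bnd: "n \<in> ?I" if "Im c = of_int n * L" for n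
    proof -
      have "\<bar>Im z - of_int n * L\<bar> < 2"
        using c abs_Im_le_cmod[of "z - c"] that by (simp add: F_def dist_norm)
      then have "(Im z - 2) / L \<le> of_int n" "of_int n \<le> (Im z + 2) / L"
        using L_bounds by (simp_all add: divide_le_eq le_divide_eq abs_less_iff)
      then show ?thesis by (simp add: floor_le_iff le_ceiling_iff)
    qed
    have "c \<in> Z" using c by (simp add: F_def)
    then show "c \<in> cR ` ?I \<union> cL ` ?I"
    proof (cases rule: Z_cases)
      case (1 n)
      then show ?thesis using bnd[of n] by (auto simp: cR_def)
    next
      case (2 n)
      then show ?thesis using bnd[of n] by (auto simp: cL_def)
    qed
  qed
  then have fin: "finite F" by (rule finite_subset) auto
  define r where "r = Min (insert 1 ((\<lambda>c. dist z c - 1) ` F))"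
  have r0: "r > 0" unfolding r_def using fin z by (subst Min_gr_iff) (auto simp: F_def op_ext_def)
  have r1: "r \<le> 1" unfolding r_def using fin by (intro Min_le) auto
  have r: "1 + r \<le> dist z c" if "c \<in> Z" for c
  proof (cases "c \<in> F")
    case True
    then have "r \<le> dist z c - 1" unfolding r_def using fin by (intro Min_le) auto
    then show ?thesis by simp
  next
    case False
    then show ?thesis using that r1 by (simp add: F_def)
  qed
  have "ball z r \<subseteq> op_ext Z"
  proof
    fix w assume w: "w \<in> ball z r"
    show "w \<in> op_ext Z" unfolding op_ext_def
    proof safe
      fix c assume "c \<in> Z"
      then show "1 < dist w c" using r[of c] w dist_triangle[of z c w] by simp
    qed
  qed
  then show "\<exists>e>0. ball z e \<subseteq> op_ext Z" using r0 by blast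
qed

lemma Dcal_iff: "(Re z, Im z) \<in> - Dcal \<epsilon> \<delta> \<longleftrightarrow> z \<in> cl_ext Z"
proof -
  have R: "(Re z, Im z) \<in> DR \<epsilon> \<delta> n \<longleftrightarrow> dist z (cR n) < 1" for n
    using dist_pt_complex[of z "1 + \<epsilon> / 2" "of_int n * L"]
    by (simp add: DR_def cR_def L_def dist_commute)
  have Lf: "(Re z, Im z) \<in> DL \<epsilon> \<delta> n \<longleftrightarrow> dist z (cL n) < 1" for n
    using dist_pt_complex[of z "- 1 - \<epsilon> / 2" "of_int n * L"]
    by (simp add: DL_def cL_def L_def dist_commute)
  show ?thesis
    unfolding Dcal_def cl_ext_def Z_def by (auto simp: R Lf not_less)
qed

text \<open>The closure of the infinite union adds only the circles, because the union of the closed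
  disks is closed by \<open>open_op_ext\<close>.\<close>

lemma closure_Dcal_iff: "(Re z, Im z) \<in> - closure (Dcal \<epsilon> \<delta>) \<longleftrightarrow> z \<in> op_ext Z"
proof
  assume z: "(Re z, Im z) \<in> - closure (Dcal \<epsilon> \<delta>)"
  have "1 < dist z c" if c: "c \<in> Z" for c
  proof (rule ccontr)
    assume "\<not> 1 < dist z c"
    then have "(Re z, Im z) \<in> cball (Re c, Im c) 1"
      using dist_pt_complex[of z "Re c" "Im c"] by (simp add: dist_commute)
    then have "(Re z, Im z) \<in> closure (ball (Re c, Im c) 1)" by simp
    moreover have "ball (Re c, Im c) 1 \<subseteq> Dcal \<epsilon> \<delta>"
      using c by (elim Z_cases) (auto simp: Dcal_def DL_def DR_def cR_def cL_def L_def)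
    ultimately show False using z closure_mono by blast
  qed
  then show "z \<in> op_ext Z" by (simp add: op_ext_def)
next
  assume z: "z \<in> op_ext Z"
  have vim: "{p. Complex (fst p) (snd p) \<in> op_ext Z} = (\<lambda>p. Complex (fst p) (snd p)) -` op_ext Z" by auto
  have "open {p. Complex (fst p) (snd p) \<in> op_ext Z}"
    unfolding vim by (intro open_vimage open_op_ext continuous_intros)
  then have cl: "closed (- {p. Complex (fst p) (snd p) \<in> op_ext Z})" by auto
  have "Dcal \<epsilon> \<delta> \<subseteq> - {p. Complex (fst p) (snd p) \<in> op_ext Z}"
  proof
    fix p assume p: "p \<in> Dcal \<epsilon> \<delta>"
    have "Complex (fst p) (snd p) \<notin> cl_ext Z" using p Dcal_iff[of "Complex (fst p) (snd p)"] by simp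
    then show "p \<in> - {p. Complex (fst p) (snd p) \<in> op_ext Z}" using op_ext_subset_cl_ext by auto
  qed
  then have "closure (Dcal \<epsilon> \<delta>) \<subseteq> - {p. Complex (fst p) (snd p) \<in> op_ext Z}" using cl by (rule closure_minimal)
  then show "(Re z, Im z) \<in> - closure (Dcal \<epsilon> \<delta>)" using z by auto
qed

lemma op_ext_if_Re: "\<bar>Re z\<bar> > 5 / 2 \<Longrightarrow> z \<in> op_ext Z"
  unfolding op_ext_def
proof safe
  fix c assume z: "\<bar>Re z\<bar> > 5 / 2" and c: "c \<in> Z"
  have "\<bar>Re z\<bar> - \<bar>Re c\<bar> \<le> \<bar>Re (z - c)\<bar>" by simp
  also have "\<dots> \<le> dist z c" unfolding dist_norm by (rule abs_Re_le_cmod)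
  finally show "1 < dist z c" using z Z_Re_Im[OF c] eps by simp
qed

text \<open>These lines and the axis of \<open>op_ext_if_Re0\<close> avoid all disks; the paths that
  connect the domain run along them.\<close>

lemma op_ext_if_Im: "\<bar>Im z - (of_int k + 1 / 2) * L\<bar> = 0 \<Longrightarrow> z \<in> op_ext Z"
  unfolding op_ext_def
proof safe
  fix c assume z: "\<bar>Im z - (of_int k + 1 / 2) * L\<bar> = 0" and c: "c \<in> Z"
  obtain n where n: "Im c = of_int n * L" using Z_Re_Im[OF c] by blast
  have "1 / 2 \<le> \<bar>of_int k + 1 / 2 - of_int n :: real\<bar>"
  proof -
    have "k \<ge> n \<or> k + 1 \<le> n" by linarith
    then have "of_int k \<ge> (of_int n :: real) \<or> of_int k + 1 \<le> (of_int n :: real)" by linarith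
    then show ?thesis by linarith
  qed
  then have "1 / 2 * L \<le> \<bar>of_int k + 1 / 2 - of_int n\<bar> * L" using L_bounds by (intro mult_right_mono) auto
  also have "\<dots> = \<bar>(of_int k + 1 / 2 - of_int n) * L\<bar>" using L_bounds by (simp add: abs_mult)
  also have "\<dots> = \<bar>Im (z - c)\<bar>" using z n by (simp add: algebra_simps)
  also have "\<dots> \<le> dist z c" unfolding dist_norm by (rule abs_Im_le_cmod)
  finally show "1 < dist z c" using L_bounds by simp
qed

lemma op_ext_if_Re0: "Re z = 0 \<Longrightarrow> z \<in> op_ext Z"
  unfolding op_ext_def
proof safe
  fix c assume z: "Re z = 0" and c: "c \<in> Z"
  have "\<bar>Re (z - c)\<bar> \<le> dist z c" unfolding dist_norm by (rule abs_Re_le_cmod)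
  then show "1 < dist z c" using z Z_Re_Im[OF c] eps by simp
qed

text \<open>Moving vertically away from row k increases the distance to its centres, and up to half
  a period every other row stays at vertical distance at least L / 2 > 1.\<close>

lemma op_ext_away:
  assumes z: "z \<in> cl_ext Z" and k: "\<bar>Im z - of_int k * L\<bar> < \<bar>Im w - of_int k * L\<bar>"
    and w: "\<bar>Im w - of_int k * L\<bar> \<le> L / 2" and re: "Re w = Re z"
  shows "w \<in> op_ext Z"
  unfolding op_ext_def
proof safe
  fix c assume c: "c \<in> Z"
  obtain n where n: "Im c = of_int n * L" using Z_Re_Im[OF c] by blast
  show "1 < dist w c"
  proof (cases "n = k")
    case True
    have "1 \<le> (dist z c)\<^sup>2" using z c by (simp add: cl_ext_def)
    also have "\<dots> = (Re z - Re c)\<^sup>2 + (Im z - of_int k * L)\<^sup>2" unfolding dist_norm cmod_power2 using n True by simp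
    also have "\<dots> < (Re z - Re c)\<^sup>2 + (Im w - of_int k * L)\<^sup>2"
      using power_strict_mono[OF k, of 2] by simp
    also have "\<dots> = (dist w c)\<^sup>2" unfolding dist_norm cmod_power2 using n True re by simp
    finally have "1\<^sup>2 < (dist w c)\<^sup>2" by simp
    then show ?thesis by (rule power_less_imp_less_base) simp
  next
    case False
    then have "1 \<le> \<bar>of_int n - of_int k :: real\<bar>" by linarith
    then have "1 * L \<le> \<bar>of_int n - of_int k\<bar> * L" using L_bounds by (intro mult_right_mono) auto
    also have "\<dots> = \<bar>of_int n * L - of_int k * L\<bar>" using L_bounds by (simp add: abs_mult flip: left_diff_distrib)
    finally have "L \<le> \<bar>of_int n * L - of_int k * L\<bar>" by simp
    then have "L / 2 \<le> \<bar>Im w - of_int n * L\<bar>" using w by linarith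
    then have "L / 2 \<le> \<bar>Im (w - c)\<bar>" using n by simp
    also have "\<dots> \<le> dist w c" unfolding dist_norm by (rule abs_Im_le_cmod)
    finally show ?thesis using L_bounds by simp
  qed
qed

text \<open>Continuity on \<open>cl_ext Z\<close> allows the segment to start or end on a
  circle.\<close>

lemma zero_cgrad_const_segment:
  assumes D: "\<And>z. z \<in> op_ext Z \<Longrightarrow> (D has_derivative (\<lambda>h. 0)) (at z)" and cont: "continuous_on (cl_ext Z) D"
    and seg: "\<And>t. 0 < t \<Longrightarrow> t < 1 \<Longrightarrow> z + of_real t * w \<in> op_ext Z"
    and z: "z \<in> cl_ext Z" "z + w \<in> cl_ext Z"
  shows "D (z + w) = (D z :: real)"
proof -
  have inc: "z + of_real t * w \<in> cl_ext Z" if "0 \<le> t" "t \<le> 1" for t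
    using that seg[of t] z op_ext_subset_cl_ext by (cases "t = 0"; cases "t = 1") auto
  have "D (z + of_real 1 * w) = D (z + of_real 0 * w)"
  proof (rule DERIV_isconst_end[where f = "\<lambda>t. D (z + of_real t * w)"])
    show "continuous_on {0..1} (\<lambda>t. D (z + of_real t * w))"
      by (rule continuous_on_compose2[OF cont]) (auto intro!: continuous_intros inc)
    fix t :: real assume t: "0 < t" "t < 1"
    have 2: "((\<lambda>t. z + of_real t * w) has_derivative (\<lambda>t. of_real t * w)) (at t)"
      by (auto intro!: derivative_eq_intros)
    from has_derivative_compose[OF 2 D[OF seg[OF t]]]
    show "((\<lambda>t. D (z + of_real t * w)) has_real_derivative 0) (at t)"
      by (simp add: has_field_derivative_def lambda_zero)
  qed simp
  then show ?thesis by simp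
qed

lemma zero_cgrad_const:
  assumes D: "\<And>z. z \<in> op_ext Z \<Longrightarrow> (D has_derivative (\<lambda>h. 0)) (at z)" and cont: "continuous_on (cl_ext Z) D"
    and z: "z \<in> cl_ext Z"
  shows "D z = (D 0 :: real)"
proof -
  \<comment> \<open>Walk vertically to a line halfway between two rows of disks, then along it to the axis \<open>Re = 0\<close>.\<close>
  have "\<exists>n :: int. \<bar>Im (z + of_int n * (\<i> * of_real L))\<bar> \<le> L / 2" by (rule vertical_reduce) (use L_bounds in simp)
  then obtain n :: int where n: "\<bar>Im z + of_int n * L\<bar> \<le> L / 2" by auto
  define k where "k = - n"
  have k: "\<bar>Im z - of_int k * L\<bar> \<le> L / 2" using n by (simp add: k_def)
  define \<sigma> :: real where "\<sigma> = (if Im z \<ge> of_int k * L then 1 else - 1)"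
  define l where "l = L / 2 - \<bar>Im z - of_int k * L\<bar>"
  have l: "l \<ge> 0" using k by (simp add: l_def)
  define w where "w = z + \<i> * of_real (\<sigma> * l)"
  have Imt: "\<bar>Im z + t * (\<sigma> * l) - of_int k * L\<bar> = \<bar>Im z - of_int k * L\<bar> + t * l" if "t \<ge> 0" for t
    using that l by (auto simp: \<sigma>_def abs_if mult_nonneg_nonneg not_le add_nonneg_nonneg) (smt (verit) mult_nonneg_nonneg)+
  have wop: "w \<in> op_ext Z"
  proof (cases "Im z \<ge> of_int k * L")
    case True
    then show ?thesis using op_ext_if_Im[of w k] L_bounds by (simp add: w_def l_def \<sigma>_def algebra_simps)
  next
    case False
    then show ?thesis using op_ext_if_Im[of w "k - 1"] L_bounds by (simp add: w_def l_def \<sigma>_def algebra_simps)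
  qed
  have Imw: "\<exists>j. Im w = (of_int j + 1 / 2) * L"
  proof (cases "Im z \<ge> of_int k * L")
    case True
    then show ?thesis by (intro exI[of _ k]) (simp add: w_def l_def \<sigma>_def algebra_simps)
  next
    case False
    then show ?thesis by (intro exI[of _ "k - 1"]) (simp add: w_def l_def \<sigma>_def algebra_simps)
  qed
  then obtain j where j: "Im w = (of_int j + 1 / 2) * L" by blast
  have "D w = D z"
  proof (cases "l = 0")
    case True
    then show ?thesis by (simp add: w_def)
  next
    case False
    then have lp: "l > 0" using l by simp
    show ?thesis unfolding w_def
    proof (rule zero_cgrad_const_segment[OF D cont _ z])
      show "z + \<i> * of_real (\<sigma> * l) \<in> cl_ext Z" using wop op_ext_subset_cl_ext by (auto simp: w_def)
      fix t :: real assume t: "0 < t" "t < 1"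
      have tl: "0 < t * l" "t * l \<le> l" using t lp by (auto simp: mult_le_cancel_right1)
      show "z + of_real t * (\<i> * of_real (\<sigma> * l)) \<in> op_ext Z"
        by (rule op_ext_away[OF z, of k]) (use Imt[of t] t tl in \<open>auto simp: l_def\<close>)
    qed
  qed
  moreover have "D (w + of_real (- Re w)) = D w"
    by (rule zero_cgrad_const_segment[OF D cont])
      (use wop j in \<open>auto intro!: op_ext_if_Im[where k = j] subsetD[OF op_ext_subset_cl_ext]\<close>)
  moreover have "w + of_real (- Re w) = \<i> * of_real (Im w)" by (simp add: complex_eq_iff)
  moreover have "D (0 + \<i> * of_real (Im w)) = D 0"
    by (rule zero_cgrad_const_segment[OF D cont])
      (auto intro!: op_ext_if_Re0 subsetD[OF op_ext_subset_cl_ext])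
  ultimately show ?thesis by simp
qed

end

text \<open>The logarithm is nonnegative outside the unit disk about its pole, so subtracting a
  multiple of it does not spoil the bound on the circles. It is unbounded, so on a large circle even
  a tiny multiple outweighs the a priori bound \<open>B\<close>.\<close>

lemma (in disk_array) bounded_maximum_principle:
  assumes f: "has_cgrad f F (op_ext Z)" and cont: "continuous_on (cl_ext Z) f"
    and B: "\<And>z. z \<in> cl_ext Z \<Longrightarrow> f z \<le> B" and m: "\<And>z. z \<in> cl_ext Z - op_ext Z \<Longrightarrow> f z \<le> m"
    and z: "z \<in> cl_ext Z"
  shows "f z \<le> m"
proof -
  let ?c = "cR 0"
  have out: "1 \<le> norm (w - ?c)" if "w \<in> cl_ext Z" for w using that by (auto simp: cl_ext_def dist_norm)
  have ln0: "0 \<le> ln (norm (w - ?c))" if "w \<in> cl_ext Z" for w using out[OF that] by simp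
  have main: "f z - \<eta> * ln (norm (z - ?c)) \<le> m" if \<eta>: "\<eta> > 0" for \<eta>
  proof -
    define R where "R = max (dist z ?c) (exp ((B - m) / \<eta>))"
    have R: "R > 0" "dist z ?c \<le> R" "exp ((B - m) / \<eta>) \<le> R" by (auto simp: R_def less_max_iff_disj)
    have "(B - m) / \<eta> \<le> ln R" using R by (simp add: ln_ge_iff)
    then have lnR: "B - m \<le> \<eta> * ln R" using \<eta> by (simp add: divide_le_eq mult.commute)
    let ?W = "op_ext Z \<inter> ball ?c R" and ?K = "cl_ext Z \<inter> cball ?c R"
    have opW: "open ?W" using open_op_ext by blast
    show ?thesis
    proof (rule cgrad_maximum_principle[where K = ?K and W = ?W and z = z
          and f = "\<lambda>z. f z - \<eta> * ln (norm (z - ?c))"])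
      show "compact ?K" by (simp add: closed_Int_compact closed_cl_ext)
      have nW: "?c \<notin> ?W" by (auto simp: op_ext_def intro!: bexI[of _ ?c])
      show "has_cgrad (\<lambda>z. f z - \<eta> * ln (norm (z - ?c))) (\<lambda>z. F z - of_real \<eta> * (1 / (z - ?c))) ?W"
        by (intro has_cgrad_diff has_cgrad_scale has_cgrad_subset[OF f opW] has_cgrad_ln_norm opW nW) auto
      show "?W \<subseteq> ?K" using op_ext_subset_cl_ext by auto
      have nz: "norm (w - ?c) \<noteq> 0" if "w \<in> ?K" for w using out[of w] that by auto
      show "continuous_on ?K (\<lambda>z. f z - \<eta> * ln (norm (z - ?c)))"
        by (intro continuous_intros continuous_on_subset[OF cont]) (use nz in auto)
      show "z \<in> ?K" using z R by (simp add: dist_commute)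
      fix w assume w: "w \<in> ?K - ?W"
      show "f w - \<eta> * ln (norm (w - ?c)) \<le> m"
      proof (cases "w \<in> op_ext Z")
        case False
        then have "f w \<le> m" using m w by blast
        moreover have "0 \<le> \<eta> * ln (norm (w - ?c))" using \<eta> ln0[of w] w by simp
        ultimately show ?thesis by linarith
      next
        case True
        then have "norm (w - ?c) = R" using w by (auto simp: dist_norm norm_minus_commute)
        then show ?thesis using B[of w] w lnR by auto
      qed
    qed
  qed
  show ?thesis
  proof (rule field_le_epsilon)
    fix r :: real assume r: "r > 0"
    let ?l = "ln (norm (z - ?c))"
    have l: "0 \<le> ?l" by (rule ln0[OF z])
    have "f z - r / (1 + ?l) * ?l \<le> m" using main[of "r / (1 + ?l)"] r l by simp
    moreover have "r / (1 + ?l) * ?l \<le> r" using r l by (simp add: divide_le_eq)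
    ultimately show "f z \<le> m + r" by linarith
  qed
qed

section \<open>Solutions: increments over a period and global bounds\<close>

locale array_solution = disk_array +
  fixes H u :: "pt \<Rightarrow> real"
  assumes H_harmonic: "harmonic_on UNIV H"
    and H_per: "\<And>p. grad H p = grad H (fst p, snd p + (2 + \<delta>))"
    and sol: "is_solution \<epsilon> \<delta> H u"
begin

definition U :: "complex \<Rightarrow> real" where "U z = u (Re z, Im z)"
definition HC :: "complex \<Rightarrow> real" where "HC z = H (Re z, Im z)"
text \<open>Increment of H over a full period, between the heights -L/2 and L/2, whereas the theorem
  uses the heights -1 and 1; \<open>lam_bound\<close> compares the two.\<close>

definition P :: real where "P = HC (\<i> * of_real (L / 2)) - HC (- \<i> * of_real (L / 2))"
definition M :: real where "M = (SUP p\<in>Omega_m \<delta> 4. \<bar>H p\<bar>)"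
definition KR :: real where "KR = U (cR 0 + 1)"
definition KL :: real where "KL = U (cL 0 + 1)"

lemma U_cgrad: "has_cgrad U (cgradient u) (op_ext Z)"
proof -
  have "harmonic_on (- closure (Dcal \<epsilon> \<delta>)) u" using sol by (simp add: is_solution_def)
  from harmonic_on_has_cgrad[OF this] show ?thesis
    unfolding closure_Dcal_iff U_def[abs_def] by simp
qed

lemma U_cont: "continuous_on (cl_ext Z) U"
proof -
  have "continuous_on (- Dcal \<epsilon> \<delta>) u" using sol by (simp add: is_solution_def)
  then show ?thesis unfolding U_def[abs_def]
    by (rule continuous_on_compose2) (use Dcal_iff in \<open>auto intro!: continuous_intros\<close>)
qed

lemma HC_cgrad: "has_cgrad HC (cgradient H) UNIV"
  using harmonic_on_has_cgrad[OF H_harmonic] by (simp add: HC_def[abs_def])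

lemma HC_cont: "continuous_on S HC"
  using has_cgrad_continuous_on[OF HC_cgrad] continuous_on_subset by blast

lemma cgradient_H_per: "cgradient H (z + \<i> * of_real L) = cgradient H z"
  using H_per[of "(Re z, Im z)"] by (simp add: cgradient_def grad_def L_def)

lemma cgradient_u_per: "z \<in> op_ext Z \<Longrightarrow> cgradient u (z + \<i> * of_real L) = cgradient u z"
proof -
  assume "z \<in> op_ext Z"
  then have "(Re z, Im z) \<in> - closure (Dcal \<epsilon> \<delta>)" by (simp only: closure_Dcal_iff)
  then have "grad u (Re z, Im z) = grad u (Re z, Im z + (2 + \<delta>))" using sol by (fastforce simp: is_solution_def)
  then show ?thesis by (simp add: cgradient_def grad_def L_def)
qed

lemma HC_per: "HC (z + \<i> * of_real L) = HC z + P"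
proof -
  have "((\<lambda>z. HC (z + \<i> * of_real L) - HC z) has_derivative (\<lambda>h. 0)) (at z within UNIV)" for z
  proof -
    have "has_cgrad (\<lambda>z. HC (\<i> * of_real L + 1 * z) - HC z) (\<lambda>z. 1 * cgradient H (\<i> * of_real L + 1 * z) - cgradient H z) UNIV"
      by (intro has_cgrad_diff has_cgrad_affine[OF HC_cgrad] HC_cgrad) auto
    then have "((\<lambda>z. HC (\<i> * of_real L + 1 * z) - HC z) has_derivative
        (\<lambda>h. Re ((1 * cgradient H (\<i> * of_real L + 1 * z) - cgradient H z) * h))) (at z)"
      unfolding has_cgrad_def by blast
    then show ?thesis using cgradient_H_per[of z] by (simp add: add.commute)
  qed
  then obtain c where c: "\<And>z. HC (z + \<i> * of_real L) - HC z = c"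
    using has_derivative_zero_constant[OF convex_UNIV, of "\<lambda>z. HC (z + \<i> * of_real L) - HC z"] by blast
  have e: "- \<i> * of_real (L / 2) + \<i> * of_real L = \<i> * of_real (L / 2)" by (simp add: complex_eq_iff)
  have "c = P" using c[of "- \<i> * of_real (L / 2)"] unfolding e by (simp add: P_def)
  then show ?thesis using c[of z] by simp
qed

lemma HC_per_int: "HC (z + of_int k * (\<i> * of_real L)) = HC z + of_int k * P"
  using vertical_period_int[of L UNIV HC P z k] HC_per by simp

definition T :: real where "T = U (\<i> * of_real L) - U 0"

lemma U_per_T: assumes "z \<in> cl_ext Z" shows "U (z + \<i> * of_real L) = U z + T"
proof -
  let ?D = "\<lambda>z. U (z + \<i> * of_real L) - U z"
  have "(?D has_derivative (\<lambda>h. 0)) (at z)" if z: "z \<in> op_ext Z" for z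
  proof -
    have "has_cgrad (\<lambda>z. U (\<i> * of_real L + 1 * z) - U z) (\<lambda>z. 1 * cgradient u (\<i> * of_real L + 1 * z) - cgradient u z) (op_ext Z)"
      by (intro has_cgrad_diff has_cgrad_affine[OF U_cgrad] U_cgrad open_op_ext)
        (simp add: ext_shift1 add.commute[of "\<i> * of_real L"])
    then have "((\<lambda>z. U (\<i> * of_real L + 1 * z) - U z) has_derivative
        (\<lambda>h. Re ((1 * cgradient u (\<i> * of_real L + 1 * z) - cgradient u z) * h))) (at z)"
      using z unfolding has_cgrad_def by blast
    then show ?thesis using cgradient_u_per[OF z] by (simp add: add.commute)
  qed
  moreover have "continuous_on (cl_ext Z) ?D"
    by (intro continuous_intros U_cont continuous_on_compose2[OF U_cont]) (auto simp: ext_shift1)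
  ultimately have "?D z = ?D 0" using assms by (rule zero_cgrad_const)
  then show ?thesis by (simp add: T_def)
qed

definition g :: "complex \<Rightarrow> real" where "g z = U z - HC z"
definition G :: "complex \<Rightarrow> complex" where "G z = cgradient u z - cgradient H z"

lemma g_cgrad: "has_cgrad g G (op_ext Z)"
  unfolding g_def[abs_def] G_def[abs_def]
  by (intro has_cgrad_diff U_cgrad has_cgrad_subset[OF HC_cgrad] open_op_ext) auto

lemma g_cont: "continuous_on (cl_ext Z) g"
  unfolding g_def[abs_def] by (intro continuous_intros U_cont HC_cont)

lemma g_per_T: "z \<in> cl_ext Z \<Longrightarrow> g (z + \<i> * of_real L) = g z + (T - P)"
  by (simp add: g_def U_per_T HC_per)

lemma norm_grad_diff:
  assumes "z \<in> op_ext Z"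
  shows "norm (grad (\<lambda>q. u q - H q) (Re z, Im z)) = norm (G z)"
proof -
  have "(Re z, Im z) \<in> - closure (Dcal \<epsilon> \<delta>)" using assms by (simp only: closure_Dcal_iff)
  then have "u differentiable (at (Re z, Im z))" "H differentiable (at (Re z, Im z))"
    using sol H_harmonic unfolding is_solution_def harmonic_on_def
    by (auto simp: differentiable_on_eq_differentiable_at)
  note d = differentiable_imp_DERIV_px[OF this(1)] differentiable_imp_DERIV_px[OF this(2)]
    differentiable_imp_DERIV_py[OF this(1)] differentiable_imp_DERIV_py[OF this(2)]
  have "px (\<lambda>q. u q - H q) (Re z, Im z) = px u (Re z, Im z) - px H (Re z, Im z)"
    using DERIV_imp_deriv[OF DERIV_diff[OF d(1,2)]] by (simp add: px_def)
  moreover have "py (\<lambda>q. u q - H q) (Re z, Im z) = py u (Re z, Im z) - py H (Re z, Im z)"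
    using DERIV_imp_deriv[OF DERIV_diff[OF d(3,4)]] by (simp add: py_def)
  ultimately show ?thesis
    by (simp add: grad_def G_def cgradient_def norm_Pair cmod_def power2_commute)
qed

lemma energy_box:
  obtains E where "\<And>a b. 3 \<le> a \<or> b \<le> - 3 \<Longrightarrow>
    integral (cbox (a, - L / 2) (b, L / 2)) (\<lambda>(x, y). (norm (G (Complex x y)))\<^sup>2) \<le> E"
proof -
  let ?f = "\<lambda>p. (norm (grad (\<lambda>q. u q - H q) p))\<^sup>2"
  let ?S = "Omega \<delta> - closure (DL \<epsilon> \<delta> 0 \<union> DR \<epsilon> \<delta> 0)"
  let ?\<phi> = "\<lambda>(x, y). (norm (G (Complex x y)))\<^sup>2"
  have int: "?f integrable_on ?S" using sol by (simp add: is_solution_def)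
  have "integral (cbox (a, - L / 2) (b, L / 2)) ?\<phi> \<le> integral ?S ?f" if ab: "3 \<le> a \<or> b \<le> - 3" for a b
  proof -
    \<comment> \<open>\<open>Omega \<delta>\<close> is an open strip, so the comparison is made on
      the open box; the boundary of the box is a null set.\<close>
    let ?C = "cbox (a, - L / 2) (b, L / 2)" and ?B = "box (a, - L / 2) (b, L / 2)"
    have inC: "Complex (fst p) (snd p) \<in> op_ext Z" if "p \<in> ?C" for p
      using that ab by (intro op_ext_if_Re) (cases p, auto simp: cbox_Pair_eq)
    have BC: "?B \<subseteq> ?C" by (rule box_subset_cbox)
    have "continuous_on (op_ext Z) G"
      using g_cgrad by (auto simp: has_cgrad_def intro: holomorphic_on_imp_continuous_on)
    then have "continuous_on ?C (\<lambda>p. G (Complex (fst p) (snd p)))"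
      by (rule continuous_on_compose2) (auto intro!: continuous_intros inC)
    then have "continuous_on ?C ?\<phi>" unfolding case_prod_unfold by (intro continuous_intros)
    then have iC: "?\<phi> integrable_on ?C" by (rule integrable_continuous)
    then have iB: "?\<phi> integrable_on ?B" by (simp only: integrable_on_open_interval)
    have eq: "?\<phi> p = ?f p" if "p \<in> ?B" for p
      using norm_grad_diff[OF inC[OF subsetD[OF BC that]]] by (simp add: case_prod_unfold)
    have BS: "?B \<subseteq> ?S"
    proof
      fix p assume p: "p \<in> ?B"
      have "DL \<epsilon> \<delta> 0 \<union> DR \<epsilon> \<delta> 0 \<subseteq> Dcal \<epsilon> \<delta>" by (auto simp: Dcal_def)
      then have "closure (DL \<epsilon> \<delta> 0 \<union> DR \<epsilon> \<delta> 0) \<subseteq> closure (Dcal \<epsilon> \<delta>)" by (rule closure_mono)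
      moreover have "p \<in> - closure (Dcal \<epsilon> \<delta>)"
        using closure_Dcal_iff[of "Complex (fst p) (snd p)"] inC[OF subsetD[OF BC p]] by simp
      moreover have "- L / 2 < snd p" "snd p < L / 2" using p by (cases p, simp add: mem_box Basis_prod_def)+
      then have "p \<in> Omega \<delta>" by (auto simp: Omega_def L_def abs_less_iff)
      ultimately show "p \<in> ?S" by blast
    qed
    have "integral ?C ?\<phi> = integral ?B ?\<phi>" by (simp only: integral_open_interval)
    also have "\<dots> = integral ?B ?f" by (rule integral_cong[OF eq])
    also have "\<dots> \<le> integral ?S ?f"
      by (rule integral_subset_le[OF BS integrable_eq[OF iB eq] int]) auto
    finally show ?thesis .
  qed
  then show thesis by (rule that)
qed

lemma T_eq_P: "T = P" and g_bounded_right: "\<exists>B. \<forall>z. Re z \<ge> 3 \<longrightarrow> \<bar>g z\<bar> \<le> B"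
proof -
  obtain E where E: "\<And>a b. 3 \<le> a \<or> b \<le> - 3 \<Longrightarrow>
    integral (cbox (a, - L / 2) (b, L / 2)) (\<lambda>(x, y). (norm (G (Complex x y)))\<^sup>2) \<le> E" using energy_box by blast
  have g: "has_cgrad g G {z. Re z > 5 / 2}"
    by (rule has_cgrad_subset[OF g_cgrad open_halfspace_Re_gt]) (auto intro!: op_ext_if_Re)
  have per: "g (z + \<i> * of_real L) = g z + (T - P)" if "Re z > 5 / 2" for z
    using that op_ext_subset_cl_ext by (intro g_per_T) (auto intro!: subsetD[OF op_ext_subset_cl_ext] op_ext_if_Re)
  note r = half_cylinder_finite_energy[OF g L_bounds(3) per E]
  show "T = P" using r(1) by simp
  show "\<exists>B. \<forall>z. Re z \<ge> 3 \<longrightarrow> \<bar>g z\<bar> \<le> B" using r(2) by simp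
qed

text \<open>The point reflection z -> -z carries the left end to the right end and, unlike the
  reflection in the imaginary axis, is complex affine.\<close>

lemma g_bounded_left: "\<exists>B. \<forall>z. Re z \<le> - 3 \<longrightarrow> \<bar>g z\<bar> \<le> B"
proof -
  obtain E where E: "\<And>a b. 3 \<le> a \<or> b \<le> - 3 \<Longrightarrow>
    integral (cbox (a, - L / 2) (b, L / 2)) (\<lambda>(x, y). (norm (G (Complex x y)))\<^sup>2) \<le> E" using energy_box by blast
  let ?g = "\<lambda>z. g (0 + (- 1) * z)" and ?G = "\<lambda>z. (- 1) * G (0 + (- 1) * z)"
  have g: "has_cgrad ?g ?G {z. Re z > 5 / 2}"
    by (rule has_cgrad_affine[OF g_cgrad open_halfspace_Re_gt]) (auto intro!: op_ext_if_Re)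
  have per: "?g (z + \<i> * of_real L) = ?g z + 0" if z: "Re z > 5 / 2" for z
  proof -
    have "- z - \<i> * of_real L \<in> cl_ext Z"
      by (rule subsetD[OF op_ext_subset_cl_ext]) (use z in \<open>auto intro!: op_ext_if_Re\<close>)
    from g_per_T[OF this] show ?thesis by (simp add: T_eq_P)
  qed
  have E': "integral (cbox (3, - L / 2) (N, L / 2)) (\<lambda>(x, y). (norm (?G (Complex x y)))\<^sup>2) \<le> E" for N
  proof -
    have "- Complex x y = Complex (- x) (- y)" for x y by (simp add: complex_eq_iff)
    then have "(\<lambda>(x, y). (norm (?G (Complex x y)))\<^sup>2) = (\<lambda>p. (\<lambda>(x, y). (norm (G (Complex x y)))\<^sup>2) (- p))"
      by (auto simp: fun_eq_iff)
    moreover have "cbox (3, - L / 2) (N, L / 2) = cbox (- (- 3, L / 2)) (- (- N, - L / 2))" by simp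
    ultimately show ?thesis
      using E[of "- N" "- 3"] integral_reflect[of "(- 3, L / 2)" "(- N, - L / 2)" "\<lambda>(x, y). (norm (G (Complex x y)))\<^sup>2"]
      by simp
  qed
  obtain B where B: "\<And>z. Re z \<ge> 3 \<Longrightarrow> \<bar>?g z\<bar> \<le> B"
    using half_cylinder_finite_energy(2)[OF g L_bounds(3) per E'] by blast
  have "\<bar>g z\<bar> \<le> B" if "Re z \<le> - 3" for z using B[of "- z"] that by simp
  then show ?thesis by blast
qed

lemma g_per_int: "z \<in> cl_ext Z \<Longrightarrow> g (z + of_int k * (\<i> * of_real L)) = g z"
  using vertical_period_int[of L "cl_ext Z" g 0 z k] g_per_T T_eq_P by (simp add: ext_shift1)

lemma U_per_int: "z \<in> cl_ext Z \<Longrightarrow> U (z + of_int k * (\<i> * of_real L)) = U z + of_int k * P"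
  using vertical_period_int[of L "cl_ext Z" U P z k] U_per_T T_eq_P by (simp add: ext_shift1)

lemma g_bounded: obtains B where "\<And>z. z \<in> cl_ext Z \<Longrightarrow> \<bar>g z\<bar> \<le> B"
proof -
  obtain B1 where B1: "\<And>z. Re z \<ge> 3 \<Longrightarrow> \<bar>g z\<bar> \<le> B1" using g_bounded_right by blast
  obtain B2 where B2: "\<And>z. Re z \<le> - 3 \<Longrightarrow> \<bar>g z\<bar> \<le> B2" using g_bounded_left by blast
  let ?K = "cl_ext Z \<inter> cbox (Complex (- 3) (- L / 2)) (Complex 3 (L / 2))"
  have "compact ?K" by (simp add: closed_Int_compact closed_cl_ext)
  then have "bounded (g ` ?K)"
    by (intro compact_imp_bounded compact_continuous_image continuous_on_subset[OF g_cont]) auto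
  then obtain B3 where B3: "\<And>z. z \<in> ?K \<Longrightarrow> \<bar>g z\<bar> \<le> B3"
    unfolding bounded_iff by (metis image_eqI real_norm_def)
  have "\<bar>g z\<bar> \<le> max B1 (max B2 B3)" if z: "z \<in> cl_ext Z" for z
  proof -
    consider "Re z \<ge> 3" | "Re z \<le> - 3" | "- 3 \<le> Re z" "Re z \<le> 3" by linarith
    then show ?thesis
    proof cases
      case 3
      obtain k :: int where k: "\<bar>Im (z + of_int k * (\<i> * of_real L))\<bar> \<le> L / 2"
        using vertical_reduce[OF L_bounds(3)] by blast
      have "- L / 2 \<le> Im (z + of_int k * (\<i> * of_real L))" "Im (z + of_int k * (\<i> * of_real L)) \<le> L / 2"
        using k unfolding abs_le_iff by auto
      then have "z + of_int k * (\<i> * of_real L) \<in> ?K" using z 3 by (simp add: ext_shift in_cbox_complex_iff)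
      from B3[OF this] show ?thesis by (simp add: g_per_int[OF z])
    qed (use B1 B2 in force)+
  qed
  then show thesis by (rule that)
qed

text \<open>\<open>M\<close> is a supremum over an open strip, but height L/2 is needed as well;
  values there are limits of values at height t * Im z as t tends to 1. Compactness of a larger box
  makes the supremum finite.\<close>

lemma HC_bound1: assumes "\<bar>Re z\<bar> < 4" "\<bar>Im z\<bar> \<le> L / 2" shows "\<bar>HC z\<bar> \<le> M"
proof -
  have "continuous_on (cbox (- 4, - 2) (4, 2)) (\<lambda>p. \<bar>HC (Complex (fst p) (snd p))\<bar>)"
    by (intro continuous_intros continuous_on_compose2[OF HC_cont[of UNIV]]) auto
  then have "bounded ((\<lambda>p. \<bar>H p\<bar>) ` cbox (- 4, - 2) (4, 2))"
    unfolding HC_def by (intro compact_imp_bounded compact_continuous_image) auto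
  then have "bounded ((\<lambda>p. \<bar>H p\<bar>) ` Omega_m \<delta> 4)"
    by (rule bounded_subset) (use del in \<open>force simp: Omega_m_def Omega_def cbox_Pair_eq intro!: image_mono\<close>)
  then have bdd: "bdd_above ((\<lambda>p. \<bar>H p\<bar>) ` Omega_m \<delta> 4)" by (rule bounded_imp_bdd_above)
  have inner: "\<bar>HC (Complex (Re z) (t * Im z))\<bar> \<le> M" if "0 < t" "t < 1" for t
  proof -
    have "\<bar>t * Im z\<bar> < L / 2"
    proof (cases "Im z = 0")
      case False
      then have "t * \<bar>Im z\<bar> < 1 * \<bar>Im z\<bar>" using that by (intro mult_strict_right_mono) auto
      then show ?thesis using that assms by (simp add: abs_mult)
    qed (use L_bounds in simp)
    then have "(Re z, t * Im z) \<in> Omega_m \<delta> 4" using assms by (simp add: Omega_m_def Omega_def L_def)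
    then have "\<bar>H (Re z, t * Im z)\<bar> \<le> M" unfolding M_def by (rule cSUP_upper[OF _ bdd])
    then show ?thesis by (simp add: HC_def)
  qed
  have "continuous_on UNIV (\<lambda>t. \<bar>HC (Complex (Re z) (t * Im z))\<bar>)"
    by (intro continuous_intros continuous_on_compose2[OF HC_cont[of UNIV]]) auto
  then have "((\<lambda>t. \<bar>HC (Complex (Re z) (t * Im z))\<bar>) \<longlongrightarrow> \<bar>HC (Complex (Re z) (1 * Im z))\<bar>) (at 1)"
    unfolding continuous_on_def by blast
  then have lim: "((\<lambda>t. \<bar>HC (Complex (Re z) (t * Im z))\<bar>) \<longlongrightarrow> \<bar>HC (Complex (Re z) (1 * Im z))\<bar>) (at_left 1)"
    by (rule tendsto_within_subset) simp
  have "eventually (\<lambda>t. \<bar>HC (Complex (Re z) (t * Im z))\<bar> \<le> M) (at_left 1)"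
    unfolding eventually_at_left_field by (intro exI[of _ 0]) (auto intro!: inner)
  from tendsto_upperbound[OF lim this] show ?thesis by simp
qed

lemma M_nonneg: "M \<ge> 0"
  using HC_bound1[of 0] L_bounds by force

lemma P_bound: "\<bar>P\<bar> \<le> 2 * M"
  using HC_bound1[of "\<i> * of_real (L / 2)"] HC_bound1[of "- \<i> * of_real (L / 2)"] L_bounds by (simp add: P_def)

text \<open>A shift by one period changes \<open>HC\<close> by \<open>P\<close>, and |P| <= 2 M.
  Three periods contain the neighbourhoods of all points that are examined later.\<close>

lemma HC_bound3: assumes "\<bar>Re z\<bar> < 4" "\<bar>Im z\<bar> \<le> 3 * L / 2" shows "\<bar>HC z\<bar> \<le> 3 * M"
proof -
  have "\<exists>k :: int. \<bar>of_int k :: real\<bar> \<le> 1 \<and> \<bar>Im z + of_int k * L\<bar> \<le> L / 2"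
  proof -
    consider "\<bar>Im z\<bar> \<le> L / 2" | "Im z > L / 2" | "Im z < - (L / 2)" by linarith
    then show ?thesis
    proof cases
      case 1
      then show ?thesis by (intro exI[of _ 0]) simp
    next
      case 2
      then have "\<bar>Im z - L\<bar> \<le> L / 2" using assms by linarith
      then show ?thesis by (intro exI[of _ "- 1"]) simp
    next
      case 3
      then have "\<bar>Im z + L\<bar> \<le> L / 2" using assms by linarith
      then show ?thesis by (intro exI[of _ 1]) simp
    qed
  qed
  then obtain k :: int where k: "\<bar>of_int k :: real\<bar> \<le> 1" "\<bar>Im z + of_int k * L\<bar> \<le> L / 2" by blast
  have "\<bar>HC (z + of_int k * (\<i> * of_real L))\<bar> \<le> M" using k(2) assms by (intro HC_bound1) auto
  then have 1: "\<bar>HC z + of_int k * P\<bar> \<le> M" by (simp add: HC_per_int)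
  have "\<bar>of_int k * P\<bar> \<le> 1 * (2 * M)" unfolding abs_mult using k(1) P_bound by (intro mult_mono) auto
  then show ?thesis using 1 by linarith
qed

lemma U_on_R0: "dist z (cR 0) = 1 \<Longrightarrow> U z = KR"
  and U_on_L0: "dist z (cL 0) = 1 \<Longrightarrow> U z = KL"
proof -
  obtain kR where kR: "\<And>p. p \<in> frontier (DR \<epsilon> \<delta> 0) \<Longrightarrow> u p = kR"
    using sol unfolding is_solution_def const_on_def by blast
  obtain kL where kL: "\<And>p. p \<in> frontier (DL \<epsilon> \<delta> 0) \<Longrightarrow> u p = kL"
    using sol unfolding is_solution_def const_on_def by blast
  have R: "U z = kR" if "dist z (cR 0) = 1" for z
    unfolding U_def using that dist_pt_complex[of z "1 + \<epsilon> / 2" 0] by (intro kR) (simp add: DR_def cR_def dist_commute)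
  have Lf: "U z = kL" if "dist z (cL 0) = 1" for z
    unfolding U_def using that dist_pt_complex[of z "- 1 - \<epsilon> / 2" 0] by (intro kL) (simp add: DL_def cL_def dist_commute)
  show "U z = KR" if "dist z (cR 0) = 1"
    using R[OF that] R[of "cR 0 + 1"] by (simp add: KR_def dist_norm)
  show "U z = KL" if "dist z (cL 0) = 1"
    using Lf[OF that] Lf[of "cL 0 + 1"] by (simp add: KL_def dist_norm)
qed

lemma U_on_R: assumes "z \<in> cl_ext Z" "dist z (cR n) = 1" shows "U z = KR + of_int n * P"
proof -
  have "dist (z + of_int (- n) * (\<i> * of_real L)) (cR 0) = dist z (cR n)"
    by (simp add: dist_norm cR_def cmod_def algebra_simps)
  then have "U (z + of_int (- n) * (\<i> * of_real L)) = KR" using assms U_on_R0 by simp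
  then show ?thesis using U_per_int[OF assms(1), of "- n"] by simp
qed

lemma U_on_L: assumes "z \<in> cl_ext Z" "dist z (cL n) = 1" shows "U z = KL + of_int n * P"
proof -
  have "dist (z + of_int (- n) * (\<i> * of_real L)) (cL 0) = dist z (cL n)"
    by (simp add: dist_norm cL_def cmod_def algebra_simps)
  then have "U (z + of_int (- n) * (\<i> * of_real L)) = KL" using assms U_on_L0 by simp
  then show ?thesis using U_per_int[OF assms(1), of "- n"] by simp
qed

lemma g_on_boundary:
  assumes z: "z \<in> cl_ext Z - op_ext Z"
  shows "\<bar>g z - KR\<bar> \<le> M \<or> \<bar>g z - KL\<bar> \<le> M"
proof -
  obtain c where c: "c \<in> Z" "dist z c = 1" using z unfolding cl_ext_def op_ext_def by force
  have shift: "\<bar>HC w\<bar> \<le> M" if "dist w d = 1" "\<bar>Re d\<bar> = 1 + \<epsilon> / 2" "Im d = 0" for w d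
  proof (rule HC_bound1)
    have "\<bar>Re w - Re d\<bar> \<le> 1" "\<bar>Im w - Im d\<bar> \<le> 1"
      using that abs_Re_le_cmod[of "w - d"] abs_Im_le_cmod[of "w - d"] by (auto simp: dist_norm)
    then show "\<bar>Re w\<bar> < 4" "\<bar>Im w\<bar> \<le> L / 2" using that eps L_bounds by auto
  qed
  from c(1) show ?thesis
  proof (cases rule: Z_cases)
    case (1 n)
    let ?w = "z + of_int (- n) * (\<i> * of_real L)"
    have w: "dist ?w (cR 0) = 1" using c(2) 1 by (simp add: dist_norm cR_def cmod_def algebra_simps)
    have "g z = g ?w" using g_per_int[of z "- n"] z by simp
    then have "g z = KR - HC ?w" using U_on_R0[OF w] by (simp add: g_def)
    then show ?thesis using shift[OF w] eps by (simp add: cR_def)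
  next
    case (2 n)
    let ?w = "z + of_int (- n) * (\<i> * of_real L)"
    have w: "dist ?w (cL 0) = 1" using c(2) 2 by (simp add: dist_norm cL_def cmod_def algebra_simps)
    have "g z = g ?w" using g_per_int[of z "- n"] z by simp
    then have "g z = KL - HC ?w" using U_on_L0[OF w] by (simp add: g_def)
    then show ?thesis using shift[OF w] eps by (simp add: cL_def)
  qed
qed

text \<open>On every circle g is within \<open>M\<close> of \<open>KR\<close> or of
  \<open>KL\<close>, hence within M + |KR - KL| / 2 of their mean; since g is bounded, the maximum
  principle carries this to the whole domain.\<close>

lemma g_bound:
  assumes z: "z \<in> cl_ext Z"
  shows "\<bar>g z - (KR + KL) / 2\<bar> \<le> M + \<bar>KR - KL\<bar> / 2"
proof -
  obtain B where B: "\<And>z. z \<in> cl_ext Z \<Longrightarrow> \<bar>g z\<bar> \<le> B" using g_bounded by blast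
  let ?K = "(KR + KL) / 2"
  have bd: "\<bar>g w - ?K\<bar> \<le> M + \<bar>KR - KL\<bar> / 2" if "w \<in> cl_ext Z - op_ext Z" for w
    using g_on_boundary[OF that] by (auto simp: abs_if field_simps split: if_splits)
  have "g z - ?K \<le> M + \<bar>KR - KL\<bar> / 2"
  proof (rule bounded_maximum_principle[OF has_cgrad_minus_const[OF g_cgrad] _ _ _ z])
    show "continuous_on (cl_ext Z) (\<lambda>z. g z - ?K)" by (intro continuous_intros g_cont)
    show "g w - ?K \<le> B - ?K" if "w \<in> cl_ext Z" for w using B[OF that] by simp
    show "g w - ?K \<le> M + \<bar>KR - KL\<bar> / 2" if "w \<in> cl_ext Z - op_ext Z" for w using bd[OF that] by simp
  qed
  moreover have "- 1 * (g z - ?K) \<le> M + \<bar>KR - KL\<bar> / 2"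
  proof (rule bounded_maximum_principle[OF has_cgrad_scale[OF has_cgrad_minus_const[OF g_cgrad]] _ _ _ z])
    show "continuous_on (cl_ext Z) (\<lambda>z. - 1 * (g z - ?K))" by (intro continuous_intros g_cont)
    show "- 1 * (g w - ?K) \<le> B + ?K" if "w \<in> cl_ext Z" for w using B[OF that] by simp
    show "- 1 * (g w - ?K) \<le> M + \<bar>KR - KL\<bar> / 2" if "w \<in> cl_ext Z - op_ext Z" for w
      using bd[OF that] unfolding abs_le_iff by simp
  qed
  ultimately show ?thesis unfolding abs_le_iff by simp
qed

lemma U_bound:
  assumes "z \<in> cl_ext Z" "\<bar>Re z\<bar> < 4" "\<bar>Im z\<bar> \<le> 3 * L / 2"
  shows "\<bar>U z - (KR + KL) / 2\<bar> \<le> 4 * M + \<bar>KR - KL\<bar> / 2"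
  using g_bound[OF assms(1)] HC_bound3[OF assms(2,3)] by (simp add: g_def abs_le_iff)

end

subsection \<open>The flux and the potential difference\<close>

lemma one_minus_cos_le: "1 - x\<^sup>2 / 2 \<le> cos (x :: real)"
proof -
  have "(sin (x / 2))\<^sup>2 \<le> (x / 2)\<^sup>2" using power_mono[OF abs_sin_x_le_abs_x[of "x / 2"], of 2] by (simp add: power_divide)
  moreover have "cos x = 1 - 2 * (sin (x / 2))\<^sup>2" using cos_double_sin[of "x / 2"] by simp
  ultimately show ?thesis by (simp add: power_divide)
qed

text \<open>With C = 1 + \<gamma> / 2, e = cis \<theta> and q = C + e, the relation C^2 - a^2 = 1 =
  e * cnj e gives q^2 - a^2 = 2 e (C + cos \<theta>). The real part of the left side is the outward
  radial derivative of \<open>bip\<close>; the imaginary part vanishes because \<open>bip\<close> is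
  constant on the circle.\<close>

lemma bip'_on_circle:
  assumes \<gamma>: "\<gamma> > 0"
  shows "bip' \<gamma> (of_real (1 + \<gamma> / 2) + cis \<theta>) * cis \<theta> = - of_real (bip_a \<gamma> / (1 + \<gamma> / 2 + cos \<theta>))"
proof -
  let ?a = "complex_of_real (bip_a \<gamma>)" and ?C = "complex_of_real (1 + \<gamma> / 2)" and ?e = "cis \<theta>"
  let ?q = "?C + ?e"
  have "bip_a \<gamma> ^ 2 = (1 + \<gamma> / 2)\<^sup>2 - 1" unfolding bip_a_sq[OF \<gamma>] by (simp add: power2_eq_square field_simps)
  then have a2: "?a\<^sup>2 = ?C\<^sup>2 - 1" by (metis of_real_diff of_real_power of_real_1)
  have ee: "?e * cnj ?e = 1" by (simp add: complex_eq_iff power2_eq_square[symmetric])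
  have cc: "?e + cnj ?e = of_real (2 * cos \<theta>)" by (simp add: complex_eq_iff)
  have pos: "1 + \<gamma> / 2 + cos \<theta> > 0" using \<gamma> cos_ge_minus_one[of \<theta>] by linarith
  have prod: "(?q + ?a) * (?q - ?a) = ?e * (2 * of_real (1 + \<gamma> / 2 + cos \<theta>))"
  proof -
    have "(?q + ?a) * (?q - ?a) = (?C\<^sup>2 - ?a\<^sup>2) + 2 * ?C * ?e + ?e * ?e"
      by (simp add: power2_eq_square algebra_simps)
    also have "\<dots> = ?e * cnj ?e + 2 * ?C * ?e + ?e * ?e" unfolding a2 ee by simp
    also have "\<dots> = ?e * (2 * ?C + (?e + cnj ?e))" by (simp add: algebra_simps)
    also have "\<dots> = ?e * (2 * of_real (1 + \<gamma> / 2 + cos \<theta>))" unfolding cc by simp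
    finally show ?thesis .
  qed
  have nz: "of_real (1 + \<gamma> / 2 + cos \<theta>) \<noteq> (0 :: complex)" using pos by (metis of_real_eq_0_iff less_irrefl)
  then have "(?q + ?a) * (?q - ?a) \<noteq> 0" unfolding prod by (metis cis_neq_zero mult_eq_0_iff zero_neq_numeral)
  then have n: "?q + ?a \<noteq> 0" "?q - ?a \<noteq> 0" by auto
  have "bip' \<gamma> ?q = (- (2 * ?a)) / ((?q + ?a) * (?q - ?a))"
    using n unfolding bip'_def by (simp add: diff_frac_eq)
  then have "bip' \<gamma> ?q * ?e = (- (2 * ?a)) / (?e * (2 * of_real (1 + \<gamma> / 2 + cos \<theta>))) * ?e"
    unfolding prod by simp
  also have "\<dots> = - (?a / of_real (1 + \<gamma> / 2 + cos \<theta>))"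
  proof -
    have "(- (2 * a)) / (e * (2 * X)) * e = - (a / X)" if "e \<noteq> 0" for a e X :: complex
      using that by simp
    from this[OF cis_neq_zero] show ?thesis .
  qed
  finally show ?thesis by (simp only: of_real_divide)
qed

context disk_array
begin

text \<open>867/1000 exceeds sqrt 3 / 2, so the vertical distance is at least 2 - 867/1000 =
  1133/1000; together with the horizontal distance 1/2 the squared distance exceeds 36/25.\<close>

lemma far_row:
  assumes n: "n \<noteq> 0" and c: "Im c = of_int n * L" and z: "(Im z)\<^sup>2 \<le> 3 / 4" "1 / 2 \<le> \<bar>Re z - Re c\<bar>"
  shows "6 / 5 < dist z c"
proof -
  have "\<bar>Im z\<bar> \<le> 867 / 1000"
  proof (rule power2_le_imp_le)
    show "\<bar>Im z\<bar>\<^sup>2 \<le> (867 / 1000)\<^sup>2" using z(1) by (simp add: power2_eq_square)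
  qed simp
  moreover have "2 \<le> \<bar>of_int n * L\<bar>"
  proof -
    have "1 \<le> \<bar>of_int n :: real\<bar>" using n by linarith
    then have "1 * 2 \<le> \<bar>of_int n\<bar> * L" using L_bounds by (intro mult_mono) auto
    then show ?thesis using L_bounds by (simp add: abs_mult)
  qed
  ultimately have "1133 / 1000 \<le> \<bar>Im z - Im c\<bar>" unfolding c by linarith
  from power_mono[OF this, of 2] have "1133 / 1000 * (1133 / 1000) \<le> (Im z - Im c)\<^sup>2" by (simp add: power2_eq_square)
  moreover from power_mono[OF z(2), of 2] have "1 / 4 \<le> (Re z - Re c)\<^sup>2" by (simp add: power2_eq_square)
  ultimately have "(6 / 5)\<^sup>2 < (dist z c)\<^sup>2" unfolding dist_norm cmod_power2 by (simp add: power2_eq_square)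
  then show ?thesis by (rule power_less_imp_less_base) simp
qed

lemma centers_apart: assumes "c \<in> Z" "c \<noteq> cR 0" shows "2 + min \<epsilon> \<delta> \<le> dist (cR 0) c"
  using assms(1)
proof (cases rule: Z_cases)
  case (1 n)
  then have "n \<noteq> 0" using assms(2) by auto
  then have "1 \<le> \<bar>of_int n :: real\<bar>" by linarith
  then have "1 * L \<le> \<bar>of_int n\<bar> * L" using L_bounds by (intro mult_right_mono) auto
  also have "\<dots> = \<bar>Im (cR 0 - c)\<bar>" using 1 L_bounds by (simp add: cR_def abs_mult)
  also have "\<dots> \<le> dist (cR 0) c" unfolding dist_norm by (rule abs_Im_le_cmod)
  finally show ?thesis by (simp add: L_def)
next
  case (2 n)
  have "2 + \<epsilon> = \<bar>Re (cR 0 - c)\<bar>" using 2 eps by (simp add: cR_def cL_def)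
  also have "\<dots> \<le> dist (cR 0) c" unfolding dist_norm by (rule abs_Re_le_cmod)
  finally show ?thesis by simp
qed

text \<open>The one-sided difference quotients of the flux are thus formed from values in the closed
  domain, where the barrier bound is available.\<close>

lemma radial_in_cl_ext:
  assumes "0 \<le> t" "t \<le> min \<epsilon> \<delta>"
  shows "cR 0 + of_real (1 + t) * cis \<theta> \<in> cl_ext Z"
  unfolding cl_ext_def
proof safe
  fix c assume c: "c \<in> Z"
  let ?z = "cR 0 + of_real (1 + t) * cis \<theta>"
  have d: "dist ?z (cR 0) = 1 + t" using assms(1) by (simp only: dist_norm add_diff_cancel_left' norm_mult norm_cis norm_of_real) simp
  show "1 \<le> dist ?z c"
  proof (cases "c = cR 0")
    case True
    then show ?thesis using d assms by simp
  next
    case False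
    show ?thesis using centers_apart[OF c False] dist_triangle[of "cR 0" c ?z] d[unfolded dist_commute[of ?z]] assms(2)
      by linarith
  qed
qed

lemma circle_dist: "dist (cR 0 + cis \<theta>) (cR 0) = 1" by (simp add: dist_norm)

lemma circle_in_cl_ext: "cR 0 + cis \<theta> \<in> cl_ext Z"
  using radial_in_cl_ext[of 0 \<theta>] eps del by simp

text \<open>f vanishes at the boundary point, so the linear barrier bound divided by t bounds the
  difference quotient. The normal derivative enters only as a limit of such quotients, the form in
  which \<open>zero_flux\<close> provides it.\<close>

lemma flux_density_bound:
  assumes f: "has_cgrad f F (op_ext Z)" and cont: "continuous_on (cl_ext Z) f"
    and zero: "\<And>z. z \<in> cl_ext Z - op_ext Z \<Longrightarrow> dist z (cR 0 + cis \<theta>) \<le> 1 / 10 \<Longrightarrow> f z = 0"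
    and bd: "\<And>z. z \<in> cl_ext Z \<Longrightarrow> dist z (cR 0 + cis \<theta>) \<le> 1 / 10 \<Longrightarrow> \<bar>f z\<bar> \<le> B"
    and lim: "((\<lambda>t. (f (cR 0 + cis \<theta>) - f (cR 0 + of_real (1 + t) * cis \<theta>)) / t) \<longlongrightarrow> l) (at_right 0)"
  shows "\<bar>l\<bar> \<le> 4 / ln (1 + 2 * (1 / 10)\<^sup>2) * B"
proof (rule tendsto_upperbound[OF tendsto_rabs[OF lim]])
  let ?q = "cR 0 + cis \<theta>" and ?z = "\<lambda>t. cR 0 + of_real (1 + t) * cis \<theta>"
  have q: "?q \<in> cl_ext Z" by (rule circle_in_cl_ext)
  have "?q \<notin> op_ext Z" using circle_dist[of \<theta>] by (auto simp: op_ext_def intro!: bexI[of _ "cR 0"])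
  then have fq: "f ?q = 0" using q by (intro zero) auto
  have "\<bar>(f ?q - f (?z t)) / t\<bar> \<le> 4 / ln (1 + 2 * (1 / 10)\<^sup>2) * B" if t: "0 < t" "t < min \<epsilon> \<delta>" for t
  proof -
    have dq: "dist (?z t) ?q = t"
    proof -
      have "?z t - ?q = of_real t * cis \<theta>" by (simp add: algebra_simps)
      then have "norm (?z t - ?q) = norm (of_real t * cis \<theta>)" by (rule arg_cong)
      then show ?thesis unfolding dist_norm using t by (simp add: norm_mult)
    qed
    have "\<bar>f (?z t)\<bar> \<le> 4 / ln (1 + 2 * (1 / 10)\<^sup>2) * B * dist (?z t) ?q"
    proof (rule linear_bound_near_circle[OF f cont cR_in_Z circle_dist])
      show "?z t \<in> cl_ext Z" using t by (intro radial_in_cl_ext) auto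
      show "dist (?z t) ?q \<le> 1 / 10" unfolding dq using t eps by simp
    qed (use zero bd in auto)
    then show ?thesis unfolding dq fq using t by (simp add: abs_divide divide_le_eq)
  qed
  then show "eventually (\<lambda>t. \<bar>(f ?q - f (?z t)) / t\<bar> \<le> 4 / ln (1 + 2 * (1 / 10)\<^sup>2) * B) (at_right 0)"
    unfolding eventually_at_right_field using eps del by (intro exI[of _ "min \<epsilon> \<delta>"]) auto
qed simp

lemma bip_flux_density:
  "((\<lambda>t. (bip \<epsilon> (cR 0 + cis \<theta>) - bip \<epsilon> (cR 0 + of_real (1 + t) * cis \<theta>)) / t)
     \<longlongrightarrow> bip_a \<epsilon> / (1 + \<epsilon> / 2 + cos \<theta>)) (at_right 0)"
proof -
  let ?q = "cR 0 + cis \<theta>"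
  have c0: "cR 0 = of_real (1 + \<epsilon> / 2)" by (simp add: cR_def complex_eq_iff)
  \<comment> \<open>The coordinate is harmonic off its two poles, so the circle is interior to this
    set and a two-sided derivative exists on it.\<close>
  let ?W = "- {of_real (bip_a \<epsilon>), - of_real (bip_a \<epsilon>)} :: complex set"
  have op: "open ?W" by (intro open_Compl finite_imp_closed) simp
  have g: "has_cgrad (bip \<epsilon>) (bip' \<epsilon>) ?W"
    unfolding bip_def[abs_def] bip'_def[abs_def] using op by (intro has_cgrad_diff has_cgrad_ln_norm) auto
  have "1 \<le> dist ?q (cR 0)" "1 \<le> dist ?q (cL 0)"
    using circle_in_cl_ext[of \<theta>] cR_in_Z[of 0] cL_in_Z[of 0] unfolding cl_ext_def by blast+
  moreover have "cL 0 = - of_real (1 + \<epsilon> / 2)" by (simp add: cL_def complex_eq_iff)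
  ultimately have "?q \<in> ?W" using bip_a_in_disk[OF eps(1)] unfolding c0 by force
  from has_cgrad_DERIV_Re[OF g this, of "cis \<theta>"]
  have "((\<lambda>t. bip \<epsilon> (?q + of_real t * cis \<theta>)) has_real_derivative - (bip_a \<epsilon> / (1 + \<epsilon> / 2 + cos \<theta>))) (at 0)"
    unfolding c0 bip'_on_circle[OF eps(1)] by (simp only: uminus_complex.simps Re_complex_of_real)
  then have "((\<lambda>t. (bip \<epsilon> (?q + of_real t * cis \<theta>) - bip \<epsilon> ?q) / t) \<longlongrightarrow> - (bip_a \<epsilon> / (1 + \<epsilon> / 2 + cos \<theta>))) (at 0)"
    by (simp add: DERIV_def)
  then have "((\<lambda>t. (bip \<epsilon> (?q + of_real t * cis \<theta>) - bip \<epsilon> ?q) / t) \<longlongrightarrow> - (bip_a \<epsilon> / (1 + \<epsilon> / 2 + cos \<theta>))) (at_right 0)"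
    by (rule tendsto_within_subset) simp
  from tendsto_minus[OF this]
  have "((\<lambda>t. (bip \<epsilon> ?q - bip \<epsilon> (?q + of_real t * cis \<theta>)) / t) \<longlongrightarrow> bip_a \<epsilon> / (1 + \<epsilon> / 2 + cos \<theta>)) (at_right 0)"
    by (simp only: minus_divide_left minus_diff_eq minus_minus)
  moreover have "?q + of_real t * cis \<theta> = cR 0 + of_real (1 + t) * cis \<theta>" for t by (simp add: algebra_simps)
  ultimately show ?thesis by simp
qed

end

context array_solution
begin

definition K :: real where "K = KR - KL"
definition Us :: "complex \<Rightarrow> real" where "Us z = U z + U (cnj z)"
text \<open>Barrier slope at radius 1/10 times a bound for what is left of \<open>Us\<close> once
  its boundary values near a point of the circle have been subtracted.\<close>

definition Bs :: real where "Bs = 4 / ln (1 + 2 * (1 / 10)\<^sup>2) * (8 * M + 2 * \<bar>K\<bar>)"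

lemma Us_cgrad: "has_cgrad Us (\<lambda>z. cgradient u z + cnj (cgradient u (cnj z))) (op_ext Z)"
  unfolding Us_def[abs_def]
  by (intro has_cgrad_add U_cgrad has_cgrad_cnj[OF U_cgrad] open_op_ext) (auto simp: ext_cnj)

lemma Us_cont: "continuous_on (cl_ext Z) Us"
  unfolding Us_def[abs_def]
  by (intro continuous_intros U_cont continuous_on_compose2[OF U_cont]) (auto simp: ext_cnj)

text \<open>Conjugation exchanges the rows n and -n, so the increments n P and -n P cancel.\<close>

lemma Us_on_R: assumes "z \<in> cl_ext Z" "dist z (cR n) = 1" shows "Us z = 2 * KR"
proof -
  have "dist (cnj z) (cR (- n)) = dist z (cR n)"
    by (simp add: dist_norm cR_def cmod_def) (simp add: power2_eq_square algebra_simps)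
  then show ?thesis using U_on_R[OF assms] U_on_R[of "cnj z" "- n"] assms by (simp add: Us_def ext_cnj)
qed

lemma Us_on_L: assumes "z \<in> cl_ext Z" "dist z (cL n) = 1" shows "Us z = 2 * KL"
proof -
  have "dist (cnj z) (cL (- n)) = dist z (cL n)"
    by (simp add: dist_norm cL_def cmod_def) (simp add: power2_eq_square algebra_simps)
  then show ?thesis using U_on_L[OF assms] U_on_L[of "cnj z" "- n"] assms by (simp add: Us_def ext_cnj)
qed

lemma Us_bound:
  assumes "z \<in> cl_ext Z" "\<bar>Re z\<bar> < 4" "\<bar>Im z\<bar> \<le> 3 * L / 2"
  shows "\<bar>Us z - (KR + KL)\<bar> \<le> 8 * M + \<bar>K\<bar>"
proof -
  have arith: "\<bar>(a + b) - s\<bar> \<le> 8 * m + k" if "\<bar>a - s / 2\<bar> \<le> 4 * m + k / 2" "\<bar>b - s / 2\<bar> \<le> 4 * m + k / 2" for a b s m k :: real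
    using that by linarith
  have "\<bar>U (cnj z) - (KR + KL) / 2\<bar> \<le> 4 * M + \<bar>KR - KL\<bar> / 2"
    using assms by (intro U_bound) (auto simp: ext_cnj)
  from arith[OF U_bound[OF assms] this] show ?thesis by (simp add: Us_def K_def)
qed

lemma near_circle_region:
  assumes "dist z (cR 0 + cis \<theta>) \<le> 1 / 10"
  shows "\<bar>Re z\<bar> < 4" "\<bar>Im z\<bar> \<le> 3 * L / 2"
proof -
  have "dist z (cR 0) \<le> 11 / 10" using dist_triangle[of z "cR 0" "cR 0 + cis \<theta>"] circle_dist[of \<theta>] assms by simp
  then have "\<bar>Re z - (1 + \<epsilon> / 2)\<bar> \<le> 11 / 10" "\<bar>Im z\<bar> \<le> 11 / 10"
    using abs_Re_le_cmod[of "z - cR 0"] abs_Im_le_cmod[of "z - cR 0"] by (auto simp: dist_norm cR_def)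
  then show "\<bar>Re z\<bar> < 4" "\<bar>Im z\<bar> \<le> 3 * L / 2" using eps L_bounds by linarith+
qed

text \<open>On this arc the left column is out of reach, being at horizontal distance at least 3/2.
  Boundary points nearby all lie in the right column, where \<open>Us\<close> has a single value, so
  the density stays bounded even next to the gaps within the column.\<close>

lemma flux_density_right:
  assumes lim: "((\<lambda>t. (Us (cR 0 + cis \<theta>) - Us (cR 0 + of_real (1 + t) * cis \<theta>)) / t) \<longlongrightarrow> l) (at_right 0)"
    and \<theta>: "cos \<theta> > - 1 / 2"
  shows "\<bar>l\<bar> \<le> Bs"
  unfolding Bs_def
proof (rule flux_density_bound[where f = "\<lambda>z. Us z - 2 * KR"])
  show "has_cgrad (\<lambda>z. Us z - 2 * KR) (\<lambda>z. cgradient u z + cnj (cgradient u (cnj z))) (op_ext Z)"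
    by (intro has_cgrad_minus_const Us_cgrad)
  show "continuous_on (cl_ext Z) (\<lambda>z. Us z - 2 * KR)" by (intro continuous_intros Us_cont)
  show "((\<lambda>t. ((Us (cR 0 + cis \<theta>) - 2 * KR) - (Us (cR 0 + of_real (1 + t) * cis \<theta>) - 2 * KR)) / t) \<longlongrightarrow> l) (at_right 0)"
    using lim by simp
  fix z assume z: "dist z (cR 0 + cis \<theta>) \<le> 1 / 10"
  show "Us z - 2 * KR = 0" if zb: "z \<in> cl_ext Z - op_ext Z"
  proof -
    obtain c where c: "c \<in> Z" "dist z c = 1" using zb unfolding cl_ext_def op_ext_def by force
    from c(1) show ?thesis
    proof (cases rule: Z_cases)
      case (1 n)
      then show ?thesis using Us_on_R[of z n] zb c by simp
    next
      case (2 n)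
      have "3 / 2 \<le> \<bar>Re (cR 0 + cis \<theta> - c)\<bar>" using 2 \<theta> eps by (simp add: cR_def cL_def)
      also have "\<dots> \<le> dist (cR 0 + cis \<theta>) c" unfolding dist_norm by (rule abs_Re_le_cmod)
      also have "\<dots> \<le> 11 / 10" using dist_triangle[of "cR 0 + cis \<theta>" c z] c z by (simp add: dist_commute)
      finally show ?thesis by simp
    qed
  qed
  show "\<bar>Us z - 2 * KR\<bar> \<le> 8 * M + 2 * \<bar>K\<bar>" if "z \<in> cl_ext Z"
  proof -
    have "Us z - 2 * KR = (Us z - (KR + KL)) - K" by (simp add: K_def)
    then show ?thesis
      using Us_bound[OF that near_circle_region[OF z]] abs_triangle_ineq4[of "Us z - (KR + KL)" K] by simp
  qed
qed

text \<open>This arc faces the gap between the columns. Across it \<open>Us\<close> jumps by 2 K and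
  \<open>bip\<close> by twice \<open>bip_alpha \<epsilon>\<close>, which explains the coefficient.
  Since sin^2 \<theta> <= 3/4 here, \<open>far_row\<close> excludes the other rows.\<close>

lemma flux_density_left:
  assumes lim: "((\<lambda>t. (Us (cR 0 + cis \<theta>) - Us (cR 0 + of_real (1 + t) * cis \<theta>)) / t) \<longlongrightarrow> l) (at_right 0)"
    and \<theta>: "cos \<theta> \<le> - 1 / 2"
  shows "\<bar>l - K / bip_alpha \<epsilon> * (bip_a \<epsilon> / (1 + \<epsilon> / 2 + cos \<theta>))\<bar> \<le> Bs"
  unfolding Bs_def
proof (rule flux_density_bound[where f = "\<lambda>z. (Us z - (KR + KL)) - K / bip_alpha \<epsilon> * bip \<epsilon> z"])
  let ?\<kappa> = "K / bip_alpha \<epsilon>"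
  have al: "bip_alpha \<epsilon> > 0" using bip_alpha_bounds[OF eps] by simp
  have cR0: "cR 0 = of_real (1 + \<epsilon> / 2)" and cL0: "cL 0 = - of_real (1 + \<epsilon> / 2)"
    by (simp_all add: cR_def cL_def complex_eq_iff)
  have out: "1 \<le> dist z (of_real (1 + \<epsilon> / 2))" "1 \<le> dist z (- of_real (1 + \<epsilon> / 2))" if "z \<in> cl_ext Z" for z
    using that cR_in_Z[of 0] cL_in_Z[of 0] unfolding cl_ext_def cL0[symmetric] unfolding cR0[symmetric] by auto
  note out' = out[OF subsetD[OF op_ext_subset_cl_ext]]
  show "has_cgrad (\<lambda>z. (Us z - (KR + KL)) - ?\<kappa> * bip \<epsilon> z)
      (\<lambda>z. (cgradient u z + cnj (cgradient u (cnj z))) - of_real ?\<kappa> * bip' \<epsilon> z) (op_ext Z)"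
    by (intro has_cgrad_diff has_cgrad_minus_const Us_cgrad has_cgrad_scale has_cgrad_bip eps open_op_ext out')
  show "continuous_on (cl_ext Z) (\<lambda>z. (Us z - (KR + KL)) - ?\<kappa> * bip \<epsilon> z)"
    by (intro continuous_intros Us_cont continuous_on_bip eps out)
  have lim': "((\<lambda>t. (Us (cR 0 + cis \<theta>) - Us (cR 0 + of_real (1 + t) * cis \<theta>)) / t
      - ?\<kappa> * ((bip \<epsilon> (cR 0 + cis \<theta>) - bip \<epsilon> (cR 0 + of_real (1 + t) * cis \<theta>)) / t))
      \<longlongrightarrow> l - ?\<kappa> * (bip_a \<epsilon> / (1 + \<epsilon> / 2 + cos \<theta>))) (at_right 0)"
    by (intro tendsto_intros lim bip_flux_density)
  have eq: "(a - b) / t - k * ((c - d) / t) = ((a - s - k * c) - (b - s - k * d)) / t" for a b c d k s t :: real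
    by (cases "t = 0") (simp_all add: field_simps)
  show "((\<lambda>t. ((Us (cR 0 + cis \<theta>) - (KR + KL) - ?\<kappa> * bip \<epsilon> (cR 0 + cis \<theta>))
      - (Us (cR 0 + of_real (1 + t) * cis \<theta>) - (KR + KL) - ?\<kappa> * bip \<epsilon> (cR 0 + of_real (1 + t) * cis \<theta>))) / t)
      \<longlongrightarrow> l - ?\<kappa> * (bip_a \<epsilon> / (1 + \<epsilon> / 2 + cos \<theta>))) (at_right 0)"
    using lim' unfolding eq[where s = "KR + KL"] .
  fix z assume z: "dist z (cR 0 + cis \<theta>) \<le> 1 / 10"
  show "Us z - (KR + KL) - ?\<kappa> * bip \<epsilon> z = 0" if zb: "z \<in> cl_ext Z - op_ext Z"
  proof -
    obtain c where c: "c \<in> Z" "dist z c = 1" using zb unfolding cl_ext_def op_ext_def by force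
    have close: "dist (cR 0 + cis \<theta>) c \<le> 11 / 10" using dist_triangle[of "cR 0 + cis \<theta>" c z] c z by (simp add: dist_commute)
    have "(1 / 2)\<^sup>2 \<le> (- cos \<theta>)\<^sup>2" using \<theta> by (intro power_mono) auto
    then have sin2: "(Im (cR 0 + cis \<theta>))\<^sup>2 \<le> 3 / 4" using sin_cos_squared_add[of \<theta>] by (simp add: cR_def power2_eq_square)
    have row: "n = 0" if "Im c = of_int n * L" "1 / 2 \<le> \<bar>Re (cR 0 + cis \<theta>) - Re c\<bar>" for n
      using far_row[OF _ that(1) sin2 that(2)] close by force
    from c(1) show ?thesis
    proof (cases rule: Z_cases)
      case (1 n)
      then have "n = 0" using \<theta> by (intro row) (auto simp: cR_def)
      then have "Us z = 2 * KR" "bip \<epsilon> z = bip_alpha \<epsilon>"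
        using Us_on_R[of z 0] bip_outside(2)[OF eps(1) out] zb c 1 cR0 by auto
      then show ?thesis using al by (simp add: K_def)
    next
      case (2 n)
      have "1 / 2 \<le> \<bar>Re (cR 0 + cis \<theta>) - Re c\<bar>"
      proof -
        have "Re (cR 0 + cis \<theta>) - Re c = 2 + \<epsilon> + cos \<theta>" using 2 by (simp add: cR_def cL_def)
        then show ?thesis using eps(1) cos_ge_minus_one[of \<theta>] by linarith
      qed
      then have "n = 0" using 2 by (intro row) (auto simp: cL_def)
      then have "Us z = 2 * KL" "bip \<epsilon> z = - bip_alpha \<epsilon>"
        using Us_on_L[of z 0] bip_outside(3)[OF eps(1) out] zb c 2 cL0 by auto
      then show ?thesis using al by (simp add: K_def)
    qed
  qed
  show "\<bar>Us z - (KR + KL) - ?\<kappa> * bip \<epsilon> z\<bar> \<le> 8 * M + 2 * \<bar>K\<bar>" if zc: "z \<in> cl_ext Z"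
  proof -
    have "\<bar>?\<kappa> * bip \<epsilon> z\<bar> \<le> \<bar>?\<kappa>\<bar> * bip_alpha \<epsilon>"
      unfolding abs_mult using bip_outside(1)[OF eps(1) out[OF zc]] by (intro mult_left_mono) auto
    also have "\<dots> = \<bar>K\<bar>" using al by (simp add: abs_divide)
    finally show ?thesis using Us_bound[OF zc near_circle_region[OF z]] by linarith
  qed
qed

text \<open>The substitution of 2 pi - \<theta> for \<theta> is conjugation on the circle, so the
  reflected function has zero flux too.\<close>

lemma Us_flux:
  obtains gs where "\<And>\<theta>. ((\<lambda>t. (Us (cR 0 + cis \<theta>) - Us (cR 0 + of_real (1 + t) * cis \<theta>)) / t) \<longlongrightarrow> gs \<theta>) (at_right 0)"
    "(gs has_integral 0) {0..2 * pi}"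
proof -
  have "zero_flux u (1 + \<epsilon> / 2, 0)" using sol by (simp add: is_solution_def)
  then obtain f where f: "\<And>\<theta>. ((\<lambda>t. (u ((1 + \<epsilon> / 2, 0) + (cos \<theta>, sin \<theta>))
          - u ((1 + \<epsilon> / 2, 0) + (1 + t) *\<^sub>R (cos \<theta>, sin \<theta>))) / t) \<longlongrightarrow> f \<theta>) (at_right 0)"
      and int: "(f has_integral 0) {0..2 * pi}" unfolding zero_flux_def by blast
  have e: "u ((1 + \<epsilon> / 2, 0) + (cos \<theta>, sin \<theta>)) = U (cR 0 + cis \<theta>)"
    "u ((1 + \<epsilon> / 2, 0) + (1 + t) *\<^sub>R (cos \<theta>, sin \<theta>)) = U (cR 0 + of_real (1 + t) * cis \<theta>)" for \<theta> t
    by (simp_all add: U_def cR_def)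
  have f: "((\<lambda>t. (U (cR 0 + cis \<theta>) - U (cR 0 + of_real (1 + t) * cis \<theta>)) / t) \<longlongrightarrow> f \<theta>) (at_right 0)" for \<theta>
    using f[of \<theta>] unfolding e .
  have cn: "cis (2 * pi - \<theta>) = cnj (cis \<theta>)" for \<theta> by (simp add: complex_eq_iff)
  have cn2: "cR 0 + cis (2 * pi - \<theta>) = cnj (cR 0 + cis \<theta>)"
    "cR 0 + of_real (1 + t) * cis (2 * pi - \<theta>) = cnj (cR 0 + of_real (1 + t) * cis \<theta>)" for \<theta> t
    unfolding cn by (simp_all add: complex_eq_iff cR_def)
  define gs where "gs = (\<lambda>\<theta>. f \<theta> + f (2 * pi - \<theta>))"
  have lim: "((\<lambda>t. (Us (cR 0 + cis \<theta>) - Us (cR 0 + of_real (1 + t) * cis \<theta>)) / t) \<longlongrightarrow> gs \<theta>) (at_right 0)" for \<theta>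
  proof -
    have "((\<lambda>t. (U (cR 0 + cis \<theta>) - U (cR 0 + of_real (1 + t) * cis \<theta>)) / t
       + (U (cnj (cR 0 + cis \<theta>)) - U (cnj (cR 0 + of_real (1 + t) * cis \<theta>))) / t) \<longlongrightarrow> gs \<theta>) (at_right 0)"
      using tendsto_add[OF f[of \<theta>] f[of "2 * pi - \<theta>"]] unfolding cn2 gs_def .
    moreover have "(a - b) / t + (c - d) / t = ((a + c) - (b + d)) / t" for a b c d t :: real
      by (simp add: add_divide_distrib diff_divide_distrib)
    ultimately show ?thesis unfolding Us_def by simp
  qed
  have "((\<lambda>x. f (- 1 *\<^sub>R x + 2 * pi)) has_integral (1 / (\<bar>- 1\<bar> ^ DIM(real))) *\<^sub>R 0)
      ((\<lambda>x. (1 / - 1) *\<^sub>R x + - ((1 / - 1) *\<^sub>R (2 * pi))) ` cbox 0 (2 * pi))"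
    by (rule has_integral_affinity) (use int in auto)
  moreover have "(\<lambda>x. (1 / - 1) *\<^sub>R x + - ((1 / - 1) *\<^sub>R (2 * pi))) ` cbox 0 (2 * pi) = {0..2 * pi}"
  proof -
    have "(\<lambda>x. (1 / - 1) *\<^sub>R x + - ((1 / - 1) *\<^sub>R (2 * pi))) = (\<lambda>x. 2 * pi - x)" by (simp add: fun_eq_iff)
    then show ?thesis by simp
  qed
  ultimately have "((\<lambda>\<theta>. f (2 * pi - \<theta>)) has_integral 0) {0..2 * pi}" by simp
  then have "(gs has_integral 0) {0..2 * pi}" unfolding gs_def using has_integral_add[OF int] by fastforce
  with lim show thesis by (rule that)
qed

text \<open>For |\<theta> - pi| <= sqrt \<epsilon> the bipolar density a / (1 + \<epsilon> / 2 + cos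
  \<theta>) is at least 1 / sqrt \<epsilon>, so this arc alone carries flux at least 2 |\<kappa>|.
  The errors are at most \<open>Bs\<close> per unit of arc on a circle of length 2 pi, and the total
  is 0.\<close>

lemma kappa_flux_bound: "2 * \<bar>K / bip_alpha \<epsilon>\<bar> \<le> 2 * pi * Bs"
proof -
  obtain gs where lim: "\<And>\<theta>. ((\<lambda>t. (Us (cR 0 + cis \<theta>) - Us (cR 0 + of_real (1 + t) * cis \<theta>)) / t) \<longlongrightarrow> gs \<theta>) (at_right 0)"
    and int: "(gs has_integral 0) {0..2 * pi}" using Us_flux by blast
  define \<kappa> where "\<kappa> = K / bip_alpha \<epsilon>"
  define \<sigma> :: real where "\<sigma> = (if \<kappa> \<ge> 0 then 1 else - 1)"
  have \<sigma>: "\<bar>\<sigma>\<bar> = 1" "\<sigma> * \<kappa> = \<bar>\<kappa>\<bar>" by (auto simp: \<sigma>_def)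
  let ?I = "{pi - sqrt \<epsilon>..pi + sqrt \<epsilon>}"
  have s: "0 < sqrt \<epsilon>" "sqrt \<epsilon> \<le> 1" using eps by auto
  have a: "bip_a \<epsilon> > 0" "sqrt \<epsilon> \<le> bip_a \<epsilon>" using bip_a_pos[OF eps(1)] by (auto simp: bip_a_def)
  have B0: "Bs \<ge> 0" unfolding Bs_def using M_nonneg
    by (intro mult_nonneg_nonneg divide_nonneg_nonneg ln_ge_zero) auto
  \<comment> \<open>A step function below the density, up to the sign \<sigma> of \<kappa>: on cos
    \<theta> <= -1/2 the bipolar part is nonnegative, and it is kept only on
    \<open>?I\<close>.\<close>
  have ge: "- Bs + (if \<theta> \<in> ?I then \<bar>\<kappa>\<bar> / sqrt \<epsilon> else 0) \<le> \<sigma> * gs \<theta>" for \<theta>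
  proof (cases "cos \<theta> \<le> - 1 / 2")
    case True
    let ?b = "bip_a \<epsilon> / (1 + \<epsilon> / 2 + cos \<theta>)"
    have pos: "0 < 1 + \<epsilon> / 2 + cos \<theta>" using eps cos_ge_minus_one[of \<theta>] by linarith
    have "\<bar>gs \<theta> - \<kappa> * ?b\<bar> \<le> Bs" using flux_density_left[OF lim True] by (simp add: \<kappa>_def)
    then have "\<bar>\<sigma> * (gs \<theta> - \<kappa> * ?b)\<bar> \<le> Bs" unfolding abs_mult \<sigma> by simp
    moreover have "\<sigma> * (gs \<theta> - \<kappa> * ?b) = \<sigma> * gs \<theta> - \<bar>\<kappa>\<bar> * ?b" unfolding \<sigma>(2)[symmetric] by (simp add: algebra_simps)
    ultimately have "\<bar>\<sigma> * gs \<theta> - \<bar>\<kappa>\<bar> * ?b\<bar> \<le> Bs" by simp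
    then have "- Bs \<le> \<sigma> * gs \<theta> - \<bar>\<kappa>\<bar> * ?b" by (simp only: abs_le_iff minus_le_iff)
    then have "- Bs + \<bar>\<kappa>\<bar> * ?b \<le> \<sigma> * gs \<theta>" by (simp only: le_diff_eq)
    moreover have "(if \<theta> \<in> ?I then \<bar>\<kappa>\<bar> / sqrt \<epsilon> else 0) \<le> \<bar>\<kappa>\<bar> * ?b"
    proof (cases "\<theta> \<in> ?I")
      case True
      then have "\<bar>\<theta> - pi\<bar> \<le> sqrt \<epsilon>" by auto
      from power_mono[OF this, of 2] have "(\<theta> - pi)\<^sup>2 \<le> \<epsilon>" using eps by simp
      moreover have "cos \<theta> = - cos (\<theta> - pi)" by (simp add: cos_diff)
      ultimately have "1 + \<epsilon> / 2 + cos \<theta> \<le> \<epsilon>" using one_minus_cos_le[of "\<theta> - pi"] by linarith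
      then have "sqrt \<epsilon> / \<epsilon> \<le> ?b" by (intro frac_le less_imp_le[OF a(1)] a(2) pos)
      moreover have "sqrt \<epsilon> / \<epsilon> = 1 / sqrt \<epsilon>" using eps by (simp add: real_divide_square_eq field_simps)
      ultimately have "\<bar>\<kappa>\<bar> * (1 / sqrt \<epsilon>) \<le> \<bar>\<kappa>\<bar> * ?b" by (intro mult_left_mono) auto
      then show ?thesis using True by simp
    next
      case False
      have "0 \<le> \<bar>\<kappa>\<bar> * ?b" using a(1) pos by (intro mult_nonneg_nonneg divide_nonneg_nonneg) auto
      then show ?thesis using False by (simp only: if_False)
    qed
    ultimately show ?thesis by linarith
  next
    case False
    have "\<theta> \<notin> ?I"
    proof
      assume "\<theta> \<in> ?I"
      then have "\<bar>\<theta> - pi\<bar> \<le> sqrt \<epsilon>" by auto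
      from power_mono[OF this, of 2] have "(\<theta> - pi)\<^sup>2 \<le> \<epsilon>" using eps by simp
      moreover have "cos \<theta> = - cos (\<theta> - pi)" by (simp add: cos_diff)
      ultimately show False using one_minus_cos_le[of "\<theta> - pi"] False eps by linarith
    qed
    moreover have "\<bar>\<sigma> * gs \<theta>\<bar> \<le> Bs" unfolding abs_mult \<sigma> using flux_density_right[OF lim] False by simp
    then have "- Bs + 0 \<le> \<sigma> * gs \<theta>" by (simp only: abs_le_iff minus_le_iff add_0_right)
    ultimately show ?thesis by (simp only: if_False)
  qed
  have "((\<lambda>\<theta>. - Bs + (if \<theta> \<in> ?I then \<bar>\<kappa>\<bar> / sqrt \<epsilon> else 0)) has_integral (- Bs * (2 * pi) + 2 * \<bar>\<kappa>\<bar>)) {0..2 * pi}"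
  proof (rule has_integral_add)
    show "((\<lambda>\<theta>. - Bs) has_integral - Bs * (2 * pi)) {0..2 * pi}"
      using has_integral_const_real[of "- Bs" 0 "2 * pi"] by (simp add: mult.commute)
    have "sqrt \<epsilon> \<le> pi" using s pi_gt3 by linarith
    then have "?I \<subseteq> {0..2 * pi}" by auto
    moreover have "((\<lambda>\<theta>. \<bar>\<kappa>\<bar> / sqrt \<epsilon>) has_integral 2 * \<bar>\<kappa>\<bar>) ?I"
      using has_integral_const_real[of "\<bar>\<kappa>\<bar> / sqrt \<epsilon>" "pi - sqrt \<epsilon>" "pi + sqrt \<epsilon>"] s by simp
    ultimately show "((\<lambda>\<theta>. if \<theta> \<in> ?I then \<bar>\<kappa>\<bar> / sqrt \<epsilon> else 0) has_integral 2 * \<bar>\<kappa>\<bar>) {0..2 * pi}"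
      by (subst has_integral_restrict)
  qed
  moreover have "((\<lambda>\<theta>. \<sigma> * gs \<theta>) has_integral \<sigma> * 0) {0..2 * pi}" by (rule has_integral_mult_right[OF int])
  ultimately have "- Bs * (2 * pi) + 2 * \<bar>\<kappa>\<bar> \<le> \<sigma> * 0" by (rule has_integral_le) (rule ge)
  then show ?thesis by (simp add: \<kappa>_def mult.commute)
qed

end

text \<open>Makes \<open>kappa_flux_bound\<close> read |\<kappa>| <= fluxC * (8 M + 2 |K|).\<close>

definition fluxC :: real where "fluxC = pi * (4 / ln (1 + 2 * (1 / 10)\<^sup>2))"

lemma fluxC_pos: "fluxC > 0"
  unfolding fluxC_def by (intro mult_pos_pos divide_pos_pos ln_gt_zero) auto

text \<open>By |K| = \<alpha> |\<kappa>| <= 2 sqrt \<epsilon> |\<kappa>|, the term with K in the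
  flux bound is at most half of |\<kappa>| and moves to the left side.\<close>

lemma (in array_solution) kappa_bound:
  assumes small: "8 * fluxC * sqrt \<epsilon> \<le> 1"
  shows "\<bar>K\<bar> \<le> 32 * fluxC * sqrt \<epsilon> * M"
proof -
  define \<kappa> where "\<kappa> = K / bip_alpha \<epsilon>"
  note al = bip_alpha_bounds[OF eps]
  have K: "\<bar>K\<bar> = bip_alpha \<epsilon> * \<bar>\<kappa>\<bar>" using al by (simp add: \<kappa>_def abs_divide)
  also have "\<dots> \<le> (2 * sqrt \<epsilon>) * \<bar>\<kappa>\<bar>" using al by (intro mult_right_mono) auto
  finally have K2: "\<bar>K\<bar> \<le> 2 * sqrt \<epsilon> * \<bar>\<kappa>\<bar>" .
  have "\<bar>\<kappa>\<bar> \<le> fluxC * (8 * M + 2 * \<bar>K\<bar>)"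
    using kappa_flux_bound by (simp add: \<kappa>_def fluxC_def Bs_def mult.assoc)
  also have "\<dots> \<le> fluxC * (8 * M + 2 * (2 * sqrt \<epsilon> * \<bar>\<kappa>\<bar>))" using fluxC_pos by (intro mult_left_mono add_left_mono K2) auto
  also have "\<dots> = 8 * fluxC * M + (8 * fluxC * sqrt \<epsilon>) * \<bar>\<kappa>\<bar> / 2" by (simp add: algebra_simps)
  also have "(8 * fluxC * sqrt \<epsilon>) * \<bar>\<kappa>\<bar> \<le> 1 * \<bar>\<kappa>\<bar>" using small by (intro mult_right_mono) auto
  finally have "\<bar>\<kappa>\<bar> \<le> 16 * fluxC * M" by linarith
  then have "2 * sqrt \<epsilon> * \<bar>\<kappa>\<bar> \<le> 2 * sqrt \<epsilon> * (16 * fluxC * M)" using eps by (intro mult_left_mono) auto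
  then show ?thesis using K2 by (simp add: algebra_simps)
qed

subsection \<open>The narrow regions\<close>

context array_solution
begin

text \<open>The point to check is that only the two disks of row 0 come within 6/5: every centre is
  at horizontal distance at least 1/2, so \<open>far_row\<close> excludes the other rows.\<close>

lemma Nv_estimate:
  assumes x: "\<bar>x\<bar> < 1 + \<epsilon> / 2 - sqrt (1 - y\<^sup>2)" and y: "\<bar>y\<bar> < sqrt 3 / 2"
  shows "norm (cgradient u (Complex x y) - of_real K * Complex (1 / (\<epsilon> + y\<^sup>2)) (2 * (x * y) / (\<epsilon> + y\<^sup>2)\<^sup>2))
    \<le> gapC * (4 * M + \<bar>K\<bar>) + 20 * \<bar>K\<bar>"
proof (rule scaled_expansion[OF eps x y])
  let ?z = "Complex x y"
  note b = gap_sqrt_bounds[OF x y eps(1)]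
  have C: "of_real (1 + \<epsilon> / 2) = cR 0" "- of_real (1 + \<epsilon> / 2) = cL 0" by (simp_all add: cR_def cL_def complex_eq_iff)
  have re: "1 + \<epsilon> / 2 - \<bar>x\<bar> \<le> \<bar>x - Re c\<bar>" if "c \<in> Z" for c using Z_Re_Im[OF that] by linarith
  have far: "6 / 5 < dist ?z c" if "c \<in> Z" "Im c = of_int n * L" "n \<noteq> 0" for c n
    using far_row[OF that(3,2), of ?z] b(1,4) re[OF that(1)] by simp
  have zop: "?z \<in> op_ext Z" unfolding op_ext_def
  proof safe
    fix c assume c: "c \<in> Z"
    obtain n where n: "Im c = of_int n * L" using Z_Re_Im[OF c] by blast
    show "1 < dist ?z c"
    proof (cases "n = 0")
      case True
      have "(1 + \<epsilon> / 2 - \<bar>x\<bar>)\<^sup>2 \<le> \<bar>x - Re c\<bar>\<^sup>2" using re[OF c] b(1) by (intro power_mono) auto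
      then have "1 < (x - Re c)\<^sup>2 + y\<^sup>2" using b(2) by simp
      then have "1\<^sup>2 < (dist ?z c)\<^sup>2" unfolding dist_norm cmod_power2 using True n by simp
      then show ?thesis by (rule power_less_imp_less_base) simp
    next
      case False
      then show ?thesis using far[OF c n] by linarith
    qed
  qed
  have "norm (cgradient u ?z - of_real ((KR - KL) / (2 * bip_alpha \<epsilon>)) * bip' \<epsilon> ?z)
      \<le> gapC * ((4 * M + \<bar>KR - KL\<bar> / 2) + \<bar>KR - KL\<bar> / 2)"
  proof (rule gap_gradient[OF eps U_cgrad U_cont _ _ _ _ zop])
    fix c assume c: "c \<in> Z" "c \<noteq> of_real (1 + \<epsilon> / 2)" "c \<noteq> - of_real (1 + \<epsilon> / 2)"
    from c(1) show "6 / 5 < dist ?z c"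
    proof (cases rule: Z_cases)
      case (1 n)
      then have "n \<noteq> 0" using c(2) by (auto simp: C(1)[symmetric] C(2)[symmetric] simp del: of_real_add of_real_divide)
      then show ?thesis using 1 by (intro far[OF c(1)]) (auto simp: cR_def)
    next
      case (2 n)
      then have "n \<noteq> 0" using c(3) by (auto simp: C(1)[symmetric] C(2)[symmetric] simp del: of_real_add of_real_divide)
      then show ?thesis using 2 by (intro far[OF c(1)]) (auto simp: cL_def)
    qed
  next
    fix w assume w: "w \<in> cl_ext Z" "dist w ?z \<le> 1 / 5"
    have "\<bar>Re w - x\<bar> \<le> 1 / 5" "\<bar>Im w - y\<bar> \<le> 1 / 5"
      using w(2) abs_Re_le_cmod[of "w - ?z"] abs_Im_le_cmod[of "w - ?z"] by (auto simp: dist_norm)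
    moreover have "\<bar>y\<bar> \<le> 1" using power2_le_imp_le[of "\<bar>y\<bar>" 1] b(4) by simp
    ultimately show "\<bar>U w - (KR + KL) / 2\<bar> \<le> 4 * M + \<bar>KR - KL\<bar> / 2"
      using b(5) eps L_bounds by (intro U_bound w(1)) linarith+
  next
    show "of_real (1 + \<epsilon> / 2) \<in> Z" unfolding C by simp
    show "- of_real (1 + \<epsilon> / 2) \<in> Z" unfolding C(2) by simp
    show "U w = KR" if "dist w (of_real (1 + \<epsilon> / 2)) = 1" for w using that unfolding C(1) by (rule U_on_R0)
    show "U w = KL" if "dist w (- of_real (1 + \<epsilon> / 2)) = 1" for w using that unfolding C(2) by (rule U_on_L0)
  qed
  then show "norm (cgradient u ?z - of_real (K / (2 * bip_alpha \<epsilon>)) * bip' \<epsilon> ?z) \<le> gapC * (4 * M + \<bar>K\<bar>)"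
    unfolding K_def[symmetric] by (simp add: add.commute)
qed

lemma Nh_estimate:
  assumes y: "\<bar>y\<bar> < 1 + \<delta> / 2 - sqrt (1 - x\<^sup>2)" and x: "\<bar>x\<bar> < sqrt 3 / 2"
  shows "norm (cgradient u (Complex (1 + \<epsilon> / 2 + x) (1 + \<delta> / 2 + y))
      - of_real P * Complex (- (2 * (x * y) / (\<delta> + x\<^sup>2)\<^sup>2)) (- (1 / (\<delta> + x\<^sup>2))))
    \<le> gapC * (4 * M + \<bar>K\<bar> + \<bar>P\<bar>) + 20 * \<bar>P\<bar>"
proof -
  \<comment> \<open>The gap between the disks of a column is a gap as in \<open>Nv\<close>, turned by a quarter.\<close>
  define z0 where "z0 = Complex (1 + \<epsilon> / 2) (L / 2)"
  define \<psi> where "\<psi> = (\<lambda>\<zeta>. z0 + \<i> * \<zeta>)"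
  define Z' where "Z' = {\<zeta>. \<psi> \<zeta> \<in> Z}"
  \<comment> \<open>As i (y - i x) = x + i y, this is the point in the turned coordinate, whose real
    part runs across the gap.\<close>
  let ?\<zeta> = "Complex y (- x)"
  have x': "\<bar>- x\<bar> < sqrt 3 / 2" and y': "\<bar>y\<bar> < 1 + \<delta> / 2 - sqrt (1 - (- x)\<^sup>2)" using x y by simp_all
  note b = gap_sqrt_bounds[OF y x del(1)]
  have L2: "L / 2 = 1 + \<delta> / 2" by (simp add: L_def)
  have \<psi>d: "dist (\<psi> a) (\<psi> b) = dist a b" for a b
    by (simp add: \<psi>_def dist_norm norm_mult flip: right_diff_distrib)
  have \<psi>inv: "\<psi> (- \<i> * (c - z0)) = c" for c by (simp add: \<psi>_def algebra_simps)
  have cl: "w \<in> cl_ext Z' \<longleftrightarrow> \<psi> w \<in> cl_ext Z" and op: "w \<in> op_ext Z' \<longleftrightarrow> \<psi> w \<in> op_ext Z" for w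
  proof -
    have "(\<forall>c\<in>Z'. Q (dist w c)) \<longleftrightarrow> (\<forall>c\<in>Z. Q (dist (\<psi> w) c))" for Q
      unfolding Z'_def using \<psi>d \<psi>inv by (metis mem_Collect_eq)
    then show "w \<in> cl_ext Z' \<longleftrightarrow> \<psi> w \<in> cl_ext Z" "w \<in> op_ext Z' \<longleftrightarrow> \<psi> w \<in> op_ext Z"
      unfolding cl_ext_def op_ext_def by simp_all
  qed
  have C: "\<psi> (of_real (1 + \<delta> / 2)) = cR 1" "\<psi> (- of_real (1 + \<delta> / 2)) = cR 0"
    by (simp_all add: \<psi>_def z0_def cR_def complex_eq_iff L_def add_divide_distrib)
  have \<psi>\<zeta>: "\<psi> ?\<zeta> = Complex (1 + \<epsilon> / 2 + x) (L / 2 + y)" by (simp add: \<psi>_def z0_def complex_eq_iff)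
  have far: "6 / 5 < dist ?\<zeta> c" if c: "c \<in> Z'" "c \<noteq> of_real (1 + \<delta> / 2)" "c \<noteq> - of_real (1 + \<delta> / 2)" for c
  proof -
    have c': "\<psi> c \<in> Z" using c(1) by (simp add: Z'_def)
    have inj: "c = a" if "\<psi> c = \<psi> a" for a using that by (simp add: \<psi>_def)
    obtain n where n: "Im (\<psi> c) = of_int n * L" using Z_Re_Im[OF c'] by blast
    have "1 / 2 \<le> \<bar>L / 2 + y - of_int n * L\<bar>"
    proof -
      have "\<bar>y\<bar> \<le> L / 2 - 1 / 2" using b(1) L2 by linarith
      moreover have "L / 2 \<le> \<bar>L / 2 - of_int n * L\<bar>"
      proof -
        have "n \<le> 0 \<or> 1 \<le> n" by linarith
        then have "of_int n \<le> (0 :: real) \<or> (1 :: real) \<le> of_int n" by linarith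
        then have "of_int n * L \<le> 0 \<or> 1 * L \<le> of_int n * L" using L_bounds by (auto intro: mult_right_mono mult_nonpos_nonneg)
        then show ?thesis by linarith
      qed
      ultimately show ?thesis by linarith
    qed
    then have im: "1 / 4 \<le> (Im (\<psi> ?\<zeta>) - Im (\<psi> c))\<^sup>2"
      using power_mono[of "1 / 2" "\<bar>L / 2 + y - of_int n * L\<bar>" 2] unfolding \<psi>\<zeta> n by (simp add: power2_eq_square)
    from c' have "6 / 5 < dist (\<psi> ?\<zeta>) (\<psi> c)"
    proof (cases rule: Z_cases)
      case (1 m)
      then have m: "m \<noteq> 0" "m \<noteq> 1" using c inj C by metis+
      have "L + 1 / 2 \<le> \<bar>L / 2 + y - of_int m * L\<bar>"
      proof -
        have "\<bar>y\<bar> \<le> L / 2 - 1 / 2" using b(1) L2 by linarith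
        moreover have "m \<le> - 1 \<or> 2 \<le> m" using m by linarith
        then have "of_int m \<le> (- 1 :: real) \<or> (2 :: real) \<le> of_int m" by linarith
        then have "of_int m * L \<le> - 1 * L \<or> 2 * L \<le> of_int m * L" using L_bounds by (metis less_imp_le mult_right_mono)
        ultimately show ?thesis by linarith
      qed
      moreover have "Im (\<psi> ?\<zeta> - \<psi> c) = L / 2 + y - of_int m * L" unfolding \<psi>\<zeta> 1 by (simp add: cR_def)
      ultimately show ?thesis using abs_Im_le_cmod[of "\<psi> ?\<zeta> - \<psi> c"] L_bounds unfolding dist_norm by linarith
    next
      case (2 m)
      have "\<bar>x\<bar> \<le> 867 / 1000"
        by (rule power2_le_imp_le) (use b(4) in \<open>auto simp: power2_eq_square\<close>)
      then have "1133 / 1000 \<le> Re (\<psi> ?\<zeta>) - Re (\<psi> c)" unfolding \<psi>\<zeta> 2 using eps by (simp add: cL_def)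
      from power_mono[OF this, of 2] have "1133 / 1000 * (1133 / 1000) \<le> (Re (\<psi> ?\<zeta>) - Re (\<psi> c))\<^sup>2" by (simp add: power2_eq_square)
      then have "(6 / 5)\<^sup>2 < (dist (\<psi> ?\<zeta>) (\<psi> c))\<^sup>2" unfolding dist_norm cmod_power2 minus_complex.simps using im
        by (simp only: power2_eq_square[of "6 / 5 :: real"])
      then show ?thesis by (rule power_less_imp_less_base) simp
    qed
    then show ?thesis by (simp only: \<psi>d)
  qed
  have \<zeta>op: "?\<zeta> \<in> op_ext Z'" unfolding op_ext_def
  proof safe
    fix c assume c: "c \<in> Z'"
    show "1 < dist ?\<zeta> c"
    proof (cases "c = of_real (1 + \<delta> / 2) \<or> c = - of_real (1 + \<delta> / 2)")
      case True
      then have c: "\<bar>Re c\<bar> = 1 + \<delta> / 2" "Im c = 0" using del by auto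
      have "(1 + \<delta> / 2 - \<bar>y\<bar>)\<^sup>2 \<le> \<bar>y - Re c\<bar>\<^sup>2" using c b(1) by (intro power_mono) linarith+
      then have "1 < (y - Re c)\<^sup>2 + x\<^sup>2" using b(2) by simp
      then have "1\<^sup>2 < (dist ?\<zeta> c)\<^sup>2" unfolding dist_norm cmod_power2 using c by simp
      then show ?thesis by (rule power_less_imp_less_base) simp
    next
      case False
      then show ?thesis using far[OF c] by force
    qed
  qed
  have opZ': "open (op_ext Z')"
  proof -
    have "op_ext Z' = \<psi> -` op_ext Z" using op by auto
    then show ?thesis unfolding \<psi>_def by (simp add: open_vimage open_op_ext continuous_intros)
  qed
  have cg: "has_cgrad (\<lambda>\<zeta>. U (\<psi> \<zeta>)) (\<lambda>\<zeta>. \<i> * cgradient u (\<psi> \<zeta>)) (op_ext Z')"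
    unfolding \<psi>_def by (rule has_cgrad_affine[OF U_cgrad opZ']) (use op in \<open>simp add: \<psi>_def\<close>)
  have ct: "continuous_on (cl_ext Z') (\<lambda>\<zeta>. U (\<psi> \<zeta>))"
    by (rule continuous_on_compose2[OF U_cont]) (use cl in \<open>auto simp: \<psi>_def intro!: continuous_intros\<close>)
  have "norm (\<i> * cgradient u (\<psi> ?\<zeta>) - of_real ((KR + P - KR) / (2 * bip_alpha \<delta>)) * bip' \<delta> ?\<zeta>)
      \<le> gapC * ((4 * M + \<bar>K\<bar> + \<bar>P\<bar> / 2) + \<bar>KR + P - KR\<bar> / 2)"
  proof (rule gap_gradient[OF del cg ct _ _ _ _ \<zeta>op far])
    show "of_real (1 + \<delta> / 2) \<in> Z'" "- of_real (1 + \<delta> / 2) \<in> Z'" unfolding Z'_def mem_Collect_eq C by simp_all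
    show "U (\<psi> w) = KR + P" if "w \<in> cl_ext Z'" "dist w (of_real (1 + \<delta> / 2)) = 1" for w
      using that U_on_R[of "\<psi> w" 1] cl \<psi>d[of w "of_real (1 + \<delta> / 2)"] unfolding C by simp
    show "U (\<psi> w) = KR" if "w \<in> cl_ext Z'" "dist w (- of_real (1 + \<delta> / 2)) = 1" for w
      using that U_on_R0[of "\<psi> w"] \<psi>d[of w "- of_real (1 + \<delta> / 2)"] unfolding C by simp
    fix w assume w: "w \<in> cl_ext Z'" "dist w ?\<zeta> \<le> 1 / 5"
    then have "dist (\<psi> w) (\<psi> ?\<zeta>) \<le> 1 / 5" by (simp only: \<psi>d)
    then have "\<bar>Re (\<psi> w) - (1 + \<epsilon> / 2 + x)\<bar> \<le> 1 / 5" "\<bar>Im (\<psi> w) - (L / 2 + y)\<bar> \<le> 1 / 5"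
      using abs_Re_le_cmod[of "\<psi> w - \<psi> ?\<zeta>"] abs_Im_le_cmod[of "\<psi> w - \<psi> ?\<zeta>"] unfolding \<psi>\<zeta> dist_norm by auto
    moreover have "\<bar>x\<bar> \<le> 1" using power2_le_imp_le[of "\<bar>x\<bar>" 1] b(4) by simp
    ultimately have "\<bar>Re (\<psi> w)\<bar> < 4" "\<bar>Im (\<psi> w)\<bar> \<le> 3 * L / 2"
      using b(1) L2 eps L_bounds by linarith+
    then have "\<bar>U (\<psi> w) - (KR + KL) / 2\<bar> \<le> 4 * M + \<bar>KR - KL\<bar> / 2"
      using w(1) cl by (intro U_bound) auto
    \<comment> \<open>\<open>U_bound\<close> is centred at the mean of \<open>KR\<close> and
      \<open>KL\<close>, but this gap lies between the values \<open>KR\<close> and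
      \<open>KR + P\<close>; recentring costs |K| / 2 + |P| / 2.\<close>
    moreover have "\<bar>a - ((k + p) + k) / 2\<bar> \<le> 4 * m + \<bar>k - l\<bar> + \<bar>p\<bar> / 2"
      if "\<bar>a - (k + l) / 2\<bar> \<le> 4 * m + \<bar>k - l\<bar> / 2" for a k l m p :: real
    proof -
      have eq: "a - ((k + p) + k) / 2 = (a - (k + l) / 2) - ((k - l) / 2 + p / 2)" by (simp add: field_simps)
      have "\<bar>(k - l) / 2 + p / 2\<bar> \<le> \<bar>k - l\<bar> / 2 + \<bar>p\<bar> / 2"
        using abs_triangle_ineq[of "(k - l) / 2" "p / 2"] by simp
      with that have "\<bar>a - ((k + p) + k) / 2\<bar> \<le> (4 * m + \<bar>k - l\<bar> / 2) + (\<bar>k - l\<bar> / 2 + \<bar>p\<bar> / 2)"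
        unfolding eq by (rule order_trans[OF abs_triangle_ineq4 add_mono])
      then show ?thesis by simp
    qed
    ultimately show "\<bar>U (\<psi> w) - ((KR + P) + KR) / 2\<bar> \<le> 4 * M + \<bar>K\<bar> + \<bar>P\<bar> / 2" unfolding K_def by blast
  qed
  then have "norm (\<i> * cgradient u (\<psi> ?\<zeta>) - of_real (P / (2 * bip_alpha \<delta>)) * bip' \<delta> ?\<zeta>) \<le> gapC * (4 * M + \<bar>K\<bar> + \<bar>P\<bar>)"
    by (simp add: add.assoc)
  from scaled_expansion[OF del y' x' this]
  have r: "norm (\<i> * cgradient u (\<psi> ?\<zeta>) - of_real P * Complex (1 / (\<delta> + x\<^sup>2)) (- (2 * (x * y) / (\<delta> + x\<^sup>2)\<^sup>2)))
      \<le> gapC * (4 * M + \<bar>K\<bar> + \<bar>P\<bar>) + 20 * \<bar>P\<bar>" by (simp add: mult.commute)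
  \<comment> \<open>The chain rule put a factor i in front of the gradient; taking it out of the
    norm turns the profile back.\<close>
  have "\<i> * (g - of_real P * Complex (- a) (- b)) = \<i> * g - of_real P * Complex b (- a)" for g a b
    by (simp add: complex_eq_iff)
  then have "norm (g - of_real P * Complex (- a) (- b)) = norm (\<i> * g - of_real P * Complex b (- a))" for g a b
    by (metis norm_mult norm_ii mult_1)
  then show ?thesis using r unfolding \<psi>\<zeta> L2 by simp
qed

text \<open>At either end the heights differ by L / 2 - 1 = \<delta> / 2, and there the gradient of
  H is at most 3 exp 2 * M. The unit balls of the gradient estimate leave the strip, which is what
  \<open>HC_bound3\<close> is for.\<close>

lemma lam_bound: "\<bar>P - (HC \<i> - HC (- \<i>))\<bar> \<le> 3 * exp 2 * \<delta> * M"
proof -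
  have gr: "norm (cgradient H z) \<le> exp 2 * (3 * M) / 1" if "Re z = 0" "\<bar>Im z\<bar> \<le> L / 2" for z
  proof (rule norm_cgrad_le[OF has_cgrad_subset[OF HC_cgrad]])
    fix w assume "w \<in> ball z 1"
    then have "\<bar>Re w - Re z\<bar> < 1" "\<bar>Im w - Im z\<bar> < 1"
      using abs_Re_le_cmod[of "z - w"] abs_Im_le_cmod[of "z - w"] by (auto simp: dist_norm)
    then show "\<bar>HC w\<bar> \<le> 3 * M" using that L_bounds by (intro HC_bound3) linarith+
  qed auto
  have seg: "\<bar>HC (0 + of_real (L / 2) * e) - HC (0 + of_real 1 * e)\<bar> \<le> \<delta> / 2 * (exp 2 * (3 * M))" if e: "e = \<i> \<or> e = - \<i>" for e
  proof -
    have "\<exists>t>1. t < L / 2 \<and> HC (0 + of_real (L / 2) * e) - HC (0 + of_real 1 * e) = (L / 2 - 1) * Re (cgradient H (0 + of_real t * e) * e)"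
      using L_bounds by (intro MVT2[where f = "\<lambda>t. HC (0 + of_real t * e)"] has_cgrad_DERIV_line[OF HC_cgrad]) auto
    then obtain t where t: "1 < t" "t < L / 2"
      and eq: "HC (0 + of_real (L / 2) * e) - HC (0 + of_real 1 * e) = (L / 2 - 1) * Re (cgradient H (0 + of_real t * e) * e)" by blast
    have "\<bar>Re (cgradient H (0 + of_real t * e) * e)\<bar> \<le> norm (cgradient H (0 + of_real t * e) * e)" by (rule abs_Re_le_cmod)
    also have "\<dots> = norm (cgradient H (0 + of_real t * e))" using e by (auto simp: norm_mult)
    also have "\<dots> \<le> exp 2 * (3 * M)" using gr[of "0 + of_real t * e"] e t by auto
    finally have "(L / 2 - 1) * \<bar>Re (cgradient H (0 + of_real t * e) * e)\<bar> \<le> (L / 2 - 1) * (exp 2 * (3 * M))"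
      using L_bounds by (intro mult_left_mono) auto
    moreover have "L / 2 - 1 = \<delta> / 2" by (simp add: L_def add_divide_distrib)
    ultimately show ?thesis unfolding eq abs_mult using del by (simp only: abs_of_nonneg[of "\<delta> / 2"])
  qed
  have "\<bar>P - (HC \<i> - HC (- \<i>))\<bar> \<le> \<bar>HC (0 + of_real (L / 2) * \<i>) - HC (0 + of_real 1 * \<i>)\<bar>
      + \<bar>HC (0 + of_real (L / 2) * (- \<i>)) - HC (0 + of_real 1 * (- \<i>))\<bar>"
    unfolding P_def by (simp add: mult.commute)
  also have "\<dots> \<le> \<delta> / 2 * (exp 2 * (3 * M)) + \<delta> / 2 * (exp 2 * (3 * M))" by (intro add_mono seg) auto
  also have "\<dots> = 3 * exp 2 * \<delta> * M" by simp
  finally show ?thesis .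
qed

lemma norm_grad_minus:
  "norm (grad u p - (Re w, - Im w)) = norm (cgradient u (Complex (fst p) (snd p)) - w)"
proof -
  have "grad u p - (Re w, - Im w) = (Re (cgradient u (Complex (fst p) (snd p)) - w), - Im (cgradient u (Complex (fst p) (snd p)) - w))"
    by (simp add: grad_def cgradient_def)
  then show ?thesis by (simp add: norm_Pair cmod_def power2_commute)
qed

lemma grad_u_on_Nh:
  assumes p: "p \<in> Nh \<epsilon> \<delta>"
  shows "norm (grad u p - (H (0, 1) - H (0, - 1)) *\<^sub>R ((1 / (\<delta> + (fst p - 1 - \<epsilon> / 2)\<^sup>2)) *\<^sub>R (0, 1)
      + (1 / sqrt \<delta> * Sfun \<epsilon> \<delta> p) *\<^sub>R (1, 0))) \<le> gapC * (4 * M + \<bar>K\<bar> + \<bar>P\<bar>) + 20 * \<bar>P\<bar> + 9 * exp 2 * M"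
    and "\<bar>Sfun \<epsilon> \<delta> p\<bar> \<le> 2"
proof -
  define x y X where "x = fst p - 1 - \<epsilon> / 2" and "y = snd p - 1 - \<delta> / 2" and "X = \<delta> + x\<^sup>2"
  have y: "\<bar>y\<bar> < 1 + \<delta> / 2 - sqrt (1 - x\<^sup>2)" and x: "\<bar>x\<bar> < sqrt 3 / 2"
    using p by (auto simp: Nh_def x_def y_def)
  note b = gap_sqrt_bounds[OF y x del(1)]
  have X: "X > 0" "\<delta> \<le> X" "\<bar>y\<bar> \<le> X" using del b(3) by (auto simp: X_def add_pos_nonneg)
  have pe: "Complex (fst p) (snd p) = Complex (1 + \<epsilon> / 2 + x) (1 + \<delta> / 2 + y)" by (simp add: x_def y_def)
  have S: "Sfun \<epsilon> \<delta> p = - 2 * sqrt \<delta> * (x * y) / X\<^sup>2" by (simp add: Sfun_def x_def y_def X_def add.commute)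
  \<comment> \<open>Together with |y| <= X this even gives the bound 1 for
    \<open>Sfun\<close>.\<close>
  have amgm: "2 * sqrt \<delta> * \<bar>x\<bar> \<le> X"
    using zero_le_power2[of "sqrt \<delta> - \<bar>x\<bar>"] del by (simp add: X_def power2_diff)
  have "2 * sqrt \<delta> * \<bar>x\<bar> * \<bar>y\<bar> \<le> X * X" using amgm X by (intro mult_mono) auto
  then have "\<bar>Sfun \<epsilon> \<delta> p\<bar> \<le> 1" unfolding S using X del by (simp add: abs_mult power2_eq_square divide_le_eq mult.assoc)
  then show "\<bar>Sfun \<epsilon> \<delta> p\<bar> \<le> 2" by simp
  define lam where "lam = H (0, 1) - H (0, - 1)"
  have lam: "lam = HC \<i> - HC (- \<i>)" by (simp add: lam_def HC_def)
  define E where "E = Complex (- (2 * (x * y) / X\<^sup>2)) (- (1 / X))"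
  have "1 / sqrt \<delta> * Sfun \<epsilon> \<delta> p = - (2 * (x * y) / X\<^sup>2)" unfolding S using del by simp
  then have form: "lam *\<^sub>R ((1 / (\<delta> + (fst p - 1 - \<epsilon> / 2)\<^sup>2)) *\<^sub>R (0, 1) + (1 / sqrt \<delta> * Sfun \<epsilon> \<delta> p) *\<^sub>R (1, 0))
    = (Re (of_real lam * E), - Im (of_real lam * E))"
    by (simp add: E_def X_def x_def)
  \<comment> \<open>Replacing \<open>P\<close> by \<open>lam\<close> costs |P - lam| times this
    norm: O(\<delta>) times 3/\<delta>, which is bounded.\<close>
  have nE: "norm E \<le> 3 / \<delta>"
  proof -
    have "\<bar>2 * (x * y) / X\<^sup>2\<bar> \<le> 2 / X"
    proof -
      have "\<bar>x\<bar> \<le> 1" using power2_le_imp_le[of "\<bar>x\<bar>" 1] b(4) by simp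
      then have "\<bar>x\<bar> * \<bar>y\<bar> \<le> 1 * X" using X by (intro mult_mono) auto
      then show ?thesis using X by (simp add: abs_mult power2_eq_square divide_le_eq)
    qed
    then have "norm E \<le> 2 / X + 1 / X" using cmod_le[of E] X by (simp add: E_def)
    also have "\<dots> = 3 / X" by simp
    also have "\<dots> \<le> 3 / \<delta>" using X del by (intro divide_left_mono) auto
    finally show ?thesis .
  qed
  have "cgradient u (Complex (fst p) (snd p)) - of_real lam * E
      = (cgradient u (Complex (fst p) (snd p)) - of_real P * E) + of_real (P - lam) * E" by (simp add: algebra_simps)
  moreover have "norm (cgradient u (Complex (fst p) (snd p)) - of_real P * E) \<le> gapC * (4 * M + \<bar>K\<bar> + \<bar>P\<bar>) + 20 * \<bar>P\<bar>"
    unfolding pe E_def X_def by (rule Nh_estimate[OF y x])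
  moreover have "norm (of_real (P - lam) * E) \<le> 9 * exp 2 * M"
  proof -
    have "norm (of_real (P - lam) * E) \<le> (3 * exp 2 * \<delta> * M) * (3 / \<delta>)"
      unfolding norm_mult norm_of_real using lam_bound nE M_nonneg del(1) unfolding lam by (intro mult_mono) auto
    also have "\<dots> = 9 * exp 2 * M" using del by simp
    finally show ?thesis .
  qed
  ultimately have "norm (cgradient u (Complex (fst p) (snd p)) - of_real lam * E)
      \<le> gapC * (4 * M + \<bar>K\<bar> + \<bar>P\<bar>) + 20 * \<bar>P\<bar> + 9 * exp 2 * M"
    using norm_triangle_le[OF add_mono] by metis
  then show "norm (grad u p - (H (0, 1) - H (0, - 1)) *\<^sub>R ((1 / (\<delta> + (fst p - 1 - \<epsilon> / 2)\<^sup>2)) *\<^sub>R (0, 1)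
      + (1 / sqrt \<delta> * Sfun \<epsilon> \<delta> p) *\<^sub>R (1, 0))) \<le> gapC * (4 * M + \<bar>K\<bar> + \<bar>P\<bar>) + 20 * \<bar>P\<bar> + 9 * exp 2 * M"
    unfolding lam_def[symmetric] form norm_grad_minus .
qed

text \<open>The second component of the profile goes into the error: 2 |x y| / X^2 is at most 1 /
  sqrt \<epsilon> in the gap, while K is of order sqrt \<epsilon>. The quotient
  \<open>K / sqrt \<epsilon>\<close> becomes the \<mu> of the theorem.\<close>

lemma grad_u_on_Nv:
  assumes p: "p \<in> Nv \<epsilon>"
  shows "norm (grad u p - (K / sqrt \<epsilon> * sqrt \<epsilon> / (\<epsilon> + (snd p)\<^sup>2)) *\<^sub>R (1, 0))
    \<le> gapC * (4 * M + \<bar>K\<bar>) + 20 * \<bar>K\<bar> + \<bar>K\<bar> / sqrt \<epsilon>"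
proof -
  define x y X where "x = fst p" and "y = snd p" and "X = \<epsilon> + y\<^sup>2"
  have x: "\<bar>x\<bar> < 1 + \<epsilon> / 2 - sqrt (1 - y\<^sup>2)" and y: "\<bar>y\<bar> < sqrt 3 / 2"
    using p by (auto simp: Nv_def x_def y_def)
  note b = gap_sqrt_bounds[OF x y eps(1)]
  have X: "X > 0" "\<bar>x\<bar> \<le> X" using eps b(3) by (auto simp: X_def add_pos_nonneg)
  define E where "E = Complex (1 / X) (2 * (x * y) / X\<^sup>2)"
  have form: "(K / sqrt \<epsilon> * sqrt \<epsilon> / (\<epsilon> + (snd p)\<^sup>2)) *\<^sub>R (1, 0) = (Re (of_real (K / X) :: complex), - Im (of_real (K / X) :: complex))"
    using eps by (simp add: X_def y_def)
  have amgm: "2 * sqrt \<epsilon> * \<bar>y\<bar> \<le> X"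
    using zero_le_power2[of "sqrt \<epsilon> - \<bar>y\<bar>"] eps by (simp add: X_def power2_diff)
  have "cgradient u (Complex x y) - of_real (K / X)
      = (cgradient u (Complex x y) - of_real K * E) + of_real K * Complex 0 (2 * (x * y) / X\<^sup>2)"
    by (simp add: E_def complex_eq_iff)
  moreover have "norm (cgradient u (Complex x y) - of_real K * E) \<le> gapC * (4 * M + \<bar>K\<bar>) + 20 * \<bar>K\<bar>"
    unfolding E_def X_def by (rule Nv_estimate[OF x y])
  moreover have "norm (of_real K * Complex 0 (2 * (x * y) / X\<^sup>2)) \<le> \<bar>K\<bar> / sqrt \<epsilon>"
  proof -
    have "\<bar>x\<bar> * (2 * sqrt \<epsilon> * \<bar>y\<bar>) \<le> X * X" using amgm X eps by (intro mult_mono) auto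
    then have "\<bar>2 * (x * y) / X\<^sup>2\<bar> \<le> 1 / sqrt \<epsilon>"
      using X eps by (simp add: abs_mult power2_eq_square divide_simps) (simp add: mult_ac)
    then have "\<bar>K\<bar> * \<bar>2 * (x * y) / X\<^sup>2\<bar> \<le> \<bar>K\<bar> * (1 / sqrt \<epsilon>)" by (intro mult_left_mono) auto
    then show ?thesis by (simp add: norm_mult cmod_def abs_mult)
  qed
  ultimately have "norm (cgradient u (Complex x y) - of_real (K / X)) \<le> gapC * (4 * M + \<bar>K\<bar>) + 20 * \<bar>K\<bar> + \<bar>K\<bar> / sqrt \<epsilon>"
    using norm_triangle_le[OF add_mono] by metis
  then show ?thesis unfolding form norm_grad_minus by (simp add: x_def y_def)
qed

end

theorem theorem1p1:
  shows "\<exists>C \<epsilon>0 \<delta>0. C > 0 \<and> \<epsilon>0 > 0 \<and> \<delta>0 > 0 \<and>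
    (\<forall>\<epsilon> \<delta> H u. 0 < \<epsilon> \<and> \<epsilon> < \<epsilon>0 \<and> 0 < \<delta> \<and> \<delta> < \<delta>0
       \<and> harmonic_on UNIV H
       \<and> (\<forall>p. grad H p = grad H (fst p, snd p + (2 + \<delta>)))
       \<and> is_solution \<epsilon> \<delta> H u
     \<longrightarrow>
       (\<forall>p\<in>Nh \<epsilon> \<delta>. \<bar>Sfun \<epsilon> \<delta> p\<bar> \<le> 2)
     \<and> Sfun \<epsilon> \<delta> (1 + \<epsilon>/2, 1 + \<delta>/2) = 0
     \<and> (\<exists>lam mu R1 R2.
          lam = H (0, 1) - H (0, -1)
        \<and> \<bar>mu\<bar> \<le> C * (SUP p\<in>Omega_m \<delta> 4. \<bar>H p\<bar>)
        \<and> (\<forall>p\<in>Nh \<epsilon> \<delta>. grad u p =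
              lam *\<^sub>R ((1 / (\<delta> + (fst p - 1 - \<epsilon>/2)\<^sup>2)) *\<^sub>R (0, 1)
                    + (1 / sqrt \<delta> * Sfun \<epsilon> \<delta> p) *\<^sub>R (1, 0)) + R1 p)
        \<and> (\<forall>p\<in>Nv \<epsilon>. grad u p = (mu * sqrt \<epsilon> / (\<epsilon> + (snd p)\<^sup>2)) *\<^sub>R (1, 0) + R2 p)
        \<and> (\<exists>A B. (\<forall>p\<in>Nh \<epsilon> \<delta>. norm (R1 p) \<le> A) \<and> (\<forall>p\<in>Nv \<epsilon>. norm (R2 p) \<le> B)
               \<and> A + B \<le> C * (SUP p\<in>Omega_m \<delta> 4. \<bar>H p\<bar>))))"
proof -
  define f where "f = 32 * fluxC"
  have f: "f > 0" using fluxC_pos by (simp add: f_def)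
  \<comment> \<open>The two brackets are the bounds of \<open>grad_u_on_Nh\<close> and
    \<open>grad_u_on_Nv\<close> divided by \<open>M\<close>, after inserting |K| <= f M, |K| / sqrt
    \<epsilon> <= f M and |P| <= 2 M.\<close>
  define C where "C = (gapC * (4 + f + 2) + 40 + 9 * exp 2) + (gapC * (4 + f) + 20 * f + f)"
  \<comment> \<open>The square ensures 8 fluxC sqrt \<epsilon> <= 1, the smallness that
    \<open>kappa_bound\<close> requires; 1/10 is the range of \<open>disk_array\<close>.\<close>
  define \<epsilon>0 where "\<epsilon>0 = min (1 / 10) ((1 / (8 * fluxC))\<^sup>2)"
  have \<epsilon>0: "\<epsilon>0 > 0" using fluxC_pos by (simp add: \<epsilon>0_def)
  have parts: "0 \<le> gapC * (4 + f + 2)" "0 \<le> gapC * (4 + f)" using f gapC_pos by simp_all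
  have e2: "(0 :: real) < exp 2" by simp
  have C: "C > 0" unfolding C_def using parts f e2 by linarith
  have fC: "f \<le> C" unfolding C_def using parts f e2 by linarith
  show ?thesis
  proof (rule exI[of _ C], rule exI[of _ \<epsilon>0], rule exI[of _ "1 / 10"], intro conjI allI impI)
    fix \<epsilon> \<delta> :: real and H u :: "pt \<Rightarrow> real"
    assume hyp: "0 < \<epsilon> \<and> \<epsilon> < \<epsilon>0 \<and> 0 < \<delta> \<and> \<delta> < 1 / 10 \<and> harmonic_on UNIV H
       \<and> (\<forall>p. grad H p = grad H (fst p, snd p + (2 + \<delta>))) \<and> is_solution \<epsilon> \<delta> H u"
    then interpret array_solution \<epsilon> \<delta> H u
      by unfold_locales (auto simp: \<epsilon>0_def)
    have eM: "(SUP p\<in>Omega_m \<delta> 4. \<bar>H p\<bar>) = M" by (simp add: M_def)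
    show "\<forall>p\<in>Nh \<epsilon> \<delta>. \<bar>Sfun \<epsilon> \<delta> p\<bar> \<le> 2" using grad_u_on_Nh(2) by blast
    show "Sfun \<epsilon> \<delta> (1 + \<epsilon> / 2, 1 + \<delta> / 2) = 0" by (simp add: Sfun_def)
    have s: "0 < sqrt \<epsilon>" "sqrt \<epsilon> \<le> 1" using eps by auto
    have "sqrt \<epsilon> \<le> 1 / (8 * fluxC)"
      using hyp fluxC_pos by (intro real_le_lsqrt) (auto simp: \<epsilon>0_def)
    then have "8 * fluxC * sqrt \<epsilon> \<le> 1" using fluxC_pos by (simp add: le_divide_eq mult.commute)
    then have "\<bar>K\<bar> \<le> 32 * fluxC * sqrt \<epsilon> * M" by (rule kappa_bound)
    then have K: "\<bar>K\<bar> \<le> f * sqrt \<epsilon> * M" by (simp add: f_def)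
    then have mu: "\<bar>K\<bar> / sqrt \<epsilon> \<le> f * M" using s by (simp add: divide_le_eq mult_ac)
    have "f * sqrt \<epsilon> * M \<le> f * 1 * M" using s f M_nonneg by (intro mult_right_mono mult_left_mono) auto
    then have K1: "\<bar>K\<bar> \<le> f * M" using K by simp
    define R1 where "R1 = (\<lambda>p. grad u p - (H (0, 1) - H (0, - 1)) *\<^sub>R ((1 / (\<delta> + (fst p - 1 - \<epsilon> / 2)\<^sup>2)) *\<^sub>R (0, 1)
      + (1 / sqrt \<delta> * Sfun \<epsilon> \<delta> p) *\<^sub>R (1, 0)))"
    define R2 where "R2 = (\<lambda>p. grad u p - (K / sqrt \<epsilon> * sqrt \<epsilon> / (\<epsilon> + (snd p)\<^sup>2)) *\<^sub>R (1, 0))"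
    let ?A = "gapC * (4 * M + \<bar>K\<bar> + \<bar>P\<bar>) + 20 * \<bar>P\<bar> + 9 * exp 2 * M"
    let ?B = "gapC * (4 * M + \<bar>K\<bar>) + 20 * \<bar>K\<bar> + \<bar>K\<bar> / sqrt \<epsilon>"
    have "?A + ?B \<le> C * M"
    proof -
      have "gapC * (4 * M + \<bar>K\<bar> + \<bar>P\<bar>) \<le> gapC * (4 * M + f * M + 2 * M)"
        "gapC * (4 * M + \<bar>K\<bar>) \<le> gapC * (4 * M + f * M)"
        using K1 P_bound gapC_pos by (intro mult_left_mono; simp)+
      moreover have "20 * \<bar>P\<bar> \<le> 40 * M" "20 * \<bar>K\<bar> \<le> 20 * (f * M)" using P_bound K1 by simp_all
      ultimately have "?A + ?B \<le> (gapC * (4 * M + f * M + 2 * M) + 40 * M + 9 * exp 2 * M)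
        + (gapC * (4 * M + f * M) + 20 * (f * M) + f * M)"
        using mu by (intro add_mono order_refl)
      also have "\<dots> = C * M" by (simp add: C_def algebra_simps)
      finally show ?thesis .
    qed
    then have AB: "\<exists>A B. (\<forall>p\<in>Nh \<epsilon> \<delta>. norm (R1 p) \<le> A) \<and> (\<forall>p\<in>Nv \<epsilon>. norm (R2 p) \<le> B) \<and> A + B \<le> C * M"
      using grad_u_on_Nh(1) grad_u_on_Nv unfolding R1_def R2_def by (intro exI[of _ ?A] exI[of _ ?B]) blast
    have "\<bar>K / sqrt \<epsilon>\<bar> \<le> f * M" using mu s by (simp add: abs_divide)
    also have "\<dots> \<le> C * M" using fC M_nonneg by (rule mult_right_mono)
    finally have muC: "\<bar>K / sqrt \<epsilon>\<bar> \<le> C * M" .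
    show "\<exists>lam mu R1 R2.
          lam = H (0, 1) - H (0, -1)
        \<and> \<bar>mu\<bar> \<le> C * (SUP p\<in>Omega_m \<delta> 4. \<bar>H p\<bar>)
        \<and> (\<forall>p\<in>Nh \<epsilon> \<delta>. grad u p =
              lam *\<^sub>R ((1 / (\<delta> + (fst p - 1 - \<epsilon>/2)\<^sup>2)) *\<^sub>R (0, 1)
                    + (1 / sqrt \<delta> * Sfun \<epsilon> \<delta> p) *\<^sub>R (1, 0)) + R1 p)
        \<and> (\<forall>p\<in>Nv \<epsilon>. grad u p = (mu * sqrt \<epsilon> / (\<epsilon> + (snd p)\<^sup>2)) *\<^sub>R (1, 0) + R2 p)
        \<and> (\<exists>A B. (\<forall>p\<in>Nh \<epsilon> \<delta>. norm (R1 p) \<le> A) \<and> (\<forall>p\<in>Nv \<epsilon>. norm (R2 p) \<le> B)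
               \<and> A + B \<le> C * (SUP p\<in>Omega_m \<delta> 4. \<bar>H p\<bar>))"
      unfolding eM
    proof (rule exI[of _ "H (0, 1) - H (0, - 1)"], rule exI[of _ "K / sqrt \<epsilon>"], rule exI[of _ R1], rule exI[of _ R2],
        intro conjI ballI)
      show "\<bar>K / sqrt \<epsilon>\<bar> \<le> C * M" by (rule muC)
      show "\<exists>A B. (\<forall>p\<in>Nh \<epsilon> \<delta>. norm (R1 p) \<le> A) \<and> (\<forall>p\<in>Nv \<epsilon>. norm (R2 p) \<le> B) \<and> A + B \<le> C * M" by (rule AB)
    qed (simp_all add: R1_def R2_def)
  qed (use C \<epsilon>0 in auto)
qed

end
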